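(* There exists a system of polar coordinates in $\mathbb R^{n+1}$, generic with respect to the braid arrangement $\mathcal A(A_n)=\{H_{ij}=\{x_i=x_j\},\ 1\le i<j\le n+1\}$, such that a codimension-$k$ facet $F$ of $\mathcal A(A_n)$ meets the coordinate space $V_k$ if and only if the tableau which represents $F$ is in $\pi_k(A_n)$. Moreover, the induced (polar) order between codimension-$k$ facets intersecting $V_k$ equals the order defined on $\pi_k(A_n)$.
   Context: **Polar coordinates in $\mathbb R^N$ ($N=n+1$).** Given an origin $O$ and an orthonormal basis $\mathbf e_1,\dots,\mathbf e_N$, with Cartesian coordinates $y_1,\dots,y_N$ in this frame, the polar coordinates $\theta_0=\rho\ge0$, $\theta_1,\dots,\theta_{N-2}\in[0,\pi]$, $\theta_{N-1}\in(-\pi,\pi]$ satisfy $y_i=\rho\sin\theta_1\cdots\sin\theta_{i-1}\cos\theta_i$ for $i<N$, $y_N=\rho\sin\theta_1\cdots\sin\theta_{N-1}$ ($\theta_i:=0$ if $y_i=\dots=y_N=0$). $V_i=O+\langle\mathbf e_1,\dots,\mathbf e_i\rangle$. $V_i(\bar\theta_i,\dots,\bar\theta_{N-1})$ is the set of $P\notin V_{i-1}$ with $\theta_j(P)=\bar\theta_j$ for $j\ge i$ (convention: $\bar\theta_j\in\{0,\pi\}$ implies $\bar\theta_k=0$ for $k>j$), an open $i$-dimensional half-subspace with span $|V_i(\bar\theta)|$. $\tilde B(\delta)=\{P:\theta_i(P)\in(0,\delta),\,1\le i\le N-1,\ \rho(P)>0\}$. Facets of an arrangement are the classes of points having the same position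 (on or strictly on one side) with respect to each hyperplane. The system is generic with respect to an arrangement $\mathcal A$ if (i) $O$ lies in a chamber; (ii) for some $\delta\in(0,\pi/2)$ all bounded facets are contained in $\tilde B=\tilde B(\delta)$, and every facet meets $\tilde B$; (iii) every $V_i(\bar\theta)$ meeting $\mathrm{clos}(\tilde B)$ satisfies, for every codimension-$k$ intersection $L$ of hyperplanes of $\mathcal A$ with $i\ge k$: $V_i(\bar\theta)\cap L\cap\mathrm{clos}(\tilde B)\neq\emptyset$ and $\dim(|V_i(\bar\theta)|\cap L)=i-k$. A codimension-$k$ facet meeting $V_k$ meets it in a single point; the polar order between such facets is the anti-lexicographic order (lexicographic from the last coordinate) of the polar coordinates $(\theta_0,\dots,\theta_{N-1})$ of these points. **Tableaux.** $\mathbf T^{\mathbf k}(A_n)$ is the set of $k$-tableaux: tableaux with $n+1-k$ (left-aligned, nonempty, of arbitrary lengths) rows, filled bijectively with $1,\dots,n+1$, entries increasing along each row; $\mathbf T(A_n)=\bigcup_k\mathbf T^{\mathbf k}(A_n)$. A $k$-tableau represents the codimension-$k$ facet of points $(x_1,\dots,x_{n+1})$ with $x_i=x_j$ iff $i,j$ are in the same row, and $x_i<x_j$ iff the row of $i$ precedes the row of $j$. $T\prec T'$ means $\mathrm{clos}(F)\supseteq F'$ for the represented facets. *Moving.* $M_{j,r}(T)$ is obtained by moving the entry $r$ of $T$ to the $j$-th row; for $j=0$, $r$ becomes the only entry of a new first row. If $r$ is in the $i$-th row, $M_r(T)=\{M_{j,r}(T)\}_{0<j<i}$, ordered by decreasing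 $j$. *Projection, inclusion.* $p_{n,m}:\mathbf T(A_n)\to\mathbf T(A_m)$ forgets the entries $\ge m+2$ (deleting empty rows); $m_T$ is the minimum integer $0\le m\le n$ such that $p_{n,m}(T)$ is a tableau of the same dimension $k$ as $T$. $i_{m,n}:\mathbf T(A_m)\to\mathbf T(A_n)$ attaches below $T$ the one-box rows $m+2,\dots,n+1$ in this order. *T-blocks.* Let $e_i(T)$ be the first entry of the $i$-th row of the $k$-tableau $T$. If $m_T<n$ and $m_T+1-k<h\le n+1-k$, set $\mathcal Q_{n,h}(T)=\bigcup_{m_T+1-k<i\le h}M_{e_i(T)}(T_{i-1})$, where $T_{m_T+1-k}=T$, $T_i=M_{0,e_i(T)}(T_{i-1})$; it is ordered by the order of each $M_{e_i(T)}(T_{i-1})$, with those for smaller $i$ first. *Reflections.* For $T'\prec T$, $r_T(T')$ is the tableau of the facet opposite to (symmetric to) that of $T'$ with respect to the affine span of the facet of $T$: the rows of $T'$ composing each row of $T$ are listed in reverse order. If $\mathcal Q_{n,h}(T)=\{T_1,\dots,T_p\}$ in order, $r_{\mathcal Q_{n,h}(T)}(\overline T)=\overline T_p$, where $\overline T_0=\overline T$ and $\overline T_i=r_{T_i}(\overline T_{i-1})$ if $T_i\succ\overline T_{i-1}$, $\overline T_i=\overline T_{i-1}$ otherwise. *The ordered sets $\pi_k(A_n)$.* $\pi_0(A_n)$ consists of the one-column tableau with entries $1,\dots,n+1$ in increasing order. Given the ordered set $\pi_k(A_{n-1})=\{T_1,T_2,\dots\}$, set $T_{i,1}=i_{n-1,n}(T_i)$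 and $T_{i,j}=r_{\mathcal Q_{n,n+1-k}(T_{j-1,j-1})}(T_{i,j-1})$ for $2\le j\le i$; then $\pi_{k+1}(A_n)=\bigcup_i\mathcal Q_{n,n+1-k}(T_{i,i})$, ordered by $i$ first and then by the order inside each block. *)

theory Defs
  imports "HOL-Analysis.Analysis"
begin

section \<open>Facets and intersections of a hyperplane arrangement\<close>

text \<open>An arrangement is the set of its hyperplanes. Since \<^term>\<open>(a, b)\<close> and \<^term>\<open>(- a, - b)\<close> give
  the same hyperplane, the second disjunct covers both of its open sides.\<close>

definition same_position :: "'a::euclidean_space set \<Rightarrow> 'a \<Rightarrow> 'a \<Rightarrow> bool" where
  "same_position H x y \<longleftrightarrow>
     (x \<in> H \<and> y \<in> H) \<or>
     (\<exists>a b. a \<noteq> 0 \<and> H = {z. a \<bullet> z = b} \<and> a \<bullet> x < b \<and> a \<bullet> y < b)"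

definition facets :: "'a::euclidean_space set set \<Rightarrow> 'a set set" where
  "facets \<A> = UNIV // {(x, y). \<forall>H\<in>\<A>. same_position H x y}"

definition codim_facets :: "'a::euclidean_space set set \<Rightarrow> nat \<Rightarrow> 'a set set" where
  "codim_facets \<A> k = {F \<in> facets \<A>. aff_dim F = int (DIM('a)) - int k}"

text \<open>The chambers are the facets of codimension 0. The whole space is the intersection of the
  empty family of hyperplanes, of codimension 0.\<close>

definition codim_flats :: "'a::euclidean_space set set \<Rightarrow> nat \<Rightarrow> 'a set set" where
  "codim_flats \<A> k =
     {L. (\<exists>\<B>\<subseteq>\<A>. L = \<Inter>\<B>) \<and> L \<noteq> {} \<and> aff_dim L = int (DIM('a)) - int k}"


section \<open>Polar coordinates\<close>

text \<open>The dimension is \<open>N = DIM('a)\<close>; the frame is \<open>e 1, \<dots>, e N\<close>. The values of a coordinate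
  vector \<^term>\<open>\<theta> :: nat \<Rightarrow> real\<close> at indices \<open>\<ge> N\<close> are meaningless and set to 0, so that \<open>\<theta>\<close> is
  determined by the point when \<open>N \<ge> 2\<close>.\<close>

definition orthonormal_frame :: "(nat \<Rightarrow> 'a::euclidean_space) \<Rightarrow> bool" where
  "orthonormal_frame e \<longleftrightarrow>
     (\<forall>i\<in>{1..DIM('a)}. \<forall>j\<in>{1..DIM('a)}. e i \<bullet> e j = (if i = j then 1 else 0))"

definition is_polar_coords :: "nat \<Rightarrow> (nat \<Rightarrow> real) \<Rightarrow> (nat \<Rightarrow> real) \<Rightarrow> bool" where
  "is_polar_coords N y \<theta> \<longleftrightarrow>
     0 \<le> \<theta> 0 \<and>
     (\<forall>i. 1 \<le> i \<and> i + 2 \<le> N \<longrightarrow> \<theta> i \<in> {0..pi}) \<and>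
     \<theta> (N - 1) \<in> {- pi<..pi} \<and>
     (\<forall>i\<in>{1..<N}. y i = \<theta> 0 * (\<Prod>j=1..<i. sin (\<theta> j)) * cos (\<theta> i)) \<and>
     y N = \<theta> 0 * (\<Prod>j=1..<N. sin (\<theta> j)) \<and>
     (\<forall>i\<in>{1..<N}. (\<forall>j\<in>{i..N}. y j = 0) \<longrightarrow> \<theta> i = 0) \<and>
     (\<forall>i\<ge>N. \<theta> i = 0)"

definition polar :: "'a::euclidean_space \<Rightarrow> (nat \<Rightarrow> 'a) \<Rightarrow> 'a \<Rightarrow> nat \<Rightarrow> real" where
  "polar org e P = (THE \<theta>. is_polar_coords (DIM('a)) (\<lambda>i. (P - org) \<bullet> e i) \<theta>)"

definition coord_space :: "'a::euclidean_space \<Rightarrow> (nat \<Rightarrow> 'a) \<Rightarrow> nat \<Rightarrow> 'a set" where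
  "coord_space org e i = {org + v |v. v \<in> span (e ` {1..i})}"

definition angle_convention :: "nat \<Rightarrow> nat \<Rightarrow> (nat \<Rightarrow> real) \<Rightarrow> bool" where
  "angle_convention N i th \<longleftrightarrow>
     (\<forall>j\<in>{i..<N}. th j \<in> {0, pi} \<longrightarrow> (\<forall>k\<in>{j<..<N}. th k = 0))"

text \<open>\<open>V\<^sub>i(\<theta>\<^sub>i, \<dots>, \<theta>\<^sub>N\<^sub>-\<^sub>1)\<close> for \<open>1 \<le> i \<le> N\<close>; only the values of \<^term>\<open>th\<close> at \<open>i, \<dots>, N - 1\<close> are used.\<close>

definition half_subspace ::
    "'a::euclidean_space \<Rightarrow> (nat \<Rightarrow> 'a) \<Rightarrow> nat \<Rightarrow> (nat \<Rightarrow> real) \<Rightarrow> 'a set" where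
  "half_subspace org e i th =
     {P. P \<notin> coord_space org e (i - 1) \<and> (\<forall>j\<in>{i..<DIM('a)}. polar org e P j = th j)}"

definition polar_sector :: "'a::euclidean_space \<Rightarrow> (nat \<Rightarrow> 'a) \<Rightarrow> real \<Rightarrow> 'a set" where
  "polar_sector org e \<delta> =
     {P. (\<forall>i\<in>{1..<DIM('a)}. polar org e P i \<in> {0<..<\<delta>}) \<and> 0 < polar org e P 0}"

definition generic_polar ::
    "'a::euclidean_space set set \<Rightarrow> 'a \<Rightarrow> (nat \<Rightarrow> 'a) \<Rightarrow> bool" where
  "generic_polar \<A> org e \<longleftrightarrow>
     (\<exists>C\<in>codim_facets \<A> 0. org \<in> C) \<and>
     (\<exists>\<delta>\<in>{0<..<pi/2}.
        (\<forall>F\<in>facets \<A>. bounded F \<longrightarrow> F \<subseteq> polar_sector org e \<delta>) \<and>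
        (\<forall>F\<in>facets \<A>. F \<inter> polar_sector org e \<delta> \<noteq> {}) \<and>
        (\<forall>i\<in>{1..DIM('a)}. \<forall>th.
           angle_convention (DIM('a)) i th \<and>
           half_subspace org e i th \<inter> closure (polar_sector org e \<delta>) \<noteq> {} \<longrightarrow>
           (\<forall>k\<le>i. \<forall>L\<in>codim_flats \<A> k.
              half_subspace org e i th \<inter> L \<inter> closure (polar_sector org e \<delta>) \<noteq> {} \<and>
              aff_dim (affine hull (half_subspace org e i th) \<inter> L) = int i - int k)))"

definition polar_less ::
    "'a::euclidean_space \<Rightarrow> (nat \<Rightarrow> 'a) \<Rightarrow> 'a \<Rightarrow> 'a \<Rightarrow> bool" where
  "polar_less org e P P' \<longleftrightarrow>
     (\<exists>j<DIM('a). polar org e P j < polar org e P' j \<and>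
        (\<forall>m\<in>{j<..<DIM('a)}. polar org e P m = polar org e P' m))"

text \<open>For facets of codimension \<open>k\<close> that meet \<open>V\<^sub>k\<close>, necessarily in a single point when the system
  is generic.\<close>

definition polar_facet_less ::
    "'a::euclidean_space \<Rightarrow> (nat \<Rightarrow> 'a) \<Rightarrow> nat \<Rightarrow> 'a set \<Rightarrow> 'a set \<Rightarrow> bool" where
  "polar_facet_less org e k F F' \<longleftrightarrow>
     polar_less org e (the_elem (F \<inter> coord_space org e k)) (the_elem (F' \<inter> coord_space org e k))"


section \<open>Tableaux\<close>

text \<open>A tableau is the list of its rows. Rows are numbered from 1, so row \<open>i\<close> of \<open>T\<close> is
  \<^term>\<open>T ! (i - 1)\<close>.\<close>

type_synonym tableau = "nat list list"

definition is_tableau :: "nat \<Rightarrow> nat \<Rightarrow> tableau \<Rightarrow> bool" where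
  "is_tableau k n T \<longleftrightarrow>
     length T + k = n + 1 \<and>
     (\<forall>R\<in>set T. R \<noteq> [] \<and> sorted_wrt (<) R) \<and>
     distinct (concat T) \<and> set (concat T) = {1..n+1}"

definition row_of :: "tableau \<Rightarrow> nat \<Rightarrow> nat" where
  "row_of T r = (THE i. i \<in> {1..length T} \<and> r \<in> set (T ! (i - 1)))"

text \<open>The facet represented by \<open>T\<close>, as a cylinder in \<open>nat \<Rightarrow> real\<close>: the coordinates that are not
  entries of \<open>T\<close> are unconstrained. Tableaux of all sizes thus live in one space, and for two
  tableaux with the same entries, inclusions between (closures of) the cylinders are equivalent to
  those between the finite-dimensional facets.\<close>

definition tableau_cell :: "tableau \<Rightarrow> (nat \<Rightarrow> real) set" where
  "tableau_cell T =
     {x. \<forall>i\<in>set (concat T). \<forall>j\<in>set (concat T).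
           (x i = x j \<longleftrightarrow> row_of T i = row_of T j) \<and>
           (x i < x j \<longleftrightarrow> row_of T i < row_of T j)}"

definition tab_prec :: "tableau \<Rightarrow> tableau \<Rightarrow> bool"  (infix "\<prec>\<^sub>T" 50) where
  "T \<prec>\<^sub>T T' \<longleftrightarrow> tableau_cell T' \<subseteq> closure (tableau_cell T)"

definition remove_empty :: "tableau \<Rightarrow> tableau" where
  "remove_empty T = filter (\<lambda>R. R \<noteq> []) T"

definition move :: "nat \<Rightarrow> nat \<Rightarrow> tableau \<Rightarrow> tableau" where
  "move j r T =
     (let U = map (removeAll r) T
      in if j = 0 then [r] # remove_empty U
         else remove_empty (U[j - 1 := insort r (U ! (j - 1))]))"

definition moves :: "nat \<Rightarrow> tableau \<Rightarrow> tableau list" where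
  "moves r T = map (\<lambda>j. move j r T) (rev [1..<row_of T r])"

definition proj_tab :: "nat \<Rightarrow> tableau \<Rightarrow> tableau" where
  "proj_tab m T = remove_empty (map (filter (\<lambda>r. r < m + 2)) T)"

definition incl_tab :: "nat \<Rightarrow> nat \<Rightarrow> tableau \<Rightarrow> tableau" where
  "incl_tab m n T = T @ map (\<lambda>r. [r]) [m+2..<n+2]"

definition min_level :: "nat \<Rightarrow> nat \<Rightarrow> tableau \<Rightarrow> nat" where
  "min_level k n T = (LEAST m. m \<le> n \<and> is_tableau k m (proj_tab m T))"

definition first_entry :: "tableau \<Rightarrow> nat \<Rightarrow> nat" where
  "first_entry T i = hd (T ! (i - 1))"

text \<open>\<^term>\<open>block_tab T s d\<close> is \<open>T\<^sub>s\<^sub>+\<^sub>d\<close> in the recursion \<open>T\<^sub>s = T\<close>, \<open>T\<^sub>i = M\<^sub>0\<^sub>,\<^sub>e\<^sub>i\<^sub>(\<^sub>T\<^sub>)(T\<^sub>i\<^sub>-\<^sub>1)\<close>; the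
  entries moved are read off the initial \<open>T\<close>.\<close>

primrec block_tab :: "tableau \<Rightarrow> nat \<Rightarrow> nat \<Rightarrow> tableau" where
  "block_tab T s 0 = T"
| "block_tab T s (Suc d) = move 0 (first_entry T (s + Suc d)) (block_tab T s d)"

definition block :: "nat \<Rightarrow> nat \<Rightarrow> nat \<Rightarrow> tableau \<Rightarrow> tableau list" where
  "block k n h T =
     (let s = min_level k n T + 1 - k
      in concat (map (\<lambda>i. moves (first_entry T i) (block_tab T s (i - 1 - s))) [s+1..<h+1]))"

definition reflect :: "tableau \<Rightarrow> tableau \<Rightarrow> tableau" where
  "reflect T T' = concat (map (\<lambda>R. rev (filter (\<lambda>R'. set R' \<subseteq> set R) T')) T)"

definition reflect_block :: "tableau list \<Rightarrow> tableau \<Rightarrow> tableau" where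
  "reflect_block Q T = foldl (\<lambda>U Ti. if U \<prec>\<^sub>T Ti then reflect Ti U else U) T Q"

text \<open>With \<open>Ts = [T\<^sub>1, T\<^sub>2, \<dots>] = \<pi>\<^sub>k(A\<^sub>n\<^sub>-\<^sub>1)\<close>, \<^term>\<open>iter_tab k n Ts i j\<close> is \<open>T\<^sub>i\<^sub>,\<^sub>j\<close> for \<open>1 \<le> j \<le> i\<close>;
  the value at \<open>j = 0\<close> is not used.\<close>

fun iter_tab :: "nat \<Rightarrow> nat \<Rightarrow> tableau list \<Rightarrow> nat \<Rightarrow> nat \<Rightarrow> tableau" where
  "iter_tab k n Ts i 0 = []"
| "iter_tab k n Ts i (Suc 0) = incl_tab (n - 1) n (Ts ! (i - 1))"
| "iter_tab k n Ts i (Suc (Suc j)) =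
     reflect_block (block k n (n + 1 - k) (iter_tab k n Ts (Suc j) (Suc j)))
                   (iter_tab k n Ts i (Suc j))"

text \<open>\<^term>\<open>pi_tab k n\<close> lists \<open>\<pi>\<^sub>k(A\<^sub>n)\<close>, \<open>0 \<le> k \<le> n\<close>, in its order.\<close>

fun pi_tab :: "nat \<Rightarrow> nat \<Rightarrow> tableau list" where
  "pi_tab 0 n = [map (\<lambda>r. [r]) [1..<n+2]]"
| "pi_tab (Suc k) 0 = []"
| "pi_tab (Suc k) (Suc n) =
     (let Ts = pi_tab k n
      in concat (map (\<lambda>i. block k (Suc n) (Suc n + 1 - k) (iter_tab k (Suc n) Ts i i))
                     [1..<length Ts + 1]))"

definition listed_before :: "'b list \<Rightarrow> 'b \<Rightarrow> 'b \<Rightarrow> bool" where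
  "listed_before xs a b \<longleftrightarrow> (\<exists>i j. i < j \<and> j < length xs \<and> xs ! i = a \<and> xs ! j = b)"


section \<open>The braid arrangement\<close>

text \<open>The coordinates \<open>x\<^sub>1, \<dots>, x\<^sub>n\<^sub>+\<^sub>1\<close> of \<open>x :: real ^ 'n\<close> are \<open>x $ idx 1, \<dots>, x $ idx (n + 1)\<close>, where
  \<open>idx\<close> is a bijection from \<open>{1..n+1}\<close> onto the index type.\<close>

definition braid :: "(nat \<Rightarrow> 'n::finite) \<Rightarrow> nat \<Rightarrow> (real ^ 'n) set set" where
  "braid idx n = {{x. x $ idx i = x $ idx j} |i j. 1 \<le> i \<and> i < j \<and> j \<le> n + 1}"

definition represents :: "(nat \<Rightarrow> 'n::finite) \<Rightarrow> tableau \<Rightarrow> (real ^ 'n) set \<Rightarrow> bool" where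
  "represents idx T F \<longleftrightarrow> F = {x. (\<lambda>i. x $ idx i) \<in> tableau_cell T}"

definition tableau_of ::
    "(nat \<Rightarrow> 'n::finite) \<Rightarrow> nat \<Rightarrow> nat \<Rightarrow> (real ^ 'n) set \<Rightarrow> tableau" where
  "tableau_of idx k n F = (THE T. is_tableau k n T \<and> represents idx T F)"

end

theory Submission
  imports Defs
begin

text \<open>A codimension \<open>k\<close> flat of the braid arrangement is coded by the list of pairs \<open>(b, c)\<close>, where \<open>b\<close>
  is an entry that is not minimal in its block and \<open>c\<close> is the minimum of that block, the largest \<open>b\<close>
  first. The tableau of the list \<open>\<pi>\<^sub>k\<close> that lies on this flat orders the blocks by signed minima,
  where each \<open>b\<close> in the code contributes a sign change for the smaller minima; the order of \<open>\<pi>\<^sub>k\<close>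
  is lexicographic in the pairs, the smallest \<open>b\<close> first.

  For the geometry let \<open>x\<^sub>d = - \<beta>\<^sub>d p(s\<^sub>d)\<close> for polynomials \<open>p\<close>, where \<open>\<beta>\<^sub>1 = 0\<close>, the \<open>\<beta>\<^sub>d\<close> grow fast
  and the \<open>s\<^sub>d < 0\<close> tend to 0 fast. Polynomials of degree less than \<open>k\<close> span the direction of \<open>V\<^sub>k\<close>,
  and a codimension \<open>k\<close> flat contains a unique monic polynomial of degree \<open>k\<close>, close to
  \<open>\<Prod>(X - s\<^sub>b)\<close>. Its sign pattern gives the tableau, and its second coefficient (the sum of its roots)
  gives the polar order. All this is proved by adding one entry at a time, with \<open>s\<close> tending to 0. Moving along
  the line that a flat cuts out of \<open>V\<^sub>k\<^sub>+\<^sub>1\<close> turns the reflections in the definition of \<open>\<pi>\<^sub>k\<close> into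
  the crossings of that line with the smaller flats.

  For any flag that is transversal to all flats of a central arrangement, with orthonormal frame \<open>e\<close>, the origin
  \<open>- \<Sum>\<epsilon>\<^sup>i e\<^sub>i\<close> gives generic polar coordinates for all small \<open>\<epsilon>\<close>, and then the point of \<open>V\<^sub>k\<close> on a
  flat of codimension \<open>k\<close> is governed by the intersection of this flat with the span of \<open>e\<^sub>1, \<dots>, e\<^sub>k\<^sub>+\<^sub>1\<close>.\<close>

section \<open>Tableaux as ordered partitions\<close>

text \<open>One polynomial per code would not survive the induction: when the parameter of the
  newest entry tends to 0, the polynomial of a code that contains this entry acquires a root at 0 in
  the limit. Hence the induction treats a code \<open>P\<close> together with an exponent
  \<open>l\<close>, and a monic polynomial of degree \<open>length P + l\<close> divisible by X^l,
  where X^l stands for \<open>l\<close> roots that have already reached 0. The polynomial of a new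
  code is that of its tail with exponent \<open>l + 1\<close> plus a small positive multiple
  \<open>tau\<close> of the one with exponent \<open>l\<close>. The main term carries the sign
  (-1)^(l+1), and this produces the sign changes of the weights. The correction \<open>tau\<close>,
  which gets smaller as the weight of the chosen minimum grows, orders codes that have the same
  limit. In this way codes of different lengths become comparable, which is why the order of codes
  also places a code before its proper suffixes. On the geometric side there are only finitely many
  flats, so a single small \<epsilon> satisfies all the conditions at once.\<close>

definition ordered_rows :: "(nat \<Rightarrow> 'b::linorder) \<Rightarrow> nat set \<Rightarrow> tableau \<Rightarrow> bool" where
  "ordered_rows v A T \<longleftrightarrow>
     (\<forall>R\<in>set T. R \<noteq> [] \<and> sorted_wrt (<) R \<and> (\<forall>a\<in>set R. \<forall>b\<in>set R. v a = v b)) \<and>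
     (\<Union>R\<in>set T. set R) = A \<and>
     sorted_wrt (\<lambda>R R'. \<forall>a\<in>set R. \<forall>b\<in>set R'. v a < v b) T"

text \<open>A tableau on \<open>A\<close> is a weak order, and a weight is a convenient carrier of
  one. Tableau operations thus become operations on weights, whose values may be row numbers,
  integers or reals.\<close>

definition level_rows :: "(nat \<Rightarrow> 'b::linorder) \<Rightarrow> nat set \<Rightarrow> tableau" where
  "level_rows v A = map (\<lambda>y. sorted_list_of_set {a\<in>A. v a = y}) (sorted_list_of_set (v ` A))"

lemma ordered_rows_level_rows:
  assumes "finite A"
  shows "ordered_rows v A (level_rows v A)"
proof -
  have s: "set (sorted_list_of_set {a\<in>A. v a = y}) = {a\<in>A. v a = y}" for y
    using assms by simp
  have "sorted_list_of_set {a\<in>A. v a = y} \<noteq> []" if "y \<in> v ` A" for y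
    using s[of y] that by (metis (mono_tags, lifting) empty_Collect_eq empty_set image_iff)
  moreover have "sorted_wrt (\<lambda>R R'. \<forall>a\<in>set R. \<forall>b\<in>set R'. v a < v b) (level_rows v A)"
    unfolding level_rows_def sorted_wrt_map s
    by (rule sorted_wrt_mono_rel[OF _ strict_sorted_list_of_set]) simp
  moreover have "(\<Union>R\<in>set (level_rows v A). set R) = A"
    using assms s by (auto simp: level_rows_def)
  ultimately show ?thesis
    using assms unfolding ordered_rows_def by (simp add: level_rows_def)
qed

lemma sorted_rows_eq:
  fixes v :: "nat \<Rightarrow> 'b::linorder"
  assumes "sorted_wrt (\<lambda>R R'. \<forall>a\<in>set R. \<forall>b\<in>set R'. v a < v b) T"
    and "R \<in> set T" "R' \<in> set T" "a \<in> set R" "b \<in> set R'" "v a = v b"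
  shows "R = R'"
proof -
  obtain i j where ij: "i < length T" "T ! i = R" "j < length T" "T ! j = R'"
    using assms(2,3) by (metis in_set_conv_nth)
  have "\<not> i < j"
  proof
    assume "i < j"
    then have "v a < v b" using sorted_wrt_nth_less[OF assms(1), of i j] ij assms(4,5) by blast
    then show False using assms(6) by simp
  qed
  moreover have "\<not> j < i"
  proof
    assume "j < i"
    then have "v b < v a" using sorted_wrt_nth_less[OF assms(1), of j i] ij assms(4,5) by blast
    then show False using assms(6) by simp
  qed
  ultimately have "i = j" by simp
  then show ?thesis using ij by simp
qed

text \<open>The heads of the rows run through the values of \<open>v\<close> in strictly increasing
  order, and each row is an entire level set in increasing order, so nothing in the list is left to
  choose.\<close>

lemma ordered_rows_unique:
  assumes "ordered_rows v A T"
  shows "T = level_rows v A"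
proof -
  have ne: "R \<noteq> []" "sorted_wrt (<) R" "\<And>a b. a \<in> set R \<Longrightarrow> b \<in> set R \<Longrightarrow> v a = v b" if "R \<in> set T" for R
    using assms that unfolding ordered_rows_def by blast+
  have A: "A = (\<Union>R\<in>set T. set R)" and
    sw: "sorted_wrt (\<lambda>R R'. \<forall>a\<in>set R. \<forall>b\<in>set R'. v a < v b) T"
    using assms unfolding ordered_rows_def by auto
  have finA: "finite A" unfolding A by auto
  have "sorted_wrt (\<lambda>R R'. v (hd R) < v (hd R')) T"
    by (rule sorted_wrt_mono_rel[OF _ sw]) (use ne(1) hd_in_set in blast)
  then have s1: "sorted_wrt (<) (map (\<lambda>R. v (hd R)) T)"
    by (simp add: sorted_wrt_map)
  have set1: "set (map (\<lambda>R. v (hd R)) T) = v ` A"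
  proof (intro equalityI subsetI)
    fix y assume "y \<in> set (map (\<lambda>R. v (hd R)) T)"
    then obtain R where "R \<in> set T" "y = v (hd R)" by auto
    then show "y \<in> v ` A" using ne(1)[of R] A by (auto intro!: imageI bexI[of _ R])
  next
    fix y assume "y \<in> v ` A"
    then obtain a R where "a \<in> set R" "R \<in> set T" "y = v a" using A by auto
    then show "y \<in> set (map (\<lambda>R. v (hd R)) T)"
      using ne(1)[of R] ne(3)[of R a "hd R"] by (auto intro!: image_eqI[of _ _ R])
  qed
  have m1: "sorted_list_of_set (v ` A) = map (\<lambda>R. v (hd R)) T"
    using s1 set1 finA
    by (metis finite_imageI sorted_list_of_set.idem_if_sorted_distinct strict_sorted_iff)
  have row: "sorted_list_of_set {a\<in>A. v a = v (hd R)} = R" if "R \<in> set T" for R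
  proof -
    have "{a\<in>A. v a = v (hd R)} = set R"
    proof (intro equalityI subsetI)
      fix a assume "a \<in> {a\<in>A. v a = v (hd R)}"
      then obtain R' where R': "R' \<in> set T" "a \<in> set R'" "v a = v (hd R)" using A by auto
      have hR: "hd R \<in> set R" using ne(1)[OF that] by auto
      show "a \<in> set R" using sorted_rows_eq[OF sw R'(1) that R'(2) hR R'(3)] R'(2) by simp
    next
      fix a assume "a \<in> set R"
      then show "a \<in> {a\<in>A. v a = v (hd R)}" using that A ne(1)[OF that] ne(3)[OF that, of a "hd R"] by auto
    qed
    then show ?thesis
      using ne(2)[OF that] by (metis sorted_list_of_set.idem_if_sorted_distinct strict_sorted_iff)
  qed
  show ?thesis unfolding level_rows_def m1 map_map comp_def
    using row by (simp add: map_idI)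
qed

text \<open>Strict comparisons also decide equality, since a tie means that neither entry is
  smaller. This is the bridge between combinatorial weights, values of polynomials and coordinates
  of points.\<close>

lemma level_rows_eqI:
  assumes "finite A" "\<And>a b. a \<in> A \<Longrightarrow> b \<in> A \<Longrightarrow> v a < v b \<longleftrightarrow> w a < w b"
  shows "level_rows v A = level_rows w A"
proof (rule ordered_rows_unique)
  have eq: "v a = v b \<longleftrightarrow> w a = w b" if "a \<in> A" "b \<in> A" for a b
    using assms(2)[OF that] assms(2)[OF that(2,1)] by (metis linorder_neqE order_less_irrefl)
  have o: "ordered_rows v A (level_rows v A)" by (rule ordered_rows_level_rows) fact
  then have sub: "a \<in> A" if "R \<in> set (level_rows v A)" "a \<in> set R" for a R
    using that unfolding ordered_rows_def by auto
  show "ordered_rows w A (level_rows v A)"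
    unfolding ordered_rows_def
  proof (intro conjI ballI)
    show "sorted_wrt (\<lambda>R R'. \<forall>a\<in>set R. \<forall>b\<in>set R'. w a < w b) (level_rows v A)"
      by (rule sorted_wrt_mono_rel[of _ "\<lambda>R R'. \<forall>a\<in>set R. \<forall>b\<in>set R'. v a < v b"])
        (use o sub assms(2) in \<open>auto simp: ordered_rows_def\<close>)
    show "(\<Union>R\<in>set (level_rows v A). set R) = A" using o unfolding ordered_rows_def by blast
  next
    fix R assume R: "R \<in> set (level_rows v A)"
    show "R \<noteq> []" "sorted_wrt (<) R" using o R unfolding ordered_rows_def by blast+
    fix a b assume "a \<in> set R" "b \<in> set R"
    moreover from this have "v a = v b" using o R unfolding ordered_rows_def by blast
    ultimately show "w a = w b" using eq sub[OF R] by blast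
  qed
qed

lemma level_rows_Un:
  assumes "finite A" "finite B" "\<And>a b. a \<in> A \<Longrightarrow> b \<in> B \<Longrightarrow> v a < v b"
  shows "level_rows v (A \<union> B) = level_rows v A @ level_rows v B"
proof -
  have o: "ordered_rows v A (level_rows v A)" "ordered_rows v B (level_rows v B)"
    using assms ordered_rows_level_rows by blast+
  have "\<forall>R\<in>set (level_rows v A). \<forall>R'\<in>set (level_rows v B). \<forall>a\<in>set R. \<forall>b\<in>set R'. v a < v b"
    using o assms(3) unfolding ordered_rows_def by blast
  then have "sorted_wrt (\<lambda>R R'. \<forall>a\<in>set R. \<forall>b\<in>set R'. v a < v b) (level_rows v A @ level_rows v B)"
    using o unfolding sorted_wrt_append ordered_rows_def by blast
  moreover have "(\<Union>R\<in>set (level_rows v A @ level_rows v B). set R) = A \<union> B"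
    using o unfolding ordered_rows_def by simp
  ultimately have "ordered_rows v (A \<union> B) (level_rows v A @ level_rows v B)"
    using o unfolding ordered_rows_def set_append by blast
  then show ?thesis by (rule ordered_rows_unique[symmetric])
qed

lemma level_rows_singleton: "level_rows v {a} = [[a]]"
  by (rule ordered_rows_unique[symmetric]) (simp add: ordered_rows_def)

lemma level_rows_empty [simp]: "level_rows v {} = []"
  by (simp add: level_rows_def)

lemma level_rows_upt:
  assumes "\<And>a b. l \<le> a \<Longrightarrow> a < b \<Longrightarrow> b < m \<Longrightarrow> v a < v b"
  shows "level_rows v {l..<m} = map (\<lambda>r. [r]) [l..<m]"
proof -
  have "ordered_rows v {l..<m} (map (\<lambda>r. [r]) [l..<m])"
    unfolding ordered_rows_def
    by (auto simp: sorted_wrt_map intro!: sorted_wrt_mono_rel[OF _ sorted_wrt_upt[of l m]] assms)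
  then show ?thesis by (rule ordered_rows_unique[symmetric])
qed

lemma length_level_rows: "length (level_rows v A) = card (v ` A)"
  by (simp add: level_rows_def)

lemma set_level_rows_sub: "finite A \<Longrightarrow> R \<in> set (level_rows v A) \<Longrightarrow> a \<in> set R \<Longrightarrow> a \<in> A"
  using ordered_rows_level_rows[of A v] unfolding ordered_rows_def by blast

lemma level_rows_nonempty_row: "finite A \<Longrightarrow> R \<in> set (level_rows v A) \<Longrightarrow> R \<noteq> []"
  using ordered_rows_level_rows[of A v] unfolding ordered_rows_def by blast

lemma set_concat_level_rows: "finite A \<Longrightarrow> set (concat (level_rows v A)) = A"
  using ordered_rows_level_rows[of A v] unfolding ordered_rows_def set_concat by blast

lemma distinct_concat_ordered:
  assumes "ordered_rows v A T" shows "distinct (concat T)"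
proof -
  have "distinct (concat T)" if "\<forall>R\<in>set T. R \<noteq> [] \<and> sorted_wrt (<) R"
     "sorted_wrt (\<lambda>R R'. \<forall>a\<in>set R. \<forall>b\<in>set R'. v a < v b) T" for T :: tableau
    using that
  proof (induction T)
    case (Cons R T)
    then have "distinct R" using strict_sorted_iff[of R] by auto
    moreover have "set R \<inter> set (concat T) = {}" using Cons.prems(2) by fastforce
    ultimately show ?case using Cons by auto
  qed simp
  then show ?thesis using assms unfolding ordered_rows_def by blast
qed

lemma is_tableau_level_rows:
  assumes "card (v ` {1..n+1}) + k = n + 1"
  shows "is_tableau k n (level_rows v {1..n+1})"
proof -
  have o: "ordered_rows v {1..n+1} (level_rows v {1..n+1})" by (simp add: ordered_rows_level_rows)
  then have "\<forall>R\<in>set (level_rows v {1..n+1}). R \<noteq> [] \<and> sorted_wrt (<) R"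
    unfolding ordered_rows_def by blast
  then show ?thesis
    unfolding is_tableau_def length_level_rows
    using assms distinct_concat_ordered[OF o] set_concat_level_rows[of "{1..n+1}" v] by simp
qed

lemma row_of_eqI:
  assumes "distinct (concat T)" "\<forall>R\<in>set T. R \<noteq> []" "i < length T" "r \<in> set (T ! i)"
  shows "row_of T r = Suc i"
proof -
  have uniq: "j = i" if "j < length T" "r \<in> set (T ! j)" for j
  proof (rule ccontr)
    assume "j \<noteq> i"
    define a b where "a = min i j" and "b = max i j"
    have ab: "a < b" "b < length T" "r \<in> set (T ! a)" "r \<in> set (T ! b)"
      using \<open>j \<noteq> i\<close> that assms by (auto simp: a_def b_def min_def max_def)
    have "T = take b T @ T ! b # drop (Suc b) T" using ab by (simp add: id_take_nth_drop)
    then have "concat T = concat (take b T) @ T ! b @ concat (drop (Suc b) T)"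
      by (metis concat.simps(2) concat_append)
    then have "set (concat (take b T)) \<inter> set (T ! b) = {}"
      using assms(1) by auto
    moreover have "T ! a \<in> set (take b T)" using ab by (metis in_set_conv_nth length_take min.absorb4 nth_take)
    ultimately show False using ab by auto
  qed
  show ?thesis
    unfolding row_of_def
  proof (intro the_equality)
    show "Suc i \<in> {1..length T} \<and> r \<in> set (T ! (Suc i - 1))" using assms by auto
  next
    fix j assume "j \<in> {1..length T} \<and> r \<in> set (T ! (j - 1))"
    then show "j = Suc i" using uniq[of "j - 1"] by (cases j) auto
  qed
qed

lemma row_of_ordered:
  assumes "ordered_rows v A T" "a \<in> A" "b \<in> A"
  shows "row_of T a < row_of T b \<longleftrightarrow> v a < v b"
proof -
  have T: "distinct (concat T)" "\<forall>R\<in>set T. R \<noteq> []"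
    using distinct_concat_ordered[OF assms(1)] assms(1) by (auto simp: ordered_rows_def)
  obtain R R' where "R \<in> set T" "a \<in> set R" "R' \<in> set T" "b \<in> set R'"
    using assms unfolding ordered_rows_def by blast
  then obtain i j where ij: "i < length T" "a \<in> set (T ! i)" "j < length T" "b \<in> set (T ! j)"
    by (metis in_set_conv_nth)
  have r: "row_of T a = Suc i" "row_of T b = Suc j"
    using row_of_eqI[OF T] ij by auto
  have sw: "sorted_wrt (\<lambda>R R'. \<forall>a\<in>set R. \<forall>b\<in>set R'. v a < v b) T"
    and cst: "\<And>R a b. R \<in> set T \<Longrightarrow> a \<in> set R \<Longrightarrow> b \<in> set R \<Longrightarrow> v a = v b"
    using assms(1) unfolding ordered_rows_def by blast+
  consider "i < j" | "i = j" | "j < i" by linarith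
  then show ?thesis
  proof cases
    case 1 then show ?thesis using sorted_wrt_nth_less[OF sw, of i j] ij r by auto
  next
    case 2 then show ?thesis using cst[of "T!i" a b] ij r by auto
  next
    case 3 then show ?thesis using sorted_wrt_nth_less[OF sw, of j i] ij r by (auto dest: order_less_asym)
  qed
qed

lemma row_of_level_rows:
  assumes "finite A" "a \<in> A" "b \<in> A"
  shows "row_of (level_rows v A) a < row_of (level_rows v A) b \<longleftrightarrow> v a < v b"
  using row_of_ordered[OF ordered_rows_level_rows[OF assms(1)] assms(2,3)] .

text \<open>Taking the row number as weight puts any tableau into normal form, so that uniqueness of
  the representing tableau becomes a comparison of weights.\<close>

lemma is_tableau_eq_level_rows:
  assumes "is_tableau k n T"
  shows "T = level_rows (row_of T) {1..n+1}"
proof (rule ordered_rows_unique)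
  have T: "distinct (concat T)" "\<forall>R\<in>set T. R \<noteq> []" "\<forall>R\<in>set T. sorted_wrt (<) R" "(\<Union>R\<in>set T. set R) = {1..n+1}"
    using assms unfolding is_tableau_def by auto
  note r = row_of_eqI[OF T(1,2)]
  have c: "row_of T a = row_of T b" if "R \<in> set T" "a \<in> set R" "b \<in> set R" for R a b
    using that r by (metis in_set_conv_nth)
  show "ordered_rows (row_of T) {1..n+1} T"
    unfolding ordered_rows_def
  proof (intro conjI ballI)
    show "sorted_wrt (\<lambda>R R'. \<forall>a\<in>set R. \<forall>b\<in>set R'. row_of T a < row_of T b) T"
      unfolding sorted_wrt_iff_nth_less
    proof (intro allI impI ballI)
      fix i j a b assume *: "i < j" "j < length T" "a \<in> set (T ! i)" "b \<in> set (T ! j)"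
      then have "row_of T a = Suc i" "row_of T b = Suc j" using r by simp_all
      then show "row_of T a < row_of T b" using * by simp
    qed
  qed (use T c in blast)+
qed

lemma tableau_cell_level_rows:
  assumes "finite A"
  shows "tableau_cell (level_rows v A) = {x. \<forall>i\<in>A. \<forall>j\<in>A. x i < x j \<longleftrightarrow> v i < v j}"
proof -
  have eq: "row_of (level_rows v A) i = row_of (level_rows v A) j \<longleftrightarrow> v i = v j" if "i \<in> A" "j \<in> A" for i j
    using row_of_level_rows[OF assms that, of v] row_of_level_rows[OF assms that(2,1), of v]
    by (metis linorder_neqE order_less_irrefl)
  have eq2: "(x i = x j) = (v i = v j)" 
    if "\<forall>i\<in>A. \<forall>j\<in>A. (x i < x j) = (v i < v j)" "i \<in> A" "j \<in> A" for x :: "nat \<Rightarrow> real" and i j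
  proof -
    have "x i < x j \<longleftrightarrow> v i < v j" "x j < x i \<longleftrightarrow> v j < v i" using that by blast+
    then show ?thesis by (metis linorder_neqE order_less_irrefl)
  qed
  have "tableau_cell (level_rows v A) =
    {x. \<forall>i\<in>A. \<forall>j\<in>A. (x i = x j \<longleftrightarrow> v i = v j) \<and> (x i < x j \<longleftrightarrow> v i < v j)}"
    unfolding tableau_cell_def set_concat_level_rows[OF assms]
    by (intro Collect_cong ball_cong refl) (simp add: eq row_of_level_rows[OF assms])
  also have "\<dots> = {x. \<forall>i\<in>A. \<forall>j\<in>A. x i < x j \<longleftrightarrow> v i < v j}"
    using eq2 by blast
  finally show ?thesis .
qed

section \<open>Closure order and reflections in terms of weights\<close>

lemma continuous_on_nat_fun:
  fixes f :: "real \<Rightarrow> nat \<Rightarrow> real"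
  assumes "\<And>i. continuous_on UNIV (\<lambda>t. f t i)"
  shows "continuous_on UNIV f"
  using assms by (rule continuous_on_coordinatewise_then_product)

lemma order_embed_real:
  fixes v :: "nat \<Rightarrow> 'b::linorder"
  assumes "finite A"
  obtains x :: "nat \<Rightarrow> real" where "\<And>i j. i \<in> A \<Longrightarrow> j \<in> A \<Longrightarrow> x i < x j \<longleftrightarrow> v i < v j"
proof
  fix i j assume "i \<in> A" "j \<in> A"
  then show "real (row_of (level_rows v A) i) < real (row_of (level_rows v A) j) \<longleftrightarrow> v i < v j"
    using row_of_level_rows[OF assms] by simp
qed

text \<open>A weak inequality between two coordinates is a closed condition, so it passes from a
  cell to its closure. Conversely a point \<open>x\<close> of the coarser cell is the limit of
  \<open>x + t * z\<close> as \<open>t\<close> decreases to 0, where \<open>z\<close> is a point of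
  the finer cell: ties of \<open>x\<close> are broken by \<open>z\<close>, and strict inequalities
  of \<open>x\<close> persist for small \<open>t\<close>.\<close>

lemma tab_prec_level_rows:
  fixes v :: "nat \<Rightarrow> 'b::linorder" and w :: "nat \<Rightarrow> 'c::linorder"
  assumes "finite A"
  shows "level_rows v A \<prec>\<^sub>T level_rows w A \<longleftrightarrow> (\<forall>i\<in>A. \<forall>j\<in>A. v i \<le> v j \<longrightarrow> w i \<le> w j)"
proof
  assume prec: "level_rows v A \<prec>\<^sub>T level_rows w A"
  obtain y :: "nat \<Rightarrow> real" where y: "\<And>i j. i \<in> A \<Longrightarrow> j \<in> A \<Longrightarrow> y i < y j \<longleftrightarrow> w i < w j"
    using order_embed_real[OF assms] by metis
  have "y \<in> tableau_cell (level_rows w A)"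
    unfolding tableau_cell_level_rows[OF assms] using y by auto
  then have yc: "y \<in> closure (tableau_cell (level_rows v A))"
    using prec unfolding tab_prec_def by auto
  show "\<forall>i\<in>A. \<forall>j\<in>A. v i \<le> v j \<longrightarrow> w i \<le> w j"
  proof (intro ballI impI)
    fix i j assume ij: "i \<in> A" "j \<in> A" "v i \<le> v j"
    have "closed {x :: nat \<Rightarrow> real. x i \<le> x j}"
      by (intro closed_Collect_le continuous_on_product_coordinates)
    moreover have "tableau_cell (level_rows v A) \<subseteq> {x. x i \<le> x j}"
      unfolding tableau_cell_level_rows[OF assms] using ij by (auto simp: not_less[symmetric])
    ultimately have "closure (tableau_cell (level_rows v A)) \<subseteq> {x. x i \<le> x j}"
      by (rule closure_minimal[rotated])
    then show "w i \<le> w j" using yc y[OF ij(2,1)] by (auto simp: not_less[symmetric])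
  qed
next
  assume coarse: "\<forall>i\<in>A. \<forall>j\<in>A. v i \<le> v j \<longrightarrow> w i \<le> w j"
  obtain z :: "nat \<Rightarrow> real" where z: "\<And>i j. i \<in> A \<Longrightarrow> j \<in> A \<Longrightarrow> z i < z j \<longleftrightarrow> v i < v j"
    using order_embed_real[OF assms] by metis
  show "level_rows v A \<prec>\<^sub>T level_rows w A"
    unfolding tab_prec_def
  proof
    fix x assume "x \<in> tableau_cell (level_rows w A)"
    then have x: "\<And>i j. i \<in> A \<Longrightarrow> j \<in> A \<Longrightarrow> x i < x j \<longleftrightarrow> w i < w j"
      unfolding tableau_cell_level_rows[OF assms] by auto
    define g where "g t = (\<lambda>i. x i + t * z i)" for t :: real
    have "\<forall>\<^sub>F t in at_right 0. \<forall>i\<in>A. \<forall>j\<in>A. x i < x j \<longrightarrow> g t i < g t j"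
    proof (intro eventually_ball_finite assms ballI)
      fix i j assume "i \<in> A" "j \<in> A"
      show "\<forall>\<^sub>F t in at_right 0. x i < x j \<longrightarrow> g t i < g t j"
      proof (cases "x i < x j")
        case True
        have "((\<lambda>t. g t j - g t i) \<longlongrightarrow> (x j + 0 * z j) - (x i + 0 * z i)) (at_right 0)"
          unfolding g_def by (intro tendsto_intros)
        then have "\<forall>\<^sub>F t in at_right 0. 0 < g t j - g t i"
          by (rule order_tendstoD) (use True in auto)
        then show ?thesis by (rule eventually_mono) auto
      qed simp
    qed
    then have "\<forall>\<^sub>F t in at_right 0. g t \<in> tableau_cell (level_rows v A)"
      using eventually_at_right_less[of "0::real"]
    proof eventually_elim
      case (elim t)
      have "g t i < g t j \<longleftrightarrow> v i < v j" if ij: "i \<in> A" "j \<in> A" for i j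
      proof (cases "x i = x j")
        case True
        then have "g t i < g t j \<longleftrightarrow> z i < z j" using elim by (simp add: g_def)
        then show ?thesis using z ij by simp
      next
        case False
        then consider "x i < x j" | "x j < x i" by linarith
        then show ?thesis
        proof cases
          case 1
          then have "v i < v j" using coarse ij x[OF ij] by (meson not_le)
          then show ?thesis using elim ij 1 by auto
        next
          case 2
          then have "v j < v i" using coarse ij x[OF ij(2,1)] by (meson not_le)
          moreover have "g t j < g t i" using elim ij 2 by auto
          ultimately show ?thesis by auto
        qed
      qed
      then show ?case unfolding tableau_cell_level_rows[OF assms] by auto
    qed
    moreover have "continuous_on UNIV g"
      unfolding g_def by (intro continuous_on_nat_fun continuous_intros)
    then have "(g \<longlongrightarrow> g 0) (at_right 0)"
      by (metis UNIV_I continuous_on_def tendsto_within_subset top_greatest)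
    then have "(g \<longlongrightarrow> x) (at_right 0)" by (simp add: g_def)
    ultimately show "x \<in> closure (tableau_cell (level_rows v A))"
      using Lim_in_closed_set[OF closed_closure, of g "tableau_cell (level_rows v A)" "at_right 0" x]
        closure_subset[of "tableau_cell (level_rows v A)"] trivial_limit_at_right_real
      by (metis (mono_tags, lifting) closure_closure eventually_mono subsetD)
  qed
qed

lemma sorted_wrt_concat:
  assumes "sorted_wrt (\<lambda>xs ys. \<forall>x\<in>set xs. \<forall>y\<in>set ys. r x y) xss" "\<forall>xs\<in>set xss. sorted_wrt r xs"
  shows "sorted_wrt r (concat xss)"
  using assms by (induction xss) (auto simp: sorted_wrt_append)

text \<open>By coarseness every row of the tableau of \<open>v\<close> lies in exactly one row of
  that of \<open>w\<close>, so \<open>reflect\<close> rearranges these rows without losing any. The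
  symmetry in the affine span of the coarser facet keeps the comparisons decided by \<open>w\<close>
  and turns around those inside a row of \<open>w\<close>.\<close>

lemma reflect_level_rows:
  fixes v :: "nat \<Rightarrow> 'b::linorder" and w :: "nat \<Rightarrow> 'c::linorder" and v' :: "nat \<Rightarrow> 'd::linorder"
  assumes fin: "finite A"
    and coarse: "\<And>i j. i \<in> A \<Longrightarrow> j \<in> A \<Longrightarrow> v i \<le> v j \<Longrightarrow> w i \<le> w j"
    and keep: "\<And>i j. i \<in> A \<Longrightarrow> j \<in> A \<Longrightarrow> w i < w j \<Longrightarrow> v' i < v' j"
    and flip: "\<And>i j. i \<in> A \<Longrightarrow> j \<in> A \<Longrightarrow> w i = w j \<Longrightarrow> v' i < v' j \<longleftrightarrow> v j < v i"
  shows "reflect (level_rows w A) (level_rows v A) = level_rows v' A"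
proof (rule ordered_rows_unique)
  define T where "T = level_rows v A"
  define S where "S = level_rows w A"
  have oT: "ordered_rows v A T" and oS: "ordered_rows w A S"
    unfolding T_def S_def by (auto intro: ordered_rows_level_rows fin)
  have T: "\<And>R. R \<in> set T \<Longrightarrow> R \<noteq> [] \<and> sorted_wrt (<) R"
      "\<And>R a b. R \<in> set T \<Longrightarrow> a \<in> set R \<Longrightarrow> b \<in> set R \<Longrightarrow> v a = v b"
      "(\<Union>R\<in>set T. set R) = A"
      "sorted_wrt (\<lambda>R R'. \<forall>a\<in>set R. \<forall>b\<in>set R'. v a < v b) T"
    using oT unfolding ordered_rows_def by blast+
  have S: "\<And>R a b. R \<in> set S \<Longrightarrow> a \<in> set R \<Longrightarrow> b \<in> set R \<Longrightarrow> w a = w b"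
      "(\<Union>R\<in>set S. set R) = A"
      "sorted_wrt (\<lambda>R R'. \<forall>a\<in>set R. \<forall>b\<in>set R'. w a < w b) S"
    using oS unfolding ordered_rows_def by blast+
  have TA: "a \<in> A" if "R \<in> set T" "a \<in> set R" for a R using T(3) that by auto
  have SA: "a \<in> A" if "R \<in> set S" "a \<in> set R" for a R using S(2) that by auto
  have Srow: "a \<in> set R" if R: "R \<in> set S" "b \<in> set R" "a \<in> A" "w a = w b" for a b R
  proof -
    obtain R' where R': "R' \<in> set S" "a \<in> set R'" using S(2) \<open>a \<in> A\<close> by auto
    then show ?thesis using sorted_rows_eq[OF S(3) R'(1) R(1) R'(2) R(2,4)] by simp
  qed
  have weq: "w a = w b" if "a \<in> A" "b \<in> A" "v a = v b" for a b
    using coarse[of a b] coarse[of b a] that by auto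
  have refl: "reflect S T = concat (map (\<lambda>R. rev (filter (\<lambda>R'. set R' \<subseteq> set R) T)) S)"
    by (simp add: reflect_def)
  have inrefl: "R' \<in> set (reflect S T) \<longleftrightarrow> R' \<in> set T \<and> (\<exists>R\<in>set S. set R' \<subseteq> set R)" for R'
    unfolding refl by auto
  have ex: "\<exists>R\<in>set S. set R' \<subseteq> set R" if R': "R' \<in> set T" for R'
  proof -
    obtain a where a: "a \<in> set R'" using T(1)[OF R'] by (cases R') auto
    then obtain R where R: "R \<in> set S" "a \<in> set R" using S(2) TA[OF R'] by blast
    have "set R' \<subseteq> set R" 
      using Srow[OF R] weq TA[OF R'] T(2)[OF R'] a by blast
    then show ?thesis using R by auto
  qed
  have set_refl: "set (reflect S T) = set T" using inrefl ex by auto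
  have "sorted_wrt (\<lambda>R R'. \<forall>a\<in>set R. \<forall>b\<in>set R'. v' a < v' b) (reflect S T)"
    unfolding refl
  proof (rule sorted_wrt_concat)
    show "sorted_wrt (\<lambda>xs ys. \<forall>x\<in>set xs. \<forall>y\<in>set ys. \<forall>a\<in>set x. \<forall>b\<in>set y. v' a < v' b)
      (map (\<lambda>R. rev (filter (\<lambda>R'. set R' \<subseteq> set R) T)) S)"
      unfolding sorted_wrt_map
    proof (rule sorted_wrt_mono_rel[OF _ S(3)], intro ballI)
      fix x y X Y a b assume "x \<in> set S" "y \<in> set S" and *: "\<forall>a\<in>set x. \<forall>b\<in>set y. w a < w b"
        and X: "X \<in> set (rev (filter (\<lambda>R'. set R' \<subseteq> set x) T))"
        and Y: "Y \<in> set (rev (filter (\<lambda>R'. set R' \<subseteq> set y) T))"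
        and ab: "a \<in> set X" "b \<in> set Y"
      then have "a \<in> set x" "b \<in> set y" "a \<in> A" "b \<in> A" using TA by auto
      then show "v' a < v' b" using keep * by blast
    qed
    show "\<forall>xs\<in>set (map (\<lambda>R. rev (filter (\<lambda>R'. set R' \<subseteq> set R) T)) S).
       sorted_wrt (\<lambda>R R'. \<forall>a\<in>set R. \<forall>b\<in>set R'. v' a < v' b) xs"
    proof
      fix xs assume "xs \<in> set (map (\<lambda>R. rev (filter (\<lambda>R'. set R' \<subseteq> set R) T)) S)"
      then obtain R where R: "R \<in> set S" "xs = rev (filter (\<lambda>R'. set R' \<subseteq> set R) T)" by auto
      have "sorted_wrt (\<lambda>R R'. \<forall>a\<in>set R. \<forall>b\<in>set R'. v a < v b) (filter (\<lambda>R'. set R' \<subseteq> set R) T)"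
        by (rule sorted_wrt_filter[OF T(4)])
      then show "sorted_wrt (\<lambda>R R'. \<forall>a\<in>set R. \<forall>b\<in>set R'. v' a < v' b) xs"
        unfolding R sorted_wrt_rev
      proof (rule sorted_wrt_mono_rel[rotated], intro ballI)
        fix x y a b assume "x \<in> set (filter (\<lambda>R'. set R' \<subseteq> set R) T)" and "y \<in> set (filter (\<lambda>R'. set R' \<subseteq> set R) T)"
          "\<forall>a\<in>set x. \<forall>b\<in>set y. v a < v b" "a \<in> set y" "b \<in> set x"
        then have "a \<in> set R" "b \<in> set R" "a \<in> A" "b \<in> A" "v b < v a" using TA by auto
        then show "v' a < v' b" using flip[of a b] S(1)[OF R(1), of a b] by blast
      qed
    qed
  qed
  moreover have "v' a = v' b" if "R \<in> set T" "a \<in> set R" "b \<in> set R" for R a b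
  proof -
    have "a \<in> A" "b \<in> A" "v a = v b" using that TA T(2) by blast+
    then show ?thesis using flip[of a b] flip[of b a] weq by (metis linorder_neqE order_less_irrefl)
  qed
  ultimately show "ordered_rows v' A (reflect (level_rows w A) (level_rows v A))"
    unfolding ordered_rows_def T_def[symmetric] S_def[symmetric] set_refl
    using T by blast
qed

section \<open>Codes of flats\<close>

type_synonym code = "(nat \<times> nat) list"

text \<open>In a valid code, an entry \<open>m\<close> that is not a first component has the weight
  \<open>m - 1\<close> up to the sign (-1)^j, where \<open>j\<close> counts the first components
  above \<open>m\<close>; a first component inherits the weight of its minimum. The shift by 1 gives
  the entry 1 the weight 0, in accordance with \<open>\<beta> 1 = 0\<close>.\<close>

fun wt :: "code \<Rightarrow> nat \<Rightarrow> int" where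
  "wt [] d = int d - 1"
| "wt ((b, c) # P) d = (if d < b then - wt P d else if d = b then - wt P c else int d - 1)"

text \<open>A single lookup reaches the minimum of the block, because in a valid code no second
  component occurs as a first component.\<close>

fun rep :: "code \<Rightarrow> nat \<Rightarrow> nat" where
  "rep [] d = d"
| "rep ((b, c) # P) d = (if d = b then c else rep P d)"

fun valid :: "nat \<Rightarrow> code \<Rightarrow> bool" where
  "valid N [] \<longleftrightarrow> True"
| "valid N ((b, c) # P) \<longleftrightarrow> b \<le> N \<and> 1 \<le> c \<and> c < b \<and> c \<notin> fst ` set P \<and> valid (b - 1) P"

text \<open>The default 1 fits the empty code: its children start at the entry 2, and
  \<open>top_entry P - 1\<close> is the level m_T, which is 0 for the one-column tableau.\<close>

fun top_entry :: "code \<Rightarrow> nat" where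
  "top_entry [] = 1"
| "top_entry ((b, c) # P) = b"

lemma valid_mono: "valid N P \<Longrightarrow> N \<le> M \<Longrightarrow> valid M P"
  by (cases P) auto

lemma valid_fst: "valid N P \<Longrightarrow> x \<in> set P \<Longrightarrow> 2 \<le> fst x \<and> fst x \<le> N \<and> 1 \<le> snd x \<and> snd x < fst x"
proof (induction N P rule: valid.induct)
  case (2 N b c P)
  show ?case
  proof (cases "x = (b, c)")
    case False
    then have "2 \<le> fst x \<and> fst x \<le> b - 1 \<and> 1 \<le> snd x \<and> snd x < fst x" using 2 by auto
    then show ?thesis using 2(2) by auto
  qed (use 2(2) in auto)
qed auto

lemma top_entry_le: "valid N P \<Longrightarrow> 1 \<le> N \<Longrightarrow> top_entry P \<le> N"
  by (cases P) auto

lemma top_entry_ge: "valid N P \<Longrightarrow> 1 \<le> top_entry P"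
  by (cases P) auto

lemma valid_top: "valid N P \<Longrightarrow> valid (top_entry P) P"
  by (cases P) auto

lemma wt_above: "top_entry P < d \<Longrightarrow> wt P d = int d - 1"
  by (cases "(P, d)" rule: wt.cases) auto

lemma rep_notin: "d \<notin> fst ` set P \<Longrightarrow> rep P d = d"
  by (induction P) auto

lemma rep_le: "valid N P \<Longrightarrow> rep P d \<le> d"
  by (induction N P rule: valid.induct) auto

lemma rep_ge1: "valid N P \<Longrightarrow> 1 \<le> d \<Longrightarrow> 1 \<le> rep P d"
  by (induction N P rule: valid.induct) auto

lemma rep_range: "valid N P \<Longrightarrow> rep P d \<notin> fst ` set P"
proof (induction N P rule: valid.induct)
  case (2 N b c P)
  have "rep P d \<noteq> b" if "d \<noteq> b"
  proof (cases "d \<in> fst ` set P")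
    case True
    then have "d \<le> b - 1" "2 \<le> d" using 2 valid_fst[of "b-1" P] by auto
    then show ?thesis using rep_le[of "b-1" P d] 2 by simp
  qed (use that rep_notin in auto)
  then show ?case using 2 by auto
qed auto

lemma rep_rep: "valid N P \<Longrightarrow> rep P (rep P d) = rep P d"
  using rep_range rep_notin by blast

lemma rep_snd: "valid N P \<Longrightarrow> (b, c) \<in> set P \<Longrightarrow> rep P b = c"
proof (induction N P rule: valid.induct)
  case (2 N b' c' P)
  then show ?case using valid_fst[of "b'-1" P "(b,c)"] by auto
qed auto

lemma abs_wt: "valid N P \<Longrightarrow> 1 \<le> d \<Longrightarrow> \<bar>wt P d\<bar> = int (rep P d) - 1"
proof (induction N P arbitrary: d rule: valid.induct)
  case (2 N b c P)
  have "rep P d = d" if "b < d" 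
    using that 2 valid_fst[of "b-1" P] by (intro rep_notin) force
  moreover have "rep P c = c" using 2 by (intro rep_notin) auto
  moreover have "\<bar>wt P c\<bar> = int (rep P c) - 1" using 2 by simp
  ultimately show ?case using 2 by auto
qed auto

lemma wt_rep: "valid N P \<Longrightarrow> 1 \<le> d \<Longrightarrow> wt P (rep P d) = wt P d"
proof (induction N P rule: valid.induct)
  case (2 N b c P)
  have "rep P d = d" if "b < d" 
    using that 2 valid_fst[of "b-1" P] by (intro rep_notin) force
  then show ?case using 2 rep_le[of "b-1" P d] by auto
qed auto

text \<open>Different minima have different absolute weights, and an entry has the weight of its
  minimum; hence the rows of the tableau of a code are the blocks of its flat.\<close>

lemma wt_eq_iff:
  assumes "valid N P" "1 \<le> d" "1 \<le> e"
  shows "wt P d = wt P e \<longleftrightarrow> rep P d = rep P e"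
  using abs_wt[OF assms(1,2)] abs_wt[OF assms(1,3)] wt_rep[OF assms(1,2)] wt_rep[OF assms(1,3)]
  by (metis diff_add_cancel of_nat_eq_iff)

text \<open>Weights on the line carried by \<open>P\<close>, when the entries below \<open>b\<close> have been moved to the top.\<close>

definition line_wt :: "code \<Rightarrow> nat \<Rightarrow> nat \<Rightarrow> int" where
  "line_wt P b d = (if d < b then - wt P d else int d - 1)"

text \<open>There is one child for each row into which the entry \<open>b\<close> can be moved. The
  rows come by increasing weight; since \<open>line_wt\<close> negates the weights below
  \<open>b\<close>, this is the order by decreasing row number that \<open>moves\<close>
  prescribes.\<close>

definition children_at :: "code \<Rightarrow> nat \<Rightarrow> code list" where
  "children_at P b = map (\<lambda>R. (b, hd R) # P) (level_rows (wt P) {1..<b})"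

definition children :: "nat \<Rightarrow> code \<Rightarrow> code list" where
  "children N P = concat (map (children_at P) [top_entry P + 1..<N + 1])"

text \<open>The tail of a valid code on \<open>Suc N\<close> is valid on \<open>N\<close>, because
  its entries stay below the first pair. This lets the recursion over tails run parallel to that of
  \<open>pi_tab\<close>, where \<open>k\<close> and \<open>n\<close> grow together.\<close>

fun codes :: "nat \<Rightarrow> nat \<Rightarrow> code list" where
  "codes 0 N = [[]]"
| "codes (Suc k) 0 = []"
| "codes (Suc k) (Suc N) = concat (map (children (Suc N)) (codes k N))"

abbreviation code_tab :: "nat \<Rightarrow> code \<Rightarrow> tableau" where
  "code_tab N P \<equiv> level_rows (wt P) {1..N}"

text \<open>The minimum \<open>rep P (hd R)\<close> has the weight of \<open>hd R\<close> and is at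
  most \<open>hd R\<close>, so it lies in the row \<open>R\<close>, whose least entry is
  \<open>hd R\<close>.\<close>

lemma hd_level_rows_wt:
  assumes "valid N P" "R \<in> set (level_rows (wt P) {1..<b})"
  shows "hd R \<in> {1..<b}" "hd R \<notin> fst ` set P"
proof -
  have o: "ordered_rows (wt P) {1..<b} (level_rows (wt P) {1..<b})" by (simp add: ordered_rows_level_rows)
  have ne: "R \<noteq> []" "sorted_wrt (<) R" "\<And>a a'. a \<in> set R \<Longrightarrow> a' \<in> set R \<Longrightarrow> wt P a = wt P a'"
    using o assms(2) unfolding ordered_rows_def by blast+
  have hd: "hd R \<in> set R" using ne by simp
  show h1: "hd R \<in> {1..<b}" using set_level_rows_sub[OF _ assms(2) hd] by simp
  define r where "r = rep P (hd R)"
  have r: "1 \<le> r" "r \<le> hd R" "wt P r = wt P (hd R)"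
    using rep_le[OF assms(1)] rep_ge1[OF assms(1)] wt_rep[OF assms(1)] h1 by (auto simp: r_def)
  then have "r \<in> {1..<b}" using h1 by auto
  then obtain R' where R': "R' \<in> set (level_rows (wt P) {1..<b})" "r \<in> set R'"
    using set_concat_level_rows[of "{1..<b}" "wt P"] unfolding set_concat by blast
  have "sorted_wrt (\<lambda>R R'. \<forall>a\<in>set R. \<forall>b\<in>set R'. wt P a < wt P b) (level_rows (wt P) {1..<b})"
    using o unfolding ordered_rows_def by blast
  from sorted_rows_eq[OF this R'(1) assms(2) R'(2) hd r(3)] have "r \<in> set R" using R' by simp
  then have "hd R \<le> r" using ne(2) by (cases R) auto
  then have "hd R = r" using r by simp
  then show "hd R \<notin> fst ` set P" using rep_range[OF assms(1)] unfolding r_def by metis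
qed

lemma ex_hd_level_rows_wt:
  assumes "valid N P" "c \<in> {1..<b}" "c \<notin> fst ` set P"
  shows "\<exists>R\<in>set (level_rows (wt P) {1..<b}). hd R = c"
proof -
  have o: "ordered_rows (wt P) {1..<b} (level_rows (wt P) {1..<b})" by (simp add: ordered_rows_level_rows)
  obtain R where R: "R \<in> set (level_rows (wt P) {1..<b})" "c \<in> set R"
    using assms(2) set_concat_level_rows[of "{1..<b}" "wt P"] unfolding set_concat by blast
  have "hd R \<in> set R" using R(2) by (metis hd_in_set empty_iff empty_set)
  then have "wt P (hd R) = wt P c"
    using o R unfolding ordered_rows_def by blast
  then have "rep P (hd R) = rep P c"
    using wt_eq_iff[OF assms(1)] hd_level_rows_wt(1)[OF assms(1) R(1)] assms(2) by auto
  then have "hd R = c" using rep_notin assms(3) hd_level_rows_wt(2)[OF assms(1) R(1)] by metis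
  then show ?thesis using R by auto
qed

lemma set_children_at:
  assumes "valid N P"
  shows "set (children_at P b) = {(b, c) # P |c. c \<in> {1..<b} \<and> c \<notin> fst ` set P}"
  using hd_level_rows_wt[OF assms] ex_hd_level_rows_wt[OF assms] unfolding children_at_def
  by (auto simp: image_iff) metis

lemma set_children:
  assumes "valid N P" "1 \<le> N"
  shows "set (children M P) = {(b, c) # P |b c. b \<le> M \<and> valid M ((b, c) # P)}"
proof -
  have "valid (b - 1) P \<longleftrightarrow> top_entry P < b" if "1 \<le> c" "c < b" for b c
    using assms that by (cases P) auto
  then have *: "valid M ((b, c) # P) \<longleftrightarrow> b \<le> M \<and> top_entry P < b \<and> c \<in> {1..<b} \<and> c \<notin> fst ` set P" for b c
    by auto
  have "x \<in> set (children M P) \<longleftrightarrow> (\<exists>b. top_entry P < b \<and> b \<le> M \<and> x \<in> set (children_at P b))" for x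
    unfolding children_def by (auto simp: less_Suc_eq_le Suc_le_eq)
  then show ?thesis unfolding set_children_at[OF assms(1)] * by blast
qed

lemma set_codes: "k < N \<Longrightarrow> set (codes k N) = {P. valid N P \<and> length P = k}"
proof (induction k N rule: codes.induct)
  case (3 k N)
  have *: "set (children (Suc N) P) = {(b, c) # P |b c. b \<le> Suc N \<and> valid (Suc N) ((b, c) # P)}"
    if "P \<in> set (codes k N)" for P
    using that 3 by (intro set_children[of N]) auto
  have "set (codes (Suc k) (Suc N)) = (\<Union>P\<in>set (codes k N). set (children (Suc N) P))" by simp
  also have "\<dots> = (\<Union>P\<in>set (codes k N). {(b, c) # P |b c. b \<le> Suc N \<and> valid (Suc N) ((b, c) # P)})"
    using * by (intro SUP_cong) auto
  also have "\<dots> = {Q. valid (Suc N) Q \<and> length Q = Suc k}"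
  proof (intro equalityI subsetI)
    fix Q assume "Q \<in> {Q. valid (Suc N) Q \<and> length Q = Suc k}"
    then obtain b c P where Q: "Q = (b, c) # P" "length P = k" "valid (Suc N) ((b, c) # P)"
      by (auto simp: length_Suc_conv)
    then have "valid N P" by (auto intro: valid_mono)
    then have "P \<in> set (codes k N)" using 3 Q by simp
    then show "Q \<in> (\<Union>P\<in>set (codes k N). {(b, c) # P |b c. b \<le> Suc N \<and> valid (Suc N) ((b, c) # P)})"
      using Q by auto
  qed (use 3 in auto)
  finally show ?case .
qed auto

text \<open>Codes are compared from a common suffix \<open>R\<close> towards the front, that is,
  with the smallest coded entries first. The rule \<open>ext\<close> serves codes of different
  lengths: these arise when the polynomial induction deletes the newest entry from only one of two
  codes, and when a child is compared with its parent.\<close>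

inductive code_less :: "code \<Rightarrow> code \<Rightarrow> bool" where
  pos: "b < b' \<Longrightarrow> code_less (X @ (b, c) # R) (Y @ (b', c') # R)"
| row: "wt R c < wt R c' \<Longrightarrow> code_less (X @ (b, c) # R) (Y @ (b, c') # R)"
| ext: "code_less (X @ (b, c) # R) R"

lemma code_less_Cons:
  assumes "code_less P Q" "length P = length Q"
  shows "code_less (x # P) (y # Q)"
  using assms(1)
proof cases
  case (pos b b' X c R Y c')
  then show ?thesis using code_less.pos[OF pos(3), of "x # X" c R "y # Y" c'] by simp
next
  case (row R c c' X b Y)
  then show ?thesis using code_less.row[OF row(3), of "x # X" b "y # Y"] by simp
next
  case (ext X b c)
  then show ?thesis using assms(2) by simp
qed

lemma sorted_children:
  assumes "valid N P"
  shows "sorted_wrt code_less (children M P)"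
  unfolding children_def
proof (rule sorted_wrt_concat)
  have *: "code_less x y" if "b < b'" "x \<in> set (children_at P b)" "y \<in> set (children_at P b')" for b b' x y
    using that code_less.pos[of b b' "[]" _ P "[]"] by (auto simp: children_at_def)
  show "sorted_wrt (\<lambda>xs ys. \<forall>x\<in>set xs. \<forall>y\<in>set ys. code_less x y)
     (map (children_at P) [top_entry P + 1..<M + 1])"
    unfolding sorted_wrt_map
    by (rule sorted_wrt_mono_rel[OF _ sorted_wrt_upt]) (use * in blast)
  show "\<forall>xs\<in>set (map (children_at P) [top_entry P + 1..<M + 1]). sorted_wrt code_less xs"
  proof
    fix xs assume "xs \<in> set (map (children_at P) [top_entry P + 1..<M + 1])"
    then obtain b where xs: "xs = children_at P b" by auto
    have o: "ordered_rows (wt P) {1..<b} (level_rows (wt P) {1..<b})" by (simp add: ordered_rows_level_rows)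
    show "sorted_wrt code_less xs" unfolding xs children_at_def sorted_wrt_map
    proof (rule sorted_wrt_mono_rel)
      show "sorted_wrt (\<lambda>R R'. \<forall>a\<in>set R. \<forall>b\<in>set R'. wt P a < wt P b) (level_rows (wt P) {1..<b})"
        using o unfolding ordered_rows_def by blast
      fix R R' assume *: "R \<in> set (level_rows (wt P) {1..<b})" "R' \<in> set (level_rows (wt P) {1..<b})"
        "\<forall>a\<in>set R. \<forall>b\<in>set R'. wt P a < wt P b"
      then have "R \<noteq> []" "R' \<noteq> []" using level_rows_nonempty_row by blast+
      then have "wt P (hd R) < wt P (hd R')" using * by simp
      then show "code_less ((b, hd R) # P) ((b, hd R') # P)"
        using code_less.row[of P _ _ "[]" b "[]"] by simp
    qed
  qed
qed

lemma sorted_codes: "k < N \<Longrightarrow> sorted_wrt code_less (codes k N)"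
proof (induction k N rule: codes.induct)
  case (3 k N)
  have IH: "sorted_wrt code_less (codes k N)" and len: "\<And>P. P \<in> set (codes k N) \<Longrightarrow> valid N P \<and> length P = k"
    using 3 set_codes[of k N] by auto
  show ?case unfolding codes.simps
  proof (rule sorted_wrt_concat)
    show "sorted_wrt (\<lambda>xs ys. \<forall>x\<in>set xs. \<forall>y\<in>set ys. code_less x y) (map (children (Suc N)) (codes k N))"
      unfolding sorted_wrt_map
    proof (rule sorted_wrt_mono_rel[OF _ IH])
      fix P Q assume *: "P \<in> set (codes k N)" "Q \<in> set (codes k N)" "code_less P Q"
      then show "\<forall>x\<in>set (children (Suc N) P). \<forall>y\<in>set (children (Suc N) Q). code_less x y"
        using len code_less_Cons[OF *(3)] by (auto simp: children_def children_at_def)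
    qed
    show "\<forall>xs\<in>set (map (children (Suc N)) (codes k N)). sorted_wrt code_less xs"
      using len sorted_children[of N] by simp
  qed
qed auto

section \<open>Blocks\<close>

lemma level_rows_rev:
  fixes v :: "nat \<Rightarrow> int"
  assumes "finite A"
  shows "level_rows (\<lambda>d. - v d) A = rev (level_rows v A)"
proof (rule ordered_rows_unique[symmetric])
  have o: "ordered_rows v A (level_rows v A)" by (rule ordered_rows_level_rows[OF assms])
  have s: "sorted_wrt (\<lambda>R R'. \<forall>a\<in>set R. \<forall>b\<in>set R'. v a < v b) (level_rows v A)"
    using o unfolding ordered_rows_def by blast
  have "sorted_wrt (\<lambda>R R'. \<forall>a\<in>set R. \<forall>b\<in>set R'. - v a < - v b) (rev (level_rows v A))"
    unfolding sorted_wrt_rev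
    by (rule sorted_wrt_mono_rel[OF _ s]) simp
  then show "ordered_rows (\<lambda>d. - v d) A (rev (level_rows v A))"
    using o unfolding ordered_rows_def set_rev neg_equal_iff_equal by blast
qed

lemma remove_empty_id: "\<forall>R\<in>set T. R \<noteq> [] \<Longrightarrow> remove_empty T = T"
  unfolding remove_empty_def by (simp add: filter_id_conv)

lemma remove_empty_append: "remove_empty (S @ T) = remove_empty S @ remove_empty T"
  by (simp add: remove_empty_def)

lemma map_removeAll:
  assumes "\<forall>R\<in>set T. b \<notin> set R" shows "map (removeAll b) T = T"
  using assms by (simp add: map_idI)

lemma move_single:
  assumes "\<forall>R\<in>set L. R \<noteq> [] \<and> b \<notin> set R" "\<forall>R\<in>set S. R \<noteq> [] \<and> b \<notin> set R"
  shows "move 0 b (L @ [b] # S) = [b] # L @ S"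
    and "i < length L \<Longrightarrow> move (Suc i) b (L @ [b] # S) = L[i := insort b (L ! i)] @ S"
proof -
  have m: "map (removeAll b) (L @ [b] # S) = L @ [] # S"
    using assms map_removeAll[of L b] map_removeAll[of S b] by simp
  have r: "remove_empty L = L" "remove_empty S = S" "remove_empty ([] # S) = S"
    using assms by (auto intro: remove_empty_id simp: remove_empty_def)
  show "move 0 b (L @ [b] # S) = [b] # L @ S"
    unfolding move_def Let_def m by (simp add: remove_empty_append r)
  assume i: "i < length L"
  have "R \<noteq> []" if "R \<in> set (L[i := insort b (L ! i)])" for R
  proof -
    have "R = insort b (L ! i) \<or> R \<in> set L"
      using that set_update_subset_insert[of L i "insort b (L ! i)"] by fast
    then show ?thesis using assms(1) insort_not_Nil[of "\<lambda>x. x" b "L ! i"] by metis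
  qed
  then have "remove_empty (L[i := insort b (L ! i)]) = L[i := insort b (L ! i)]"
    by (intro remove_empty_id ballI)
  then show "move (Suc i) b (L @ [b] # S) = L[i := insort b (L ! i)] @ S"
    unfolding move_def Let_def m using i by (simp add: remove_empty_append r list_update_append nth_append)
qed

lemma ordered_rows_insert:
  fixes v w :: "nat \<Rightarrow> 'b::linorder"
  assumes o: "ordered_rows v A T" and i: "i < length T" and b: "b \<notin> A"
    and w: "\<And>a. a \<in> A \<Longrightarrow> w a = v a" and wb: "w b = v (hd (T ! i))"
  shows "ordered_rows w (insert b A) (T[i := insort b (T ! i)])"
proof -
  define X Y R where "X = take i T" and "Y = drop (Suc i) T" and "R = T ! i"
  have T: "T = X @ R # Y" unfolding X_def Y_def R_def using i by (simp add: id_take_nth_drop)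
  have T': "T[i := insort b (T ! i)] = X @ insort b R # Y"
    unfolding X_def Y_def R_def using i by (simp add: upd_conv_take_nth_drop)
  have rows: "\<And>R. R \<in> set T \<Longrightarrow> R \<noteq> [] \<and> sorted_wrt (<) R"
    and c: "\<And>R a a'. R \<in> set T \<Longrightarrow> a \<in> set R \<Longrightarrow> a' \<in> set R \<Longrightarrow> v a = v a'"
    and A: "(\<Union>R\<in>set T. set R) = A"
    and s: "sorted_wrt (\<lambda>R R'. \<forall>a\<in>set R. \<forall>b\<in>set R'. v a < v b) T"
    using o unfolding ordered_rows_def by blast+
  have sub: "a \<in> A" if "R' \<in> set T" "a \<in> set R'" for a R' using A that by blast
  have R: "R \<in> set T" "R \<noteq> []" using rows[of R] by (auto simp: T)
  have wR: "w a = v (hd R)" if "a \<in> set (insort b R)" for a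
  proof (cases "a = b")
    case False
    then have "a \<in> set R" using that by (simp add: set_insort_key)
    then show ?thesis using c[OF R(1), of a "hd R"] R sub[OF R(1)] w by auto
  qed (use wb in \<open>simp add: R_def\<close>)
  have sw: "sorted_wrt (\<lambda>R R'. \<forall>a\<in>set R. \<forall>b\<in>set R'. w a < w b) T"
    by (rule sorted_wrt_mono_rel[OF _ s]) (use sub w in auto)
  have hdR: "hd R \<in> set R" "w (hd R) = v (hd R)" using R sub[OF R(1), of "hd R"] w by auto
  have sw': "sorted_wrt (\<lambda>R R'. \<forall>a\<in>set R. \<forall>b\<in>set R'. w a < w b) (X @ insort b R # Y)"
  proof -
    have XY: "\<forall>R'\<in>set Y. \<forall>b\<in>set R'. w (hd R) < w b" "\<forall>R'\<in>set X. \<forall>a\<in>set R'. w a < w (hd R)"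
      using sw hdR(1) unfolding T sorted_wrt_append by auto
    have "\<forall>R'\<in>set Y. \<forall>a\<in>set (insort b R). \<forall>b\<in>set R'. w a < w b"
      "\<forall>R'\<in>set X. \<forall>a\<in>set R'. \<forall>b'\<in>set (insort b R). w a < w b'"
      using XY wR hdR(2) by metis+
    then show ?thesis using sw unfolding T sorted_wrt_append by simp
  qed
  have "b \<notin> set R" using sub[OF R(1)] b by blast
  then have st: "sorted_wrt (<) (insort b R)"
    using rows[OF R(1)] unfolding strict_sorted_iff by (simp add: sorted_insort distinct_insort)
  have "insort b R \<noteq> []" by (metis insort_not_Nil)
  have un: "(\<Union>R'\<in>set (X @ insort b R # Y). set R') = insert b A"
    using A by (auto simp: T set_insort_key)
  have rows': "R' \<noteq> [] \<and> sorted_wrt (<) R' \<and> (\<forall>a\<in>set R'. \<forall>a'\<in>set R'. w a = w a')"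
    if R': "R' \<in> set (X @ insort b R # Y)" for R'
  proof (cases "R' = insort b R")
    case True
    then show ?thesis using st wR \<open>insort b R \<noteq> []\<close> by metis
  next
    case False
    then have RT: "R' \<in> set T" using R' by (auto simp: T)
    have "w a = w a'" if "a \<in> set R'" "a' \<in> set R'" for a a'
      using c[OF RT that] w[OF sub[OF RT that(1)]] w[OF sub[OF RT that(2)]] by simp
    then show ?thesis using rows[OF RT] by blast
  qed
  have "\<forall>R'\<in>set (X @ insort b R # Y). R' \<noteq> [] \<and> sorted_wrt (<) R' \<and> (\<forall>a\<in>set R'. \<forall>a'\<in>set R'. w a = w a')"
    by (intro ballI rows')
  from conjI[OF this conjI[OF un sw']] show ?thesis unfolding ordered_rows_def T' .
qed

lemma distinct_code: "valid N P \<Longrightarrow> distinct (map fst P)"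
proof (induction N P rule: valid.induct)
  case (2 N b c P)
  have "b \<notin> fst ` set P" using 2 valid_fst[of "b-1" P] by fastforce
  then show ?case using 2 by simp
qed auto

lemma card_rep_image:
  assumes "valid N P"
  shows "card (rep P ` {1..M}) + card (fst ` set P \<inter> {1..M}) = M"
proof -
  have "rep P ` {1..M} = {1..M} - fst ` set P"
  proof (intro equalityI subsetI)
    fix d assume "d \<in> rep P ` {1..M}"
    then obtain e where e: "e \<in> {1..M}" "d = rep P e" by auto
    then show "d \<in> {1..M} - fst ` set P"
      using rep_range[OF assms, of e] rep_le[OF assms, of e] rep_ge1[OF assms, of e] by auto
  next
    fix d assume "d \<in> {1..M} - fst ` set P"
    then show "d \<in> rep P ` {1..M}" using rep_notin[of d P] by (metis DiffD1 DiffD2 imageI)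
  qed
  then have "card (rep P ` {1..M}) = card ({1..M} - (fst ` set P \<inter> {1..M}))"
    by (simp add: Diff_Int_distrib2 Diff_Int)
  also have "\<dots> = M - card (fst ` set P \<inter> {1..M})"
    by (subst card_Diff_subset) auto
  finally show ?thesis using card_mono[of "{1..M}" "fst ` set P \<inter> {1..M}"] by simp
qed

lemma card_image_cong_kernel:
  assumes "\<And>a b. a \<in> A \<Longrightarrow> b \<in> A \<Longrightarrow> f a = f b \<longleftrightarrow> g a = g b"
  shows "card (f ` A) = card (g ` A)"
proof (rule bij_betw_same_card)
  show "bij_betw (\<lambda>y. g (inv_into A f y)) (f ` A) (g ` A)"
  proof (rule bij_betw_imageI)
    show "inj_on (\<lambda>y. g (inv_into A f y)) (f ` A)"
      by (intro inj_onI) (metis assms f_inv_into_f inv_into_into)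
    have "g (inv_into A f (f a)) = g a" if "a \<in> A" for a
      using that assms[of "inv_into A f (f a)" a] by (simp add: f_inv_into_f inv_into_into)
    then show "(\<lambda>y. g (inv_into A f y)) ` f ` A = g ` A" by (simp add: image_image)
  qed
qed

lemma card_code_classes:
  assumes "valid M P" "\<And>d e. d \<in> {1..M} \<Longrightarrow> e \<in> {1..M} \<Longrightarrow> v d = v e \<longleftrightarrow> rep P d = rep P e"
  shows "card (v ` {1..M}) + length P = M"
proof -
  have "fst ` set P \<inter> {1..M} = set (map fst P)" using valid_fst[OF assms(1)] by force
  then have "card (fst ` set P \<inter> {1..M}) = length P"
    using distinct_code[OF assms(1)] by (metis distinct_card length_map)
  then show ?thesis
    using card_rep_image[OF assms(1), of M] card_image_cong_kernel[of "{1..M}" v "rep P"] assms(2) by simp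
qed

lemma line_wt_eq_iff:
  assumes "valid N P" "top_entry P < b" "1 \<le> d" "1 \<le> e"
  shows "line_wt P b d = line_wt P b e \<longleftrightarrow> rep P d = rep P e"
proof -
  have a: "rep P d = d" if "b \<le> d" for d
    using abs_wt[OF assms(1), of d] wt_above[of P d] that assms by auto
  have l: "- wt P d \<noteq> int e - 1" "rep P d \<noteq> e" if "d < b" "b \<le> e" "1 \<le> d" for d e
    using abs_wt[OF assms(1) that(3)] rep_le[OF assms(1), of d] that by auto
  show ?thesis
    using wt_eq_iff[OF assms(1,3,4)] a[of d] a[of e] l(1)[of d e] l(1)[of e d] l(2)[of d e] l(2)[of e d] assms(3,4)
    by (auto simp: line_wt_def)
qed

lemma proj_level_rows:
  assumes "m \<le> n"
  shows "proj_tab m (level_rows v {1..n+1}) = level_rows v {1..m+1}"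
proof (rule ordered_rows_unique)
  let ?T = "level_rows v {1..n+1}"
  have o: "ordered_rows v {1..n+1} ?T" by (simp add: ordered_rows_level_rows)
  have T: "\<And>R. R \<in> set ?T \<Longrightarrow> R \<noteq> [] \<and> sorted_wrt (<) R"
     "\<And>R a b. R \<in> set ?T \<Longrightarrow> a \<in> set R \<Longrightarrow> b \<in> set R \<Longrightarrow> v a = v b"
     "(\<Union>R\<in>set ?T. set R) = {1..n+1}"
     "sorted_wrt (\<lambda>R R'. \<forall>a\<in>set R. \<forall>b\<in>set R'. v a < v b) ?T"
    using o unfolding ordered_rows_def by blast+
  have mem: "R \<in> set (proj_tab m ?T) \<longleftrightarrow> R \<noteq> [] \<and> (\<exists>R'\<in>set ?T. R = filter (\<lambda>r. r < m + 2) R')" for R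
    unfolding proj_tab_def remove_empty_def by auto
  have "sorted_wrt (\<lambda>R R'. \<forall>a\<in>set R. \<forall>b\<in>set R'. v a < v b) (proj_tab m ?T)"
    unfolding proj_tab_def remove_empty_def
    by (intro sorted_wrt_filter, unfold sorted_wrt_map) (rule sorted_wrt_mono_rel[OF _ T(4)], auto)
  moreover have "(\<Union>R\<in>set (proj_tab m ?T). set R) = (\<Union>R\<in>set ?T. set R) \<inter> {r. r < m + 2}"
  proof (intro equalityI subsetI)
    fix x assume "x \<in> (\<Union>R\<in>set ?T. set R) \<inter> {r. r < m + 2}"
    then obtain R where R: "R \<in> set ?T" "x \<in> set (filter (\<lambda>r. r < m + 2) R)" by auto
    then have "filter (\<lambda>r. r < m + 2) R \<in> set (proj_tab m ?T)" unfolding mem by (metis empty_iff empty_set)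
    then show "x \<in> (\<Union>R\<in>set (proj_tab m ?T). set R)" using R by blast
  next
    fix x assume "x \<in> (\<Union>R\<in>set (proj_tab m ?T). set R)"
    then obtain R R' where "R' \<in> set ?T" "R = filter (\<lambda>r. r < m + 2) R'" "x \<in> set R"
      using mem by auto
    then show "x \<in> (\<Union>R\<in>set ?T. set R) \<inter> {r. r < m + 2}" by auto
  qed
  then have "(\<Union>R\<in>set (proj_tab m ?T). set R) = {1..m+1}" unfolding T(3) using assms by auto
  moreover have "R \<noteq> [] \<and> sorted_wrt (<) R \<and> (\<forall>a\<in>set R. \<forall>a'\<in>set R. v a = v a')"
    if "R \<in> set (proj_tab m ?T)" for R
  proof -
    obtain R' where R': "R' \<in> set ?T" "R = filter (\<lambda>r. r < m + 2) R'" "R \<noteq> []"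
      using mem \<open>R \<in> set (proj_tab m ?T)\<close> by auto
    then show ?thesis using T(1)[OF R'(1)] T(2)[OF R'(1)] by (auto intro: sorted_wrt_filter)
  qed
  ultimately show "ordered_rows v {1..m+1} (proj_tab m ?T)"
    unfolding ordered_rows_def by blast
qed

lemma is_tableau_length:
  assumes "is_tableau k n T" shows "length T + k = n + 1"
  using assms unfolding is_tableau_def by blast

text \<open>Restriction to the entries up to \<open>m + 1\<close> keeps the dimension exactly when
  all \<open>length P\<close> coded entries survive, that is, when the largest of them is at most
  \<open>m + 1\<close>. Only the ties of \<open>v\<close> enter the argument, so it applies to
  \<open>line_wt\<close> although its order is not that of \<open>wt\<close>.\<close>

lemma min_level_line:
  assumes "valid (n + 1) P" "\<And>d e. 1 \<le> d \<Longrightarrow> 1 \<le> e \<Longrightarrow> v d = v e \<longleftrightarrow> rep P d = rep P e"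
  shows "min_level (length P) n (level_rows v {1..n+1}) = top_entry P - 1"
proof -
  have iff: "is_tableau (length P) m (proj_tab m (level_rows v {1..n+1})) \<longleftrightarrow> top_entry P \<le> m + 1"
    if "m \<le> n" for m
  proof -
    have "is_tableau (length P) m (level_rows v {1..m+1}) \<longleftrightarrow> card (v ` {1..m+1}) + length P = m + 1"
      using is_tableau_level_rows[of v m "length P"] is_tableau_length[of "length P" m "level_rows v {1..m+1}"]
      by (auto simp: length_level_rows)
    also have "card (v ` {1..m+1}) = card (rep P ` {1..m+1})"
      using assms(2) by (intro card_image_cong_kernel) auto
    also have "card (rep P ` {1..m+1}) + length P = m + 1 \<longleftrightarrow> card (fst ` set P \<inter> {1..m+1}) = length P"
      using card_rep_image[OF assms(1), of "m+1"] by auto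
    also have "\<dots> \<longleftrightarrow> card (fst ` set P \<inter> {1..m+1}) = card (fst ` set P)"
      using distinct_card[OF distinct_code[OF assms(1)]] by simp
    also have "\<dots> \<longleftrightarrow> fst ` set P \<subseteq> {1..m+1}"
      using card_subset_eq[of "fst ` set P" "fst ` set P \<inter> {1..m+1}"] by (auto simp: Int_absorb2)
    also have "\<dots> \<longleftrightarrow> top_entry P \<le> m + 1"
    proof
      show "fst ` set P \<subseteq> {1..m+1} \<Longrightarrow> top_entry P \<le> m + 1" by (cases P) auto
      assume "top_entry P \<le> m + 1"
      then have "valid (m + 1) P" using valid_mono[OF valid_top[OF assms(1)]] by blast
      then show "fst ` set P \<subseteq> {1..m+1}" using valid_fst by fastforce
    qed
    finally show ?thesis using proj_level_rows[OF that, of v] by simp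
  qed
  have "top_entry P \<le> n + 1" by (rule top_entry_le[OF assms(1)]) simp
  then show ?thesis
    unfolding min_level_def using iff by (intro Least_equality) auto
qed

lemma line_tab_split:
  assumes "valid N P" "top_entry P < b" "b \<le> N + 1"
  shows "level_rows (line_wt P b) {1..N} = level_rows (line_wt P b) {1..<b} @ map (\<lambda>r. [r]) [b..<N+1]"
proof -
  have "{1..N} = {1..<b} \<union> {b..<N+1}" using assms top_entry_ge[OF assms(1)] by auto
  moreover have "level_rows (line_wt P b) ({1..<b} \<union> {b..<N+1}) = level_rows (line_wt P b) {1..<b} @ level_rows (line_wt P b) {b..<N+1}"
  proof (rule level_rows_Un)
    fix d e assume "d \<in> {1..<b}" "e \<in> {b..<N+1}"
    then show "line_wt P b d < line_wt P b e"
      using abs_wt[OF assms(1), of d] rep_le[OF assms(1), of d] by (auto simp: line_wt_def)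
  qed auto
  moreover have "level_rows (line_wt P b) {b..<N+1} = map (\<lambda>r. [r]) [b..<N+1]"
    by (rule level_rows_upt) (auto simp: line_wt_def)
  ultimately show ?thesis by simp
qed

text \<open>The entry \<open>b\<close> outweighs all smaller ones, so it forms a row of its own just
  below their rows \<open>L\<close>. Moving it to the top changes its weight from
  \<open>b - 1\<close> to \<open>1 - b\<close>, which is the passage from \<open>line_wt P b\<close>
  to \<open>line_wt P (b + 1)\<close>; moving it into a row of \<open>L\<close> adds a pair to the
  code.\<close>

lemma line_tab_step:
  assumes "valid N P" "top_entry P < b" "b \<le> N"
  defines "L \<equiv> level_rows (line_wt P b) {1..<b}" and "S \<equiv> map (\<lambda>r. [r]) [b+1..<N+1]"
  shows "level_rows (line_wt P b) {1..N} = L @ [b] # S" 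
    and "length L + length P + 1 = b"
    and "\<forall>R\<in>set L. R \<noteq> [] \<and> b \<notin> set R" 
    and "\<forall>R\<in>set S. R \<noteq> [] \<and> b \<notin> set R"
    and "level_rows (line_wt P (b + 1)) {1..N} = [b] # L @ S"
    and "row_of (level_rows (line_wt P b) {1..N}) b = length L + 1"
    and "i < length L \<Longrightarrow> code_tab N ((b, hd (L ! i)) # P) = L[i := insort b (L ! i)] @ S"
proof -
  have b1: "1 < b" using top_entry_ge[OF assms(1)] assms(2) by simp
  show T: "level_rows (line_wt P b) {1..N} = L @ [b] # S"
    using line_tab_split[OF assms(1,2)] assms(3) by (simp add: L_def S_def upt_conv_Cons)
  have vb: "valid (b - 1) P" using valid_mono[OF valid_top[OF assms(1)], of "b - 1"] assms(2) by simp
  have "card (line_wt P b ` {1..b-1}) + length P = b - 1"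
    by (rule card_code_classes[OF vb]) (use line_wt_eq_iff[OF assms(1,2)] in auto)
  moreover have "{1..b-1} = {1..<b}" using b1 by auto
  ultimately show len: "length L + length P + 1 = b" using b1 by (simp add: L_def length_level_rows)
  show L: "\<forall>R\<in>set L. R \<noteq> [] \<and> b \<notin> set R"
    using set_level_rows_sub[of "{1..<b}" _ "line_wt P b" b] level_rows_nonempty_row[of "{1..<b}"] by (auto simp: L_def)
  show S: "\<forall>R\<in>set S. R \<noteq> [] \<and> b \<notin> set R" by (auto simp: S_def)
  have "level_rows (line_wt P (b + 1)) {1..N} = level_rows (line_wt P (b+1)) {1..<b+1} @ S"
    using line_tab_split[OF assms(1), of "b+1"] assms(2,3) by (simp add: S_def)
  also have "{1..<b+1} = {b} \<union> {1..<b}" using b1 by auto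
  also have "level_rows (line_wt P (b+1)) ({b} \<union> {1..<b}) = [b] # level_rows (line_wt P (b+1)) {1..<b}"
  proof (subst level_rows_Un)
    fix d e assume "d \<in> {b}" "e \<in> {1..<b}"
    then show "line_wt P (b + 1) d < line_wt P (b + 1) e"
      using abs_wt[OF assms(1), of e] rep_le[OF assms(1), of e] wt_above[OF assms(2)] by (auto simp: line_wt_def)
  qed (auto simp: level_rows_singleton)
  also have "level_rows (line_wt P (b+1)) {1..<b} = L"
    unfolding L_def by (rule level_rows_eqI) (auto simp: line_wt_def)
  finally show "level_rows (line_wt P (b + 1)) {1..N} = [b] # L @ S" by simp
  have o: "ordered_rows (line_wt P b) {1..N} (level_rows (line_wt P b) {1..N})" by (simp add: ordered_rows_level_rows)
  show "row_of (level_rows (line_wt P b) {1..N}) b = length L + 1"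
    using row_of_eqI[OF distinct_concat_ordered[OF o], of "length L" b] L S
    unfolding T by auto
  assume i: "i < length L"
  define Q where "Q = (b, hd (L ! i)) # P"
  have "L ! i \<in> set L" using i by simp
  then have "hd (L ! i) \<in> set (L ! i)" using L by auto
  then have hdi: "hd (L ! i) \<in> {1..<b}"
    using set_level_rows_sub[of "{1..<b}" "L ! i" "line_wt P b" "hd (L!i)"] i by (auto simp: L_def)
  have "ordered_rows (wt Q) (insert b {1..<b}) (L[i := insort b (L ! i)])"
    by (rule ordered_rows_insert[of "line_wt P b"])
      (use i hdi in \<open>auto simp: L_def ordered_rows_level_rows Q_def line_wt_def\<close>)
  then have t1: "level_rows (wt Q) (insert b {1..<b}) = L[i := insort b (L ! i)]"
    by (rule ordered_rows_unique[symmetric])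
  have "{1..N} = insert b {1..<b} \<union> {b+1..<N+1}" using b1 assms(3) by auto
  moreover have "level_rows (wt Q) (insert b {1..<b} \<union> {b+1..<N+1}) = level_rows (wt Q) (insert b {1..<b}) @ level_rows (wt Q) {b+1..<N+1}"
  proof (rule level_rows_Un)
    fix d e assume "d \<in> insert b {1..<b}" "e \<in> {b+1..<N+1}"
    then show "wt Q d < wt Q e"
      using abs_wt[OF assms(1), of d] rep_le[OF assms(1), of d] 
        abs_wt[OF assms(1), of "hd (L ! i)"] rep_le[OF assms(1), of "hd (L ! i)"] hdi
      by (auto simp: Q_def)
  qed auto
  moreover have "level_rows (wt Q) {b+1..<N+1} = S"
    unfolding S_def by (rule level_rows_upt) (auto simp: Q_def)
  ultimately show "code_tab N ((b, hd (L ! i)) # P) = L[i := insort b (L ! i)] @ S"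
    using t1 by (simp add: Q_def)
qed

text \<open>Below the rows of the entries up to \<open>top_entry P\<close>, of which there are
  \<open>top_entry P - length P\<close>, all rows are single boxes in increasing order. So the row
  \<open>i\<close> there consists of the entry \<open>i + length P\<close>, and the row range of the
  block becomes the entry range of \<open>children\<close>.\<close>

lemma block_line_tab:
  assumes "valid n P" "1 \<le> n"
  shows "block (length P) n (n + 1 - length P) (level_rows (line_wt P (top_entry P + 1)) {1..n+1})
         = map (code_tab (n + 1)) (children (n + 1) P)"
proof -
  define t where "t = top_entry P"
  define k where "k = length P"
  define T where "T = level_rows (line_wt P (t + 1)) {1..n+1}"
  have v: "valid (n + 1) P" using valid_mono[OF assms(1)] by simp
  have t: "1 \<le> t" "t \<le> n" using top_entry_ge top_entry_le assms by (auto simp: t_def)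
  have lt: "k < t + 1" and len: "length (level_rows (line_wt P (t + 1)) {1..<t+1}) + k = t"
    using line_tab_step(2)[OF v, of "t + 1"] t by (auto simp: t_def k_def)
  have kt: "k \<le> t" using lt by simp
  have len': "length (level_rows (line_wt P (Suc t)) {Suc 0..<Suc t}) = t - k" using len by simp
  have "min_level k n T = t - 1"
    unfolding k_def T_def t_def using line_wt_eq_iff[OF v] by (intro min_level_line[OF v]) auto
  then have s: "min_level k n T + 1 - k = t - k" using t by simp
  have bt: "block_tab T (t - k) d = level_rows (line_wt P (t + 1 + d)) {1..n+1}" if "t + d \<le> n + 1" for d
    using that
  proof (induction d)
    case (Suc d)
    note st = line_tab_step[OF v, of "t + 1 + d"]
    have hdT: "first_entry T (t - k + Suc d) = t + 1 + d"
    proof -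
      have T': "T = level_rows (line_wt P (t + 1)) {1..<t+1} @ map (\<lambda>r. [r]) [t+1..<n+2]"
        unfolding T_def using line_tab_split[OF v, of "t + 1"] t by (simp add: t_def)
      have "T ! (t - k + d) = [t + 1 + d]"
        unfolding T' using len' Suc.prems kt nth_upt[of "Suc t" d "Suc (Suc n)"]
        by (subst nth_append) (auto simp del: upt_Suc)
      then show ?thesis by (simp add: first_entry_def)
    qed
    have "block_tab T (t - k) (Suc d) = move 0 (t + 1 + d) (level_rows (line_wt P (t + 1 + d)) {1..n+1})"
      using Suc hdT by simp
    also have "\<dots> = level_rows (line_wt P (t + 1 + d + 1)) {1..n+1}"
      using st(1,3,4,5) move_single(1)[of _ "t + 1 + d"] Suc.prems by (simp add: t_def)
    finally show ?case by simp
  qed (simp add: T_def)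
  have mv: "moves (first_entry T i) (block_tab T (t - k) (i - 1 - (t - k))) = map (code_tab (n + 1)) (children_at P (i + k))"
    if i: "t - k < i" "i < n + 1 - k + 1" for i
  proof -
    define b where "b = i + k"
    have b: "top_entry P < b" "b \<le> n + 1" using i kt t by (auto simp: b_def t_def)
    have T': "T = level_rows (line_wt P (t + 1)) {1..<t+1} @ map (\<lambda>r. [r]) [t+1..<n+2]"
      unfolding T_def using line_tab_split[OF v, of "t + 1"] t by (simp add: t_def)
    have "T ! (i - 1) = [b]"
      unfolding T' using len' i kt nth_upt[of "Suc t" "i - 1 - (t - k)" "Suc (Suc n)"]
      by (subst nth_append) (auto simp: b_def simp del: upt_Suc)
    then have fe: "first_entry T i = b" by (simp add: first_entry_def)
    have U: "block_tab T (t - k) (i - 1 - (t - k)) = level_rows (line_wt P b) {1..n+1}"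
      using bt[of "i - 1 - (t - k)"] i kt by (simp add: b_def)
    note st = line_tab_step[OF v b]
    define L where "L = level_rows (line_wt P b) {1..<b}"
    define S where "S = map (\<lambda>r. [r]) [b+1..<n+1+1]"
    have "moves b (level_rows (line_wt P b) {1..n+1}) = map (\<lambda>j. move j b (L @ [b] # S)) (rev [1..<length L + 1])"
      unfolding moves_def st(6) using st(1) by (simp add: L_def S_def)
    also have "[1..<length L + 1] = map Suc [0..<length L]"
      by (simp add: map_Suc_upt)
    also have "map (\<lambda>j. move j b (L @ [b] # S)) (rev (map Suc [0..<length L])) =
      map (\<lambda>i. move (Suc i) b (L @ [b] # S)) (rev [0..<length L])"
      by (simp add: rev_map)
    also have "\<dots> = map (\<lambda>i. code_tab (n+1) ((b, hd (L ! i)) # P)) (rev [0..<length L])"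
    proof (rule map_cong[OF refl])
      fix i assume "i \<in> set (rev [0..<length L])"
      then have "i < length L" by simp
      then show "move (Suc i) b (L @ [b] # S) = code_tab (n+1) ((b, hd (L ! i)) # P)"
        using st(7)[of i] st(3,4) move_single(2)[of L b S i] by (simp add: L_def S_def)
    qed
    also have "\<dots> = map (\<lambda>R. code_tab (n+1) ((b, hd R) # P)) (rev (map (\<lambda>i. L ! i) [0..<length L]))"
      by (simp add: rev_map)
    \<comment> \<open>Below \<open>b\<close> the weight \<open>line_wt P b\<close> is the negative
      of \<open>wt P\<close>, so decreasing row numbers list the rows by increasing
      \<open>wt P\<close>.\<close>
    also have "rev (map (\<lambda>i. L ! i) [0..<length L]) = level_rows (wt P) {1..<b}"
    proof -
      have "L = level_rows (\<lambda>d. - wt P d) {1..<b}"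
        unfolding L_def by (rule level_rows_eqI) (auto simp: line_wt_def)
      then show ?thesis using level_rows_rev[of "{1..<b}" "wt P"] map_nth[of L] by simp
    qed
    finally show ?thesis unfolding fe U b_def[symmetric] children_at_def map_map comp_def .
  qed
  have "block k n (n + 1 - k) T = concat (map (\<lambda>i. map (code_tab (n + 1)) (children_at P (i + k))) [t - k + 1..<n + 1 - k + 1])"
    unfolding block_def Let_def s
    by (intro arg_cong[of _ _ concat] map_cong[OF refl] mv) (auto simp del: upt_Suc)
  also have "\<dots> = concat (map (\<lambda>b. map (code_tab (n + 1)) (children_at P b)) (map (\<lambda>i. i + k) [t - k + 1..<n + 1 - k + 1]))"
    by (simp add: comp_def)
  also have "map (\<lambda>i. i + k) [t - k + 1..<n + 1 - k + 1] = [t + 1..<n + 1 + 1]"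
    using kt t by (intro nth_equalityI) (auto simp del: upt_Suc)
  finally show ?thesis
    by (simp add: children_def map_concat comp_def T_def t_def k_def del: upt_Suc)
qed

section \<open>The polynomial model\<close>

text \<open>This is the negative of the coordinate x_d of the overview. The minus sign is restored
  in \<open>poly_vec\<close>, where it cancels the one in the origin.\<close>

definition val :: "(nat \<Rightarrow> real) \<Rightarrow> (nat \<Rightarrow> real) \<Rightarrow> nat \<Rightarrow> real poly \<Rightarrow> real" where
  "val \<beta> s d p = \<beta> d * poly p (s d)"

definition sat :: "(nat \<Rightarrow> real) \<Rightarrow> (nat \<Rightarrow> real) \<Rightarrow> code \<Rightarrow> real poly \<Rightarrow> bool" where
  "sat \<beta> s P p \<longleftrightarrow> (\<forall>(b, c)\<in>set P. val \<beta> s b p = val \<beta> s c p)"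

lemma val_add [simp]: "val \<beta> s d (p + q) = val \<beta> s d p + val \<beta> s d q"
  and val_diff [simp]: "val \<beta> s d (p - q) = val \<beta> s d p - val \<beta> s d q"
  and val_smult [simp]: "val \<beta> s d (smult t p) = t * val \<beta> s d p"
  and val_0 [simp]: "val \<beta> s d 0 = 0"
  by (simp_all add: val_def algebra_simps)

lemma sat_add: "sat \<beta> s P p \<Longrightarrow> sat \<beta> s P q \<Longrightarrow> sat \<beta> s P (p + q)"
  and sat_diff: "sat \<beta> s P p \<Longrightarrow> sat \<beta> s P q \<Longrightarrow> sat \<beta> s P (p - q)"
  and sat_smult: "sat \<beta> s P p \<Longrightarrow> sat \<beta> s P (smult t p)"
  unfolding sat_def by fastforce+

lemma sat_rep:
  assumes "valid N P" "sat \<beta> s P p"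
  shows "val \<beta> s (rep P d) p = val \<beta> s d p"
  using assms by (induction N P rule: valid.induct) (auto simp: sat_def)

text \<open>The factor X^l replaces \<open>l\<close> further coded entries whose parameters have
  tended to 0; each of them reverses the order of the smaller entries, hence the sign (-1)^l.
  Positivity of \<open>coeff p l\<close> models the value at 0 of a product of factors X - s_b with
  negative s_b. The clause on \<open>q\<close> says that the homogeneous conditions have no solution
  in lower degree, which later becomes transversality of the flat.\<close>

definition code_poly ::
    "(nat \<Rightarrow> real) \<Rightarrow> (nat \<Rightarrow> real) \<Rightarrow> nat \<Rightarrow> code \<Rightarrow> nat \<Rightarrow> real poly \<Rightarrow> bool" where
  "code_poly \<beta> s N P l p \<longleftrightarrow>
     coeff p (length P + l) = 1 \<and> (\<forall>i>length P + l. coeff p i = 0) \<and>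
     (\<forall>i<l. coeff p i = 0) \<and> coeff p l > 0 \<and> sat \<beta> s P p \<and>
     (\<forall>q. (\<forall>i\<ge>length P + l. coeff q i = 0) \<and> (\<forall>i<l. coeff q i = 0) \<and> sat \<beta> s P q \<longrightarrow> q = 0) \<and>
     (\<forall>d\<in>{1..N}. \<forall>e\<in>{1..N}. wt P d < wt P e \<longrightarrow> (-1)^l * val \<beta> s d p < (-1)^l * val \<beta> s e p)"

text \<open>The degree bound \<open>M\<close> is fixed in advance because the factors \<beta> are
  chosen to beat all powers up to \<open>M\<close>. The last clause compares second coefficients
  between codes of possibly different lengths but equal total degree.\<close>

definition poly_system :: "nat \<Rightarrow> nat \<Rightarrow> (nat \<Rightarrow> real) \<Rightarrow> (nat \<Rightarrow> real) \<Rightarrow> (code \<Rightarrow> nat \<Rightarrow> real poly) \<Rightarrow> bool" where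
  "poly_system N M \<beta> s pp \<longleftrightarrow> \<beta> 1 = 0 \<and>
     (\<forall>P l. valid N P \<and> length P + l \<le> M \<longrightarrow> code_poly \<beta> s N P l (pp P l)) \<and>
     (\<forall>P Q l m. valid N P \<and> valid N Q \<and> length P + l = length Q + m \<and> length P + l \<le> M \<and> code_less P Q \<longrightarrow>
        coeff (pp Q m) (length P + l - 1) < coeff (pp P l) (length P + l - 1))"

lemma finite_valid: "finite {P. valid N P}"
proof (rule finite_subset)
  have "length P \<le> N" if "valid N P" for P
    using that by (induction N P rule: valid.induct) auto
  then show "{P. valid N P} \<subseteq> {P. set P \<subseteq> {..N} \<times> {..N} \<and> length P \<le> N}"
    using valid_fst by force
  show "finite {P. set P \<subseteq> {..N} \<times> {..N} \<and> length P \<le> N}"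
    by (intro finite_lists_length_le) auto
qed

lemma eventually_ball_imp:
  assumes "finite S" "\<And>x. x \<in> S \<Longrightarrow> C x \<Longrightarrow> eventually (F x) G"
  shows "eventually (\<lambda>r. \<forall>x\<in>S. C x \<longrightarrow> F x r) G"
  using assms(2) by (intro eventually_ball_finite[OF assms(1)] ballI) (auto intro: always_eventually elim: eventually_mono)

lemma poly_over_power_tendsto:
  fixes p :: "real poly"
  assumes "\<forall>i<l. coeff p i = 0"
  shows "((\<lambda>r. poly p (- r) / (- r) ^ l) \<longlongrightarrow> coeff p l) (at_right 0)"
proof -
  have "monom 1 l dvd p" using assms by (simp add: monom_1_dvd_iff')
  then obtain q where q: "p = monom 1 l * q" by (elim dvdE)
  have "((\<lambda>r. poly q (- r)) \<longlongrightarrow> poly q (- 0)) (at_right 0)"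
    by (intro tendsto_intros)
  moreover have "poly q (- 0) = coeff p l" by (simp add: q coeff_monom_mult poly_0_coeff_0)
  moreover have "\<forall>\<^sub>F r in at_right (0::real). poly q (- r) = poly p (- r) / (- r) ^ l"
    using eventually_at_right_less[of "0::real"] by eventually_elim (simp add: q poly_monom)
  ultimately show ?thesis by (simp add: tendsto_cong)
qed

text \<open>Deletes the pair of the newest entry. The stripped code, with the exponent raised by 1
  if a pair was deleted, carries the limit polynomial when the parameter of that entry tends to
  0.\<close>

fun strip :: "nat \<Rightarrow> code \<Rightarrow> code" where
  "strip N [] = []"
| "strip N ((b, c) # P) = (if b = N then P else (b, c) # P)"

lemma valid_Suc_cases:
  assumes "valid (Suc N) P"
  obtains (old) "valid N P" "strip (Suc N) P = P" 
  | (new) c R where "P = (Suc N, c) # R" "valid N R" "c \<in> {1..N}" "c \<notin> fst ` set R" "strip (Suc N) P = R"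
proof (cases P)
  case Nil
  then show ?thesis using old by simp
next
  case (Cons x R)
  then show ?thesis using assms old new by (cases x; cases "fst x = Suc N") auto
qed

lemma valid_append: "valid K (X @ R) \<Longrightarrow> valid K R"
proof (induction X arbitrary: K)
  case (Cons x X)
  then have "valid (fst x - 1) R" "fst x \<le> K" by (cases x; auto)+
  then show ?case by (auto intro: valid_mono)
qed simp

text \<open>Deleting the newest entry preserves the strict order unless both codes become the same
  code \<open>R\<close>. That leaves two cases, a pair against none and two pairs with different
  minima, in which the limits agree and the correction \<open>tau\<close> has to decide.\<close>

lemma code_less_strip:
  assumes "code_less P Q" "valid (Suc N) P" "valid (Suc N) Q"
  shows "code_less (strip (Suc N) P) (strip (Suc N) Q) \<or>
    (\<exists>c R. P = (Suc N, c) # R \<and> Q = R) \<or>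
    (\<exists>c c' R. P = (Suc N, c) # R \<and> Q = (Suc N, c') # R \<and> wt R c < wt R c')"
  using assms(1)
proof cases
  case (pos b b' X c R Y c')
  obtain X' where X': "strip (Suc N) P = X' @ (b, c) # R"
  proof (cases X)
    case Nil
    have "b' \<le> Suc N" using valid_fst[OF assms(3), of "(b', c')"] pos by auto
    then have "b \<noteq> Suc N" using pos by simp
    then show ?thesis using that[of "[]"] pos Nil by simp
  next
    case (Cons x X'')
    then show ?thesis using that[of X] that[of X''] pos by (cases x; cases "fst x = Suc N") auto
  qed
  consider Y' where "strip (Suc N) Q = Y' @ (b', c') # R" | "strip (Suc N) Q = R"
  proof (cases Y)
    case Nil
    then show ?thesis using that(1)[of "[]"] that(2) pos by (cases "b' = Suc N") auto
  next
    case (Cons y Y'')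
    then show ?thesis using that(1)[of Y] that(1)[of Y''] pos by (cases y; cases "fst y = Suc N") auto
  qed
  then show ?thesis
    unfolding X' by cases (use pos in \<open>auto intro: code_less.pos code_less.ext\<close>)
next
  case (row R c c' X b Y)
  have bn: "b \<noteq> Suc N" if XY: "X \<noteq> [] \<or> Y \<noteq> []"
  proof -
    have vr: "valid K ((a, d) # Z @ (b, e) # R) \<Longrightarrow> b \<noteq> K" for a d Z e K
      using valid_fst[of "a - 1" "Z @ (b, e) # R" "(b, e)"] by auto
    show ?thesis
    proof (cases X)
      case Nil
      then obtain a d Z where "Y = (a, d) # Z" using XY by (cases Y) auto
      then show ?thesis using vr assms(3) row by auto
    next
      case (Cons x Z)
      then show ?thesis using vr[of "Suc N" "fst x" "snd x" Z c] assms(2) row by (cases x) auto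
    qed
  qed
  have st: "\<exists>Z'. strip (Suc N) (Z @ (b, e) # R) = Z' @ (b, e) # R" if "b \<noteq> Suc N" for Z e
    using that by (cases "(Suc N, Z)" rule: strip.cases) (auto intro: exI[of _ "[]"] exI[of _ "Z"])
  show ?thesis
  proof (cases "b = Suc N")
    case True
    then have "X = [] \<and> Y = []" using bn by blast
    then show ?thesis using True row by auto
  next
    case False
    then obtain X' Y' where "strip (Suc N) P = X' @ (b, c) # R" "strip (Suc N) Q = Y' @ (b, c') # R"
      using st row by metis
    then show ?thesis using code_less.row[OF row(3)] by simp
  qed
next
  case (ext X b c)
  have Q: "strip (Suc N) Q = Q"
  proof (cases Q)
    case (Cons q Q')
    have "fst q \<le> b - 1" 
    proof -
      have "valid (Suc N) ((b, c) # Q)" using assms(2) valid_append ext by blast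
      then have "valid (b - 1) Q" by simp
      then show ?thesis using valid_fst[of "b-1" Q q] Cons by auto
    qed
    moreover have "b \<le> Suc N" "2 \<le> b" using valid_fst[OF assms(2), of "(b, c)"] ext by auto
    ultimately show ?thesis using Cons by (cases q) auto
  qed simp
  show ?thesis
  proof (cases "X = [] \<and> b = Suc N")
    case True
    then show ?thesis using ext by auto
  next
    case False
    have "\<exists>Z'. strip (Suc N) P = Z' @ (b, c) # Q"
      using False ext by (cases "(Suc N, X)" rule: strip.cases) (auto intro: exI[of _ "[]"] exI[of _ X])
    then show ?thesis using Q code_less.ext by metis
  qed
qed

section \<open>Adding one entry, with its parameter \<open>- r\<close> tending to 0\<close>

locale extend =
  fixes N M :: nat and \<beta> s :: "nat \<Rightarrow> real" and pp :: "code \<Rightarrow> nat \<Rightarrow> real poly"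
  assumes N: "1 \<le> N" and poly_system: "poly_system N M \<beta> s pp"
begin

lemma cp: "valid N P \<Longrightarrow> length P + l \<le> M \<Longrightarrow> code_poly \<beta> s N P l (pp P l)"
  using poly_system unfolding poly_system_def by blast

lemma less_coeff: "valid N P \<Longrightarrow> valid N Q \<Longrightarrow> length P + l = length Q + m \<Longrightarrow> length P + l \<le> M \<Longrightarrow> code_less P Q \<Longrightarrow>
    coeff (pp Q m) (length P + l - 1) < coeff (pp P l) (length P + l - 1)"
  using poly_system unfolding poly_system_def by blast

text \<open>The solution of a linear equation: with this coefficient, \<open>pp R (Suc l)\<close>
  plus \<open>tau\<close> times \<open>pp R l\<close> satisfies the relation of the new pair
  \<open>(Suc N, c)\<close>, cleared of the denominator \<open>r ^ Suc M\<close>.\<close>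

definition tau :: "code \<Rightarrow> nat \<Rightarrow> nat \<Rightarrow> real \<Rightarrow> real" where
  "tau R l c r = - (poly (pp R (Suc l)) (- r) - r ^ Suc M * val \<beta> s c (pp R (Suc l)))
                 / (poly (pp R l) (- r) - r ^ Suc M * val \<beta> s c (pp R l))"

text \<open>By the uniqueness clause for \<open>R\<close>, the polynomials on the flat of
  \<open>R\<close> that are monic of degree \<open>length R + l + 1\<close> and divisible by X^l
  form a line with direction \<open>pp R l\<close>; the new relation selects one of its
  points.\<close>

definition pp' :: "real \<Rightarrow> code \<Rightarrow> nat \<Rightarrow> real poly" where
  "pp' r P l = (case P of [] \<Rightarrow> pp P l
     | (b, c) # R \<Rightarrow> if b = Suc N then pp R (Suc l) + smult (tau R l c r) (pp R l) else pp P l)"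

text \<open>At \<open>- r\<close> the polynomial \<open>pp P l\<close> is of exact order
  \<open>r ^ l\<close> with \<open>l \<le> M\<close>, since its coefficient at \<open>l\<close> is
  positive. Division by \<open>r ^ Suc M\<close> therefore makes the new entry dominate all old
  ones, and makes the old values negligible in the equation for \<open>tau\<close>.\<close>

definition "\<beta>' r = \<beta>(Suc N := 1 / r ^ Suc M)"
definition "s' r = s(Suc N := - r)"

lemma power_over_power_tendsto:
  assumes "l \<le> M"
  shows "((\<lambda>r::real. r ^ Suc M * x / (- r) ^ l) \<longlongrightarrow> 0) (at_right 0)"
proof -
  have "((\<lambda>r::real. r ^ (Suc M - l) * x * (-1) ^ l) \<longlongrightarrow> 0 ^ (Suc M - l) * x * (-1) ^ l) (at_right 0)"
    by (intro tendsto_intros)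
  moreover have "(0::real) ^ (Suc M - l) * x * (-1) ^ l = 0" using assms by simp
  moreover have "\<forall>\<^sub>F r in at_right (0::real). r ^ (Suc M - l) * x * (-1) ^ l = r ^ Suc M * x / (- r) ^ l"
    using eventually_at_right_less[of "0::real"]
  proof eventually_elim
    case (elim r)
    have "r ^ Suc M = r ^ (Suc M - l) * r ^ l" using assms by (simp flip: power_add)
    moreover have "(- r) ^ l = (-1) ^ l * r ^ l" by (metis mult_minus1 power_mult_distrib)
    moreover have "(-1::real) ^ l * (-1) ^ l = 1" by (simp flip: power_mult_distrib)
    ultimately show ?case using elim by (simp add: field_simps)
  qed
  ultimately show ?thesis by (simp add: tendsto_cong)
qed

lemma den_tendsto:
  assumes "valid N R" "length R + l \<le> M"
  shows "((\<lambda>r. (poly (pp R l) (- r) - r ^ Suc M * val \<beta> s c (pp R l)) / (- r) ^ l) \<longlongrightarrow> coeff (pp R l) l) (at_right 0)"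
proof -
  have "((\<lambda>r. poly (pp R l) (- r) / (- r) ^ l - r ^ Suc M * val \<beta> s c (pp R l) / (- r) ^ l) \<longlongrightarrow> coeff (pp R l) l - 0) (at_right 0)"
    by (intro tendsto_diff poly_over_power_tendsto power_over_power_tendsto)
      (use cp[OF assms] assms in \<open>auto simp: code_poly_def\<close>)
  then show ?thesis by (simp add: diff_divide_distrib)
qed

lemma den_ne:
  assumes "valid N R" "length R + l \<le> M"
  shows "\<forall>\<^sub>F r in at_right 0. (poly (pp R l) (- r) - r ^ Suc M * val \<beta> s c (pp R l)) / (- r) ^ l > 0"
  using order_tendstoD(1)[OF den_tendsto[OF assms]] cp[OF assms] by (simp add: code_poly_def)

text \<open>Numerator and denominator of \<open>tau\<close> have leading terms in (-r)^(l+1) and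
  (-r)^l; the surplus factor -r cancels the minus sign. Hence \<open>tau\<close> is positive and of
  first order in \<open>r\<close>.\<close>

lemma tau_over_tendsto:
  assumes "valid N R" "length R + Suc l \<le> M"
  shows "((\<lambda>r. tau R l c r / r) \<longlongrightarrow> coeff (pp R (Suc l)) (Suc l) / coeff (pp R l) l) (at_right 0)"
proof -
  have l: "length R + l \<le> M" using assms by simp
  have "coeff (pp R l) l \<noteq> 0" using cp[OF assms(1) l] by (simp add: code_poly_def)
  then have "((\<lambda>r. ((poly (pp R (Suc l)) (- r) - r ^ Suc M * val \<beta> s c (pp R (Suc l))) / (- r) ^ Suc l) /
    ((poly (pp R l) (- r) - r ^ Suc M * val \<beta> s c (pp R l)) / (- r) ^ l)) \<longlongrightarrow> coeff (pp R (Suc l)) (Suc l) / coeff (pp R l) l) (at_right 0)"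
    by (intro tendsto_divide den_tendsto assms l)
  moreover have "\<forall>\<^sub>F r in at_right 0. ((poly (pp R (Suc l)) (- r) - r ^ Suc M * val \<beta> s c (pp R (Suc l))) / (- r) ^ Suc l) /
    ((poly (pp R l) (- r) - r ^ Suc M * val \<beta> s c (pp R l)) / (- r) ^ l) = tau R l c r / r"
    using eventually_at_right_less[of "0::real"]
  proof eventually_elim
    case (elim r)
    have "(a / (- r) ^ Suc l) / (b / (- r) ^ l) = (- a / b) / r" for a b
      using elim by (simp add: field_simps)
    then show ?case unfolding tau_def .
  qed
  ultimately show ?thesis by (simp add: tendsto_cong)
qed

lemma tau_tendsto:
  assumes "valid N R" "length R + Suc l \<le> M"
  shows "((\<lambda>r. tau R l c r) \<longlongrightarrow> 0) (at_right 0)"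
proof -
  have "((\<lambda>r. tau R l c r / r * r) \<longlongrightarrow> coeff (pp R (Suc l)) (Suc l) / coeff (pp R l) l * 0) (at_right 0)"
    by (intro tendsto_mult tau_over_tendsto assms tendsto_ident_at)
  moreover have "\<forall>\<^sub>F r in at_right 0. tau R l c r / r * r = tau R l c r"
    using eventually_at_right_less[of "0::real"] by eventually_elim simp
  ultimately show ?thesis by (simp add: tendsto_cong)
qed

lemma tau_pos:
  assumes "valid N R" "length R + Suc l \<le> M"
  shows "\<forall>\<^sub>F r in at_right 0. 0 < tau R l c r"
proof -
  have l: "length R + l \<le> M" using assms by simp
  have "0 < coeff (pp R (Suc l)) (Suc l) / coeff (pp R l) l"
    using cp[OF assms] cp[OF assms(1) l] by (simp add: code_poly_def)
  then have "\<forall>\<^sub>F r in at_right 0. 0 < tau R l c r / r"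
    by (rule order_tendstoD(1)[OF tau_over_tendsto[OF assms]])
  then show ?thesis using eventually_at_right_less[of "0::real"]
    by eventually_elim (simp add: zero_less_divide_iff)
qed

text \<open>The cross-multiplied difference of the two quotients is a positive factor times
  \<open>(- r) ^ l * G r\<close>, where \<open>G\<close> tends to \<open>a * (X - X')\<close>: the
  terms with \<open>A\<close> are of higher order, and so are those with \<open>r ^ Suc M\<close>.
  The sign is thus decided by the values of \<open>pp R (Suc l)\<close> at \<open>c\<close> and
  \<open>c'\<close>, whose order carries the sign (-1)^(l+1).\<close>

lemma tau_less:
  assumes "valid N R" "length R + Suc l \<le> M" "c \<in> {1..N}" "c' \<in> {1..N}" "wt R c < wt R c'"
  shows "\<forall>\<^sub>F r in at_right 0. tau R l c' r < tau R l c r"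
proof -
  have l: "length R + l \<le> M" using assms by simp
  define X X' Y Y' where "X = val \<beta> s c (pp R (Suc l))" and "X' = val \<beta> s c' (pp R (Suc l))"
    and "Y = val \<beta> s c (pp R l)" and "Y' = val \<beta> s c' (pp R l)"
  define A B where "A r = poly (pp R (Suc l)) (- r)" and "B r = poly (pp R l) (- r)" for r
  have XX: "(-1) ^ Suc l * X < (-1) ^ Suc l * X'"
    using cp[OF assms(1,2)] assms(3-5) unfolding code_poly_def X_def X'_def by blast
  define a where "a = coeff (pp R l) l"
  have a: "a > 0" using cp[OF assms(1) l] by (simp add: code_poly_def a_def)
  have tA: "((\<lambda>r. A r / (- r) ^ Suc l) \<longlongrightarrow> coeff (pp R (Suc l)) (Suc l)) (at_right 0)"
    unfolding A_def by (rule poly_over_power_tendsto) (use cp[OF assms(1,2)] in \<open>simp add: code_poly_def\<close>)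
  have tB: "((\<lambda>r. B r / (- r) ^ l) \<longlongrightarrow> a) (at_right 0)"
    unfolding B_def a_def by (rule poly_over_power_tendsto) (use cp[OF assms(1) l] in \<open>simp add: code_poly_def\<close>)
  have te: "((\<lambda>r::real. r ^ Suc M * (X' * Y - X * Y') / (- r) ^ l) \<longlongrightarrow> 0) (at_right 0)"
    using assms(2) by (intro power_over_power_tendsto) simp
  define G where "G r = A r / (- r) ^ Suc l * (- r) * (Y' - Y) + B r / (- r) ^ l * (X - X') + r ^ Suc M * (X' * Y - X * Y') / (- r) ^ l" for r
  have "(G \<longlongrightarrow> coeff (pp R (Suc l)) (Suc l) * (- 0) * (Y' - Y) + a * (X - X') + 0) (at_right 0)"
    unfolding G_def by (intro tendsto_intros tA tB te)
  then have "((\<lambda>r. (-1) ^ l * G r) \<longlongrightarrow> (-1) ^ l * (a * (X - X'))) (at_right 0)"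
    by (intro tendsto_intros) simp
  moreover have "0 < (-1) ^ l * (a * (X - X'))"
  proof -
    have "0 < (-1) ^ l * (X - X')" using XX by (simp add: algebra_simps)
    then show ?thesis using a by (metis mult.left_commute mult_pos_pos)
  qed
  ultimately have "\<forall>\<^sub>F r in at_right 0. 0 < (-1) ^ l * G r" by (rule order_tendstoD)
  then show ?thesis
    using den_ne[OF assms(1) l, of c] den_ne[OF assms(1) l, of c'] eventually_at_right_less[of "0::real"]
  proof eventually_elim
    case (elim r)
    define D D' where "D = B r - r ^ Suc M * Y" and "D' = B r - r ^ Suc M * Y'"
    have D: "D / (- r) ^ l > 0" "D' / (- r) ^ l > 0"
      using elim by (simp_all add: D_def D'_def B_def Y_def Y'_def)
    have rl: "(- r) ^ l \<noteq> 0" using elim by simp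
    have Dn: "D \<noteq> 0" "D' \<noteq> 0" using D by auto
    have "0 < (D / (- r) ^ l) * (D' / (- r) ^ l)" using D by (rule mult_pos_pos)
    then have "0 < D * D' / ((- r) ^ l)\<^sup>2" by (simp add: power2_eq_square)
    then have DD: "0 < D * D'" by (simp add: zero_less_divide_iff)
    have t: "tau R l c r = - (A r - r ^ Suc M * X) / D" "tau R l c' r = - (A r - r ^ Suc M * X') / D'"
      by (simp_all add: tau_def A_def X_def X'_def D_def D'_def B_def Y_def Y'_def)
    have "(- r) ^ l * G r = A r * (Y' - Y) + B r * (X - X') + r ^ Suc M * (X' * Y - X * Y')"
      using elim rl by (simp add: G_def field_simps)
    moreover have "tau R l c r - tau R l c' r = 
        (- (A r - r ^ Suc M * X) * D' + (A r - r ^ Suc M * X') * D) / (D * D')"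
      using Dn by (simp add: t field_simps)
    moreover have "- (A r - r ^ Suc M * X) * D' + (A r - r ^ Suc M * X') * D =
      r ^ Suc M * (A r * (Y' - Y) + B r * (X - X') + r ^ Suc M * (X' * Y - X * Y'))"
      by (simp add: D_def D'_def algebra_simps)
    ultimately have "tau R l c r - tau R l c' r = r ^ Suc M * ((- r) ^ l * G r) / (D * D')" by simp
    moreover have "(- r) ^ l * G r = r ^ l * ((-1) ^ l * G r)"
      by (metis mult.assoc mult.commute mult_minus1 power_mult_distrib)
    moreover have "0 < r ^ Suc M * (r ^ l * ((-1) ^ l * G r)) / (D * D')"
      using elim DD by (intro divide_pos_pos[OF mult_pos_pos[OF _ mult_pos_pos]]) auto
    ultimately show ?case by simp
  qed
qed

lemma new_val_large:
  assumes "valid N P" "length P + l \<le> M"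
  shows "\<forall>\<^sub>F r in at_right 0. x < (-1) ^ l * (poly (pp P l) (- r) / r ^ Suc M)"
proof -
  define a where "a = coeff (pp P l) l"
  have a: "a > 0" using cp[OF assms] by (simp add: code_poly_def a_def)
  have "((\<lambda>r. poly (pp P l) (- r) / (- r) ^ l) \<longlongrightarrow> a) (at_right 0)"
    unfolding a_def by (rule poly_over_power_tendsto) (use cp[OF assms] in \<open>simp add: code_poly_def\<close>)
  then have "\<forall>\<^sub>F r in at_right 0. a / 2 < poly (pp P l) (- r) / (- r) ^ l"
    by (rule order_tendstoD) (use a in simp)
  moreover have "((\<lambda>r::real. r ^ Suc M * x / (- r) ^ l) \<longlongrightarrow> 0) (at_right 0)"
    using assms(2) by (intro power_over_power_tendsto) simp
  then have "((\<lambda>r::real. (-1) ^ l * (r ^ Suc M * x / (- r) ^ l)) \<longlongrightarrow> (-1) ^ l * 0) (at_right 0)"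
    by (intro tendsto_intros)
  then have "\<forall>\<^sub>F r in at_right 0. (-1) ^ l * (r ^ Suc M * x / (- r) ^ l) < a / 2"
    by (rule order_tendstoD) (use a in simp)
  ultimately show ?thesis using eventually_at_right_less[of "0::real"]
  proof eventually_elim
    case (elim r)
    have m: "(-1::real) ^ l * (-1) ^ l = 1" by (simp flip: power_mult_distrib)
    have e: "(- r) ^ l = (-1) ^ l * r ^ l" by (metis mult_minus1 power_mult_distrib)
    have "(-1) ^ l * (r ^ Suc M * x / (- r) ^ l) = r ^ Suc M * x / r ^ l"
      using m elim by (simp add: e field_simps)
    moreover have "poly (pp P l) (- r) / (- r) ^ l = (-1) ^ l * poly (pp P l) (- r) / r ^ l"
      using m elim by (simp add: e field_simps)
    ultimately have "r ^ Suc M * x / r ^ l < (-1) ^ l * poly (pp P l) (- r) / r ^ l"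
      using elim by linarith
    then have "r ^ Suc M * x < (-1) ^ l * poly (pp P l) (- r)"
      using elim by (simp add: divide_less_cancel)
    then show ?case using elim by (simp add: field_simps del: power_Suc)
  qed
qed

lemma pp'_old: "valid N P \<Longrightarrow> pp' r P l = pp P l"
  by (auto simp: pp'_def split: list.split)

lemma pp'_new: "pp' r ((Suc N, c) # R) l = pp R (Suc l) + smult (tau R l c r) (pp R l)"
  by (simp add: pp'_def)

lemma val'_old: "d \<le> N \<Longrightarrow> val (\<beta>' r) (s' r) d p = val \<beta> s d p"
  by (simp add: val_def \<beta>'_def s'_def)

lemma val'_new: "val (\<beta>' r) (s' r) (Suc N) p = poly p (- r) / r ^ Suc M"
  by (simp add: val_def \<beta>'_def s'_def)

lemma sat'_old: "valid N P \<Longrightarrow> sat (\<beta>' r) (s' r) P p \<longleftrightarrow> sat \<beta> s P p"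
proof -
  assume "valid N P"
  then have "b \<le> N \<and> c \<le> N" if "(b, c) \<in> set P" for b c using valid_fst[of N P "(b,c)"] that by simp
  then show ?thesis unfolding sat_def using val'_old by fastforce
qed

lemma coeff_pp'_tendsto:
  assumes "valid (Suc N) P" "length P + l \<le> M"
  shows "\<exists>m. length P + l = length (strip (Suc N) P) + m \<and>
    ((\<lambda>r. coeff (pp' r P l) i) \<longlongrightarrow> coeff (pp (strip (Suc N) P) m) i) (at_right 0)"
  using assms(1)
proof (cases rule: valid_Suc_cases)
  case old
  then show ?thesis using pp'_old by auto
next
  case (new c R)
  have "((\<lambda>r. coeff (pp R (Suc l)) i + tau R l c r * coeff (pp R l) i) \<longlongrightarrow> coeff (pp R (Suc l)) i + 0 * coeff (pp R l) i) (at_right 0)"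
    using new assms(2) by (intro tendsto_intros tau_tendsto) auto
  then show ?thesis using new by (intro exI[of _ "Suc l"]) (simp add: pp'_new)
qed

text \<open>A strict inequality between the stripped codes survives for small \<open>r\<close>,
  because coefficients converge to those of the stripped codes. In the two tied cases the second
  coefficients differ by \<open>tau\<close>, or by a difference of two values of \<open>tau\<close>,
  times the leading coefficient 1 of \<open>pp R l\<close>.\<close>

lemma coeff_pp'_less:
  assumes "valid (Suc N) P" "valid (Suc N) Q" "length P + l = length Q + m" "length P + l \<le> M" "code_less P Q"
  shows "\<forall>\<^sub>F r in at_right 0. coeff (pp' r Q m) (length P + l - 1) < coeff (pp' r P l) (length P + l - 1)"
  using code_less_strip[OF assms(5,1,2)]
proof (elim disjE exE conjE)
  assume less: "code_less (strip (Suc N) P) (strip (Suc N) Q)"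
  have v: "valid N (strip (Suc N) P)" "valid N (strip (Suc N) Q)"
    using assms(1,2) by (auto elim!: valid_Suc_cases)
  obtain l' where l': "length P + l = length (strip (Suc N) P) + l'"
    "((\<lambda>r. coeff (pp' r P l) (length P + l - 1)) \<longlongrightarrow> coeff (pp (strip (Suc N) P) l') (length P + l - 1)) (at_right 0)"
    using coeff_pp'_tendsto[OF assms(1,4)] by blast
  obtain m' where m': "length Q + m = length (strip (Suc N) Q) + m'"
    "((\<lambda>r. coeff (pp' r Q m) (length P + l - 1)) \<longlongrightarrow> coeff (pp (strip (Suc N) Q) m') (length P + l - 1)) (at_right 0)"
    using coeff_pp'_tendsto[OF assms(2)] assms(3,4) by metis
  have "coeff (pp (strip (Suc N) Q) m') (length P + l - 1) < coeff (pp (strip (Suc N) P) l') (length P + l - 1)"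
    using less_coeff[OF v, of l' m'] less l'(1) m'(1) assms(3,4) by simp
  then show ?thesis
    using tendsto_diff[OF l'(2) m'(2)] order_tendstoD(1)[of _ _ _ 0] by (force elim: eventually_mono)
next
  fix c R assume P: "P = (Suc N, c) # R" "Q = R"
  have R: "valid N R" "c \<in> {1..N}" using assms(1) P by (auto elim: valid_Suc_cases)
  have m: "m = Suc l" using assms(3) P by simp
  have "coeff (pp R l) (length R + l) = 1" using cp[OF R(1), of l] assms(4) P by (simp add: code_poly_def)
  moreover have "\<forall>\<^sub>F r in at_right 0. 0 < tau R l c r"
    using assms(4) P by (intro tau_pos R) auto
  ultimately show ?thesis
    by (auto simp: P pp'_new pp'_old[OF R(1)] m elim: eventually_mono)
next
  fix c c' R assume P: "P = (Suc N, c) # R" "Q = (Suc N, c') # R" "wt R c < wt R c'"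
  have R: "valid N R" "c \<in> {1..N}" "c' \<in> {1..N}" using assms(1,2) P by (auto elim: valid_Suc_cases)
  have m: "m = l" using assms(3) P by simp
  have "coeff (pp R l) (length R + l) = 1" using cp[OF R(1), of l] assms(4) P by (simp add: code_poly_def)
  moreover have "\<forall>\<^sub>F r in at_right 0. tau R l c' r < tau R l c r"
    using assms(4) P R by (intro tau_less) auto
  ultimately show ?thesis
    by (auto simp: P pp'_new m elim: eventually_mono)
qed

text \<open>For small \<open>r\<close> the new polynomial is close to \<open>pp R (Suc l)\<close>,
  whose order carries the sign (-1)^(l+1) instead of (-1)^l. This is the origin of the sign change
  in \<open>wt\<close>.\<close>

lemma new_code_order:
  assumes "valid N R" "length R + Suc l \<le> M" "d \<in> {1..N}" "e \<in> {1..N}" "wt R e < wt R d"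
  shows "\<forall>\<^sub>F r in at_right 0. (-1) ^ l * val \<beta> s d (pp R (Suc l) + smult (tau R l c r) (pp R l)) <
    (-1) ^ l * val \<beta> s e (pp R (Suc l) + smult (tau R l c r) (pp R l))"
proof -
  let ?x = "val \<beta> s e (pp R (Suc l)) - val \<beta> s d (pp R (Suc l))"
  let ?y = "val \<beta> s e (pp R l) - val \<beta> s d (pp R l)"
  have "(-1) ^ Suc l * val \<beta> s e (pp R (Suc l)) < (-1) ^ Suc l * val \<beta> s d (pp R (Suc l))"
    using cp[OF assms(1,2)] assms(3-5) unfolding code_poly_def by blast
  then have "0 < (-1) ^ l * (?x + 0 * ?y)" by (simp add: algebra_simps)
  moreover have "((\<lambda>r. (-1) ^ l * (?x + tau R l c r * ?y)) \<longlongrightarrow> (-1) ^ l * (?x + 0 * ?y)) (at_right 0)"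
    by (intro tendsto_intros tau_tendsto assms)
  ultimately have "\<forall>\<^sub>F r in at_right 0. 0 < (-1) ^ l * (?x + tau R l c r * ?y)"
    by (rule order_tendstoD(1)[rotated])
  then show ?thesis by eventually_elim (simp add: algebra_simps)
qed

lemma code_poly_old:
  assumes P: "valid N P" "length P + l \<le> M"
    and large: "\<And>d. d \<in> {1..N} \<Longrightarrow> (-1) ^ l * val \<beta> s d (pp P l) < (-1) ^ l * (poly (pp P l) (- r) / r ^ Suc M)"
  shows "code_poly (\<beta>' r) (s' r) (Suc N) P l (pp' r P l)"
proof -
  have c: "code_poly \<beta> s N P l (pp P l)" by (rule cp[OF P])
  have ord: "(-1) ^ l * val (\<beta>' r) (s' r) d (pp P l) < (-1) ^ l * val (\<beta>' r) (s' r) e (pp P l)"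
    if "d \<in> {1..Suc N}" "e \<in> {1..Suc N}" "wt P d < wt P e" for d e
  proof -
    have top: "wt P (Suc N) = int N"
      using wt_above[of P "Suc N"] top_entry_le[OF P(1) N] by simp
    have "d \<noteq> Suc N"
    proof
      assume "d = Suc N"
      then have "int N < wt P e" using that top by simp
      moreover have "\<bar>wt P e\<bar> \<le> int e - 1" using abs_wt[OF P(1), of e] rep_le[OF P(1), of e] that by simp
      ultimately show False using that(2) by simp
    qed
    then have d: "d \<in> {1..N}" using that by auto
    show ?thesis
    proof (cases "e = Suc N")
      case True
      then show ?thesis using large[OF d] d by (simp add: val'_old val'_new)
    next
      case False
      then have "e \<in> {1..N}" using that by auto
      then show ?thesis using c d that(3) by (simp add: code_poly_def val'_old)
    qed
  qed
  then show ?thesis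
    using c unfolding code_poly_def pp'_old[OF P(1)] sat'_old[OF P(1)] by blast
qed

text \<open>For the uniqueness clause, a homogeneous solution differs from a multiple
  \<open>t\<close> of \<open>pp R l\<close> by something of lower degree, which vanishes by
  uniqueness for \<open>R\<close>; the new relation then says that \<open>t\<close> times the
  nonzero quantity in \<open>den\<close> is 0.\<close>

lemma code_poly_new:
  assumes R: "valid N R" "length R + Suc l \<le> M" "c \<in> {1..N}" "c \<notin> fst ` set R" and r: "0 < r"
    and pos: "0 < tau R l c r"
    and den: "poly (pp R l) (- r) - r ^ Suc M * val \<beta> s c (pp R l) \<noteq> 0"
    and ord: "\<And>d e. d \<in> {1..N} \<Longrightarrow> e \<in> {1..N} \<Longrightarrow> wt R e < wt R d \<Longrightarrow>
      (-1) ^ l * val \<beta> s d (pp R (Suc l) + smult (tau R l c r) (pp R l)) <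
      (-1) ^ l * val \<beta> s e (pp R (Suc l) + smult (tau R l c r) (pp R l))"
  shows "code_poly (\<beta>' r) (s' r) (Suc N) ((Suc N, c) # R) l (pp' r ((Suc N, c) # R) l)"
proof -
  let ?q = "pp R (Suc l) + smult (tau R l c r) (pp R l)"
  let ?Q = "(Suc N, c) # R"
  have l: "length R + l \<le> M" using R by simp
  have c1: "code_poly \<beta> s N R (Suc l) (pp R (Suc l))" by (rule cp[OF R(1,2)])
  have c0: "code_poly \<beta> s N R l (pp R l)" by (rule cp[OF R(1) l])
  have satR: "sat \<beta> s R ?q" using c1 c0 by (auto simp: code_poly_def intro: sat_add sat_smult)
  have satQ: "sat (\<beta>' r) (s' r) ?Q p \<longleftrightarrow> sat \<beta> s R p \<and> poly p (- r) = r ^ Suc M * val \<beta> s c p" for p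
    using sat'_old[OF R(1), of r p] R(3) r val'_old[of c r p]
    by (auto simp add: sat_def[of _ _ "_ # _"] val'_new sat_def[symmetric] field_simps simp del: power_Suc)
  have eq: "poly ?q (- r) = r ^ Suc M * val \<beta> s c ?q"
    using den by (simp add: tau_def field_simps del: power_Suc)
  have uniq: "q = 0" if q: "\<forall>i\<ge>length R + Suc l. coeff q i = 0" "\<forall>i<l. coeff q i = 0" "sat (\<beta>' r) (s' r) ?Q q" for q
  proof -
    define t where "t = coeff q (length R + l)"
    have sq: "sat \<beta> s R q" "poly q (- r) = r ^ Suc M * val \<beta> s c q" using q satQ by auto
    have "q - smult t (pp R l) = 0"
    proof -
      have "coeff (q - smult t (pp R l)) i = 0" if "i \<ge> length R + l" for i
        using that q(1) c0 by (cases "i = length R + l") (auto simp: code_poly_def t_def)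
      moreover have "coeff (q - smult t (pp R l)) i = 0" if "i < l" for i
        using that q(2) c0 by (auto simp: code_poly_def)
      moreover have "sat \<beta> s R (q - smult t (pp R l))"
        using sq c0 by (auto simp: code_poly_def intro: sat_diff sat_smult)
      ultimately show ?thesis using c0 unfolding code_poly_def by blast
    qed
    then have qt: "q = smult t (pp R l)" by simp
    then have "t * (poly (pp R l) (- r) - r ^ Suc M * val \<beta> s c (pp R l)) = 0"
      using sq(2) by (simp add: algebra_simps)
    then have "t = 0" using den by simp
    then show ?thesis using qt by simp
  qed
  have ord': "(-1) ^ l * val (\<beta>' r) (s' r) d ?q < (-1) ^ l * val (\<beta>' r) (s' r) e ?q"
    if "d \<in> {1..Suc N}" "e \<in> {1..Suc N}" "wt ?Q d < wt ?Q e" for d e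
  proof -
    \<comment> \<open>The new entry has the value of \<open>c\<close> and the weight of
      \<open>c\<close>, so replacing it by \<open>c\<close> reduces all comparisons to old
      entries.\<close>
    define g where "g d = (if d = Suc N then c else d)" for d
    have w: "wt ?Q d = - wt R (g d)" and vl: "val (\<beta>' r) (s' r) d ?q = val \<beta> s (g d) ?q"
      if "d \<in> {1..Suc N}" for d
      using that val'_old[of d r ?q] eq r by (auto simp: g_def val'_new field_simps simp del: power_Suc)
    have gN: "g d \<in> {1..N}" if "d \<in> {1..Suc N}" for d using that R(3) by (auto simp: g_def)
    show ?thesis unfolding vl[OF that(1)] vl[OF that(2)]
      using ord[OF gN[OF that(1)] gN[OF that(2)]] that(3) unfolding w[OF that(1)] w[OF that(2)] by simp
  qed
  show ?thesis
    unfolding code_poly_def pp'_new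
  proof (intro conjI allI impI ballI)
    show "coeff ?q (length ?Q + l) = 1" using c1 c0 by (simp add: code_poly_def)
    show "coeff ?q i = 0" if "length ?Q + l < i" for i using that c1 c0 by (simp add: code_poly_def)
    show "coeff ?q i = 0" if "i < l" for i using that c1 c0 by (simp add: code_poly_def)
    show "0 < coeff ?q l" using c1 c0 pos by (simp add: code_poly_def)
    show "sat (\<beta>' r) (s' r) ?Q ?q" using satQ satR eq by blast
    show "q = 0" if "(\<forall>i\<ge>length ?Q + l. coeff q i = 0) \<and> (\<forall>i<l. coeff q i = 0) \<and> sat (\<beta>' r) (s' r) ?Q q" for q
      using that by (intro uniq) auto
    show "(-1) ^ l * val (\<beta>' r) (s' r) d ?q < (-1) ^ l * val (\<beta>' r) (s' r) e ?q"
      if "d \<in> {1..Suc N}" "e \<in> {1..Suc N}" "wt ?Q d < wt ?Q e" for d e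
      by (rule ord'[OF that])
  qed
qed

text \<open>Each requirement holds for all sufficiently small \<open>r > 0\<close>, and there are
  finitely many codes, exponents and entries, so one \<open>r\<close> meets all of them.\<close>

lemma extend_poly_system: "\<exists>\<beta> s pp. poly_system (Suc N) M \<beta> s pp"
proof -
  let ?V = "{P. valid N P}" and ?V' = "{P. valid (Suc N) P}"
  note fin = finite_valid[of N] finite_valid[of "Suc N"]
  have e1: "\<forall>\<^sub>F r in at_right 0. \<forall>(R, l, c)\<in>?V \<times> {..M} \<times> {1..N}. length R + Suc l \<le> M \<longrightarrow> 0 < tau R l c r"
    unfolding case_prod_beta using fin by (intro eventually_ball_imp tau_pos) auto
  have e2: "\<forall>\<^sub>F r in at_right 0. \<forall>(R, l, c)\<in>?V \<times> {..M} \<times> {1..N}. length R + Suc l \<le> M \<longrightarrow>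
     0 < (poly (pp R l) (- r) - r ^ Suc M * val \<beta> s c (pp R l)) / (- r) ^ l"
    unfolding case_prod_beta using fin by (intro eventually_ball_imp den_ne) auto
  have e3: "\<forall>\<^sub>F r in at_right 0. \<forall>(P, l, d)\<in>?V \<times> {..M} \<times> {1..N}. length P + l \<le> M \<longrightarrow>
     (-1) ^ l * val \<beta> s d (pp P l) < (-1) ^ l * (poly (pp P l) (- r) / r ^ Suc M)"
    unfolding case_prod_beta using fin by (intro eventually_ball_imp new_val_large) auto
  have e4: "\<forall>\<^sub>F r in at_right 0. \<forall>(R, l, c, d, e)\<in>?V \<times> {..M} \<times> {1..N} \<times> {1..N} \<times> {1..N}. length R + Suc l \<le> M \<and> wt R e < wt R d \<longrightarrow>
     (-1) ^ l * val \<beta> s d (pp R (Suc l) + smult (tau R l c r) (pp R l)) <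
      (-1) ^ l * val \<beta> s e (pp R (Suc l) + smult (tau R l c r) (pp R l))"
    unfolding case_prod_beta using fin by (intro eventually_ball_imp new_code_order) auto
  have e5: "\<forall>\<^sub>F r in at_right 0. \<forall>(P, Q, l, m)\<in>?V' \<times> ?V' \<times> {..M} \<times> {..M}.
     length P + l = length Q + m \<and> length P + l \<le> M \<and> code_less P Q \<longrightarrow>
     coeff (pp' r Q m) (length P + l - 1) < coeff (pp' r P l) (length P + l - 1)"
    unfolding case_prod_beta using fin by (intro eventually_ball_imp coeff_pp'_less) auto
  have "\<forall>\<^sub>F r in at_right 0. poly_system (Suc N) M (\<beta>' r) (s' r) (pp' r)"
    using e1 e2 e3 e4 e5 eventually_at_right_less[of "0::real"]
  proof eventually_elim
    case (elim r)
    have cpn: "code_poly (\<beta>' r) (s' r) (Suc N) P l (pp' r P l)" if "valid (Suc N) P" "length P + l \<le> M" for P l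
      using that(1)
    proof (cases rule: valid_Suc_cases)
      case old
      then show ?thesis using elim(3) that by (intro code_poly_old) auto
    next
      case (new c R)
      have lM: "length R + Suc l \<le> M" "l \<in> {..M}" using new that by auto
      have m: "(R, l, c) \<in> ?V \<times> {..M} \<times> {1..N}" using new lM by auto
      have "0 < tau R l c r" using elim(1) m lM by blast
      moreover have "0 < (poly (pp R l) (- r) - r ^ Suc M * val \<beta> s c (pp R l)) / (- r) ^ l"
        using elim(2) m lM by blast
      moreover have "(-1) ^ l * val \<beta> s d (pp R (Suc l) + smult (tau R l c r) (pp R l)) <
          (-1) ^ l * val \<beta> s e (pp R (Suc l) + smult (tau R l c r) (pp R l))"
        if "d \<in> {1..N}" "e \<in> {1..N}" "wt R e < wt R d" for d e
        using elim(4) m lM that by blast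
      ultimately show ?thesis unfolding new(1)
        using new lM elim(6) by (intro code_poly_new) auto
    qed
    moreover have "\<beta>' r 1 = 0" using poly_system N by (simp add: poly_system_def \<beta>'_def)
    moreover have "coeff (pp' r Q m) (length P + l - 1) < coeff (pp' r P l) (length P + l - 1)"
      if "valid (Suc N) P" "valid (Suc N) Q" "length P + l = length Q + m" "length P + l \<le> M" "code_less P Q" for P Q l m
    proof -
      have "(P, Q, l, m) \<in> ?V' \<times> ?V' \<times> {..M} \<times> {..M}" using that by auto
      then show ?thesis using elim(5) that by blast
    qed
    ultimately show ?case unfolding poly_system_def by blast
  qed
  then show ?thesis
    using eventually_happens[of _ "at_right (0::real)"] trivial_limit_at_right_real[of "0::real"] by blast
qed

end

lemma poly_system_exists:
  assumes "1 \<le> N"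
  shows "\<exists>\<beta> s pp. poly_system N M \<beta> s pp"
  using assms
proof (induction N rule: dec_induct)
  case base
  have v: "valid 1 P \<longleftrightarrow> P = []" for P by (cases P) auto
  have nl: "\<not> code_less [] []" by (auto elim: code_less.cases)
  have "code_poly (\<lambda>_. 0) (\<lambda>_. 0) 1 [] l (monom 1 l)" for l
  proof -
    have "q = 0" if "\<forall>i\<ge>l. coeff q i = 0" "\<forall>i<l. coeff q i = 0" for q :: "real poly"
      using that by (intro poly_eqI) (metis coeff_0 not_le)
    then show ?thesis unfolding code_poly_def by (auto simp: sat_def)
  qed
  then have "poly_system 1 M (\<lambda>_. 0) (\<lambda>_. 0) (\<lambda>P l. monom 1 l)"
    using nl unfolding poly_system_def v by auto
  then show ?case by blast
next
  case (step N)
  then obtain \<beta> s pp where "poly_system N M \<beta> s pp" by blast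
  then interpret extend N M \<beta> s pp using step by unfold_locales auto
  show ?case by (rule extend_poly_system)
qed

section \<open>Reflections as crossings of a line\<close>

text \<open>This codes the flat on which the blocks with minima \<open>c < c'\<close> are joined:
  \<open>c'\<close> stops being a minimum, and pairs pointing to \<open>c'\<close> are redirected to
  \<open>c\<close>. Pairs with first component below \<open>c'\<close> cannot point to
  \<open>c'\<close>, so the recursion may stop once the new pair is inserted.\<close>

fun merge :: "code \<Rightarrow> nat \<Rightarrow> nat \<Rightarrow> code" where
  "merge [] c c' = [(c', c)]"
| "merge ((b, g) # P) c c' =
     (if c' < b then (b, if g = c' then c else g) # merge P c c' else (c', c) # (b, g) # P)"

lemma merge_fst: "fst ` set (merge P c c') = insert c' (fst ` set P)"
  by (induction P c c' rule: merge.induct) auto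

lemma length_merge: "length (merge P c c') = Suc (length P)"
  by (induction P c c' rule: merge.induct) auto

lemma valid_merge:
  assumes "valid N P" "1 \<le> c" "c < c'" "c' \<le> N" "c \<notin> fst ` set P" "c' \<notin> fst ` set P"
  shows "valid N (merge P c c')"
  using assms
proof (induction N P rule: valid.induct)
  case (2 N b g P)
  show ?case
  proof (cases "c' < b")
    case True
    then have "valid (b - 1) (merge P c c')" using 2 by auto
    then show ?thesis using True 2 by (auto simp: merge_fst)
  next
    case False
    then show ?thesis using 2 by auto
  qed
qed auto

lemma sat_merge:
  assumes "sat \<beta> s P p" "val \<beta> s c p = val \<beta> s c' p"
  shows "sat \<beta> s (merge P c c') p"
  using assms by (induction P c c' rule: merge.induct) (auto simp: sat_def)

lemma merge_split:
  "\<exists>X Y R. merge P c c' = X @ (c', c) # R \<and> P = Y @ R \<and> length X = length Y \<and> (\<forall>y\<in>set Y. c' < fst y)"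
proof (induction P c c' rule: merge.induct)
  case (2 b g P c c')
  show ?case
  proof (cases "c' < b")
    case True
    then obtain X Y R where "merge P c c' = X @ (c', c) # R" "P = Y @ R" "length X = length Y" "\<forall>y\<in>set Y. c' < fst y"
      using 2 by blast
    then show ?thesis using True
      by (intro exI[of _ "(b, if g = c' then c else g) # X"] exI[of _ "(b, g) # Y"] exI[of _ R]) auto
  next
    case False
    then show ?thesis by (intro exI[of _ "[]"] exI[of _ "(b, g) # P"]) auto
  qed
qed auto

text \<open>Dropping the largest coded entry makes the lengths equal again. Seen from the common
  suffix \<open>R\<close>, the next coded entry of the tail is \<open>c'\<close>, while that of
  \<open>P\<close> is larger.\<close>

lemma merge_tl_less:
  assumes "P \<noteq> []" "c' < top_entry P"
  shows "code_less (tl (merge P c c')) P"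
proof -
  obtain b g P' where P: "P = (b, g) # P'" using assms(1) by (cases P) auto
  obtain X Y R where m: "merge P' c c' = X @ (c', c) # R" "P' = Y @ R" "length X = length Y" "\<forall>y\<in>set Y. c' < fst y"
    using merge_split by blast
  have tl: "tl (merge P c c') = X @ (c', c) # R" using assms(2) m by (simp add: P)
  define Y' where "Y' = (b, g) # Y"
  have "Y' \<noteq> []" by (simp add: Y'_def)
  then have Y: "Y' = butlast Y' @ [last Y']" by simp
  have "last Y' \<in> set Y'" using \<open>Y' \<noteq> []\<close> by (rule last_in_set)
  then have lt: "c' < fst (last Y')" using m assms(2) by (auto simp: Y'_def P)
  have "P = Y' @ R" using m by (simp add: P Y'_def)
  also have "\<dots> = butlast Y' @ (fst (last Y'), snd (last Y')) # R" using Y by (metis append.assoc append_Cons append_Nil prod.collapse)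
  finally show ?thesis unfolding tl using code_less.pos[OF lt] by metis
qed

lemma merge_above: "c' > top_entry P \<Longrightarrow> merge P c c' = (c', c) # P"
  by (cases P) auto

lemma affine_root:
  fixes a b :: real
  assumes "a + p * b < 0" "0 \<le> a + q * b"
  obtains t where "a + t * b = 0" "t \<noteq> p" "min p q \<le> t" "t \<le> max p q"
proof
  have b: "b \<noteq> 0" using assms by auto
  then show "a + (- a / b) * b = 0" by simp
  show "- a / b \<noteq> p" using assms b by (auto simp: field_simps)
  have "min p q \<le> - a / b \<and> - a / b \<le> max p q"
  proof (cases "0 < b")
    case True
    then have "p \<le> - a / b" "- a / b \<le> q"
      using assms True by (auto simp: field_simps)
    then show ?thesis by auto
  next
    case False
    then have "b < 0" using b by simp
    then have "q \<le> - a / b" "- a / b \<le> p"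
      using assms \<open>b < 0\<close> by (auto simp: field_simps)
    then show ?thesis by auto
  qed
  then show "min p q \<le> - a / b" "- a / b \<le> max p q" by auto
qed

section \<open>Order of the coordinates along an affine line\<close>

locale line =
  fixes A :: "nat set" and x :: "real \<Rightarrow> nat \<Rightarrow> real" and u v :: "nat \<Rightarrow> real"
  assumes fin: "finite A" and x: "x t d = u d + t * v d"
begin

definition crossing :: "real \<Rightarrow> nat \<Rightarrow> nat \<Rightarrow> bool" where
  "crossing t d e \<longleftrightarrow> x t d = x t e \<and> (u d \<noteq> u e \<or> v d \<noteq> v e)"

lemma order_transfer:
  assumes "x p d < x p e" "\<And>t. min p q \<le> t \<Longrightarrow> t \<le> max p q \<Longrightarrow> t \<noteq> p \<Longrightarrow> \<not> crossing t d e"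
  shows "x q d < x q e"
proof (rule ccontr)
  assume "\<not> x q d < x q e"
  then have 2: "0 \<le> (u d - u e) + q * (v d - v e)" by (simp add: x algebra_simps)
  have 1: "(u d - u e) + p * (v d - v e) < 0" using assms(1) by (simp add: x algebra_simps)
  obtain t where t: "(u d - u e) + t * (v d - v e) = 0" "t \<noteq> p" "min p q \<le> t" "t \<le> max p q"
    using affine_root[OF 1 2] by metis
  have "x t d = x t e" using t(1) by (simp add: x algebra_simps)
  moreover have "u d \<noteq> u e \<or> v d \<noteq> v e" using 1 by auto
  ultimately show False using assms(2) t unfolding crossing_def by blast
qed

lemma level_rows_no_crossing:
  assumes "\<And>t d e. min p q \<le> t \<Longrightarrow> t \<le> max p q \<Longrightarrow> d \<in> A \<Longrightarrow> e \<in> A \<Longrightarrow> \<not> crossing t d e"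
  shows "level_rows (x p) A = level_rows (x q) A"
proof (rule level_rows_eqI[OF fin])
  fix d e assume "d \<in> A" "e \<in> A"
  then show "x p d < x p e \<longleftrightarrow> x q d < x q e"
    using order_transfer[of p d e q] order_transfer[of q d e p] assms
    by (metis max.commute min.commute)
qed

text \<open>The difference of two coordinates that are tied at \<open>t\<close> is affine in the
  parameter and vanishes at \<open>t\<close>, so it has opposite signs on the two sides. Coordinates
  that are different at \<open>t\<close> keep their order, since there is no other crossing in
  between.\<close>

lemma reflect_crossing:
  assumes t: "t1 < t" "t < t0"
    and no: "\<And>t' d e. t1 \<le> t' \<Longrightarrow> t' \<le> t0 \<Longrightarrow> t' \<noteq> t \<Longrightarrow> d \<in> A \<Longrightarrow> e \<in> A \<Longrightarrow> \<not> crossing t' d e"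
  shows "level_rows (x t0) A \<prec>\<^sub>T level_rows (x t) A" "reflect (level_rows (x t) A) (level_rows (x t0) A) = level_rows (x t1) A"
proof -
  have coarse: "x t d \<le> x t e" if "d \<in> A" "e \<in> A" "x t0 d \<le> x t0 e" for d e
  proof (rule ccontr)
    assume "\<not> x t d \<le> x t e"
    then have "x t0 e < x t0 d" using that t by (intro order_transfer[of t e d t0] no) auto
    then show False using that by simp
  qed
  then show "level_rows (x t0) A \<prec>\<^sub>T level_rows (x t) A" using tab_prec_level_rows[OF fin] by blast
  show "reflect (level_rows (x t) A) (level_rows (x t0) A) = level_rows (x t1) A"
  proof (rule reflect_level_rows[OF fin coarse])
    fix d e assume de: "d \<in> A" "e \<in> A"
    show "x t1 d < x t1 e" if "x t d < x t e"
      using that t de by (intro order_transfer[of t d e t1] no) auto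
    show "x t1 d < x t1 e \<longleftrightarrow> x t0 e < x t0 d" if "x t d = x t e"
    proof -
      have "x t' e - x t' d = (t' - t) * (v e - v d)" for t'
        using that by (simp add: x algebra_simps)
      then have "x t1 d < x t1 e \<longleftrightarrow> 0 < (t1 - t) * (v e - v d)" "x t0 e < x t0 d \<longleftrightarrow> (t0 - t) * (v e - v d) < 0"
        by (metis diff_gt_0_iff_gt, metis diff_less_0_iff_less)
      then show ?thesis using t by (auto simp: zero_less_mult_iff mult_less_0_iff)
    qed
  qed
qed

text \<open>Induction over the list. The first member on the line is the crossing nearest to
  \<open>t0\<close>; its reflection leads to a parameter \<open>t'\<close> just beyond it but before
  all remaining crossings, and \<open>t'\<close> takes over the role of \<open>t0\<close>. Members
  off the line fail the test for precedence and leave the tableau unchanged.\<close>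

lemma reflect_block_line:
  fixes T :: "'q \<Rightarrow> tableau"
  assumes "\<And>Q. Q \<in> set Qs \<Longrightarrow> on Q \<Longrightarrow> T Q = level_rows (x (tq Q)) A"
    and "\<And>Q t. Q \<in> set Qs \<Longrightarrow> \<not> on Q \<Longrightarrow> \<not> level_rows (x t) A \<prec>\<^sub>T T Q"
    and "sorted_wrt (\<lambda>P Q. on P \<and> on Q \<longrightarrow> tq Q < tq P) Qs"
    and "\<And>Q. Q \<in> set Qs \<Longrightarrow> on Q \<Longrightarrow> t1 < tq Q \<and> tq Q < t0" "t1 < t0"
    and "\<And>t d e. t1 \<le> t \<Longrightarrow> t \<le> t0 \<Longrightarrow> d \<in> A \<Longrightarrow> e \<in> A \<Longrightarrow> crossing t d e \<Longrightarrow> \<exists>Q\<in>set Qs. on Q \<and> tq Q = t"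
  shows "reflect_block (map T Qs) (level_rows (x t0) A) = level_rows (x t1) A"
  using assms
proof (induction Qs arbitrary: t0)
  case Nil
  then have "level_rows (x t0) A = level_rows (x t1) A" by (intro level_rows_no_crossing) auto
  then show ?case by (simp add: reflect_block_def)
next
  case (Cons Q Qs)
  show ?case
  proof (cases "on Q")
    case False
    then have "reflect_block (map T Qs) (level_rows (x t0) A) = level_rows (x t1) A"
      using Cons.prems by (intro Cons.IH) auto
    then show ?thesis using Cons.prems(2)[of Q t0] False by (simp add: reflect_block_def)
  next
    case True
    define S where "S = insert t1 (tq ` {Q \<in> set Qs. on Q})"
    have S: "finite S" "S \<noteq> {}" by (auto simp: S_def)
    have "s < tq Q" if "s \<in> S" for s
      using that Cons.prems(3,4) True by (auto simp: S_def)
    then have "Max S < tq Q" using S by simp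
    then obtain t' where t': "Max S < t'" "t' < tq Q" using dense by blast
    have S': "s < t'" if "s \<in> S" for s using Max_ge[OF S(1) that] t' by simp
    have "\<not> crossing t d e" if tt: "t' \<le> t" "t \<le> t0" "t \<noteq> tq Q" "d \<in> A" "e \<in> A" for t d e
    proof
      assume "crossing t d e"
      moreover have "t1 \<le> t" using S'[of t1] tt by (simp add: S_def)
      ultimately obtain Q' where "Q' \<in> set Qs" "on Q'" "tq Q' = t"
        using Cons.prems(6)[of t d e] tt by auto
      then have "t \<in> S" by (auto simp: S_def)
      then show False using S'[of t] tt by simp
    qed
    from reflect_crossing[OF t'(2) _ this]
    have r: "level_rows (x t0) A \<prec>\<^sub>T T Q" "reflect (T Q) (level_rows (x t0) A) = level_rows (x t') A"
      using Cons.prems(1,4)[of Q] True by auto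
    have "reflect_block (map T Qs) (level_rows (x t') A) = level_rows (x t1) A"
    proof (rule Cons.IH)
      show "t1 < tq Q' \<and> tq Q' < t'" if "Q' \<in> set Qs" "on Q'" for Q'
        using that S' Cons.prems(4) by (auto simp: S_def)
      show "t1 < t'" using S' by (simp add: S_def)
      show "\<exists>Q\<in>set Qs. on Q \<and> tq Q = t" if "t1 \<le> t" "t \<le> t'" "d \<in> A" "e \<in> A" "crossing t d e" for t d e
      proof -
        have "t < tq Q" using that t' by simp
        moreover have "t \<le> t0" using that t' Cons.prems(4)[of Q] True by auto
        ultimately show ?thesis using Cons.prems(6)[of t d e] that by auto
      qed
    qed (use Cons.prems in auto)
    then show ?thesis using r by (simp add: reflect_block_def)
  qed
qed

end

lemma separate_finite:
  fixes S S' :: "real set"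
  assumes "finite S" "finite S'" "\<And>a b. a \<in> S \<Longrightarrow> b \<in> S' \<Longrightarrow> a < b"
  shows "\<exists>t. (\<forall>a\<in>S. a < t) \<and> (\<forall>b\<in>S'. t < b)"
proof (cases "S' = {}")
  case True
  obtain t where "\<forall>a\<in>S. a < t" using assms(1) by (metis bdd_above_finite bdd_above_def gt_ex le_less_trans)
  then show ?thesis using True by blast
next
  case False
  obtain t0 where t0: "\<forall>b\<in>S'. t0 < b" using assms(2) by (metis bdd_below_finite bdd_below_def lt_ex less_le_trans)
  define m where "m = Max (insert t0 S)"
  have "m < Min S'" unfolding m_def using assms t0 False by simp
  then obtain t where "m < t" "t < Min S'" using dense by blast
  then show ?thesis using assms False by (intro exI[of _ t]) (auto simp: m_def)
qed

section \<open>The line of monic polynomials on a flat\<close>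

locale code_polys =
  fixes N M :: nat and \<beta> s :: "nat \<Rightarrow> real" and pp :: "code \<Rightarrow> nat \<Rightarrow> real poly"
  assumes N: "1 \<le> N" and NM: "N \<le> M" and poly_system: "poly_system N M \<beta> s pp"
begin

lemma length_less: "valid N P \<Longrightarrow> length P < N"
proof -
  assume "valid N P"
  then have "set (map fst P) \<subseteq> {2..N}" using valid_fst by force
  then have "card (set (map fst P)) \<le> card {2..N}" by (intro card_mono) auto
  then show ?thesis using distinct_card[OF distinct_code[OF \<open>valid N P\<close>]] N by simp
qed

lemma cp: "valid N P \<Longrightarrow> length P + l \<le> M \<Longrightarrow> code_poly \<beta> s N P l (pp P l)"
  using poly_system unfolding poly_system_def by blast

text \<open>A valid code has fewer than \<open>N\<close> pairs, so \<open>N \<le> M\<close> makes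
  the exponents 0 and 1 available for every code. Exponent 0 gives the point of the code, exponent 1
  the base point of a line on its flat.\<close>

lemma cp0: "valid N P \<Longrightarrow> code_poly \<beta> s N P 0 (pp P 0)"
  and cp1: "valid N P \<Longrightarrow> code_poly \<beta> s N P 1 (pp P 1)"
  using cp[of P 0] cp[of P 1] length_less[of P] NM by auto

lemma uniq0:
  assumes "valid N P" "sat \<beta> s P q" "\<And>i. length P \<le> i \<Longrightarrow> coeff q i = 0"
  shows "q = 0"
  using cp0[OF assms(1)] assms(2,3) unfolding code_poly_def by auto

lemma less_coeff_gen:
  "valid N P \<Longrightarrow> valid N Q \<Longrightarrow> length P + l = length Q + m \<Longrightarrow> length P + l \<le> M \<Longrightarrow> code_less P Q \<Longrightarrow>
    coeff (pp Q m) (length P + l - 1) < coeff (pp P l) (length P + l - 1)"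
  using poly_system unfolding poly_system_def by blast

lemma less_coeff:
  assumes "valid N P" "valid N Q" "length P = length Q" "code_less P Q"
  shows "coeff (pp Q 0) (length P - 1) < coeff (pp P 0) (length P - 1)"
proof -
  have "length P + 0 \<le> M" using length_less[OF assms(1)] NM by simp
  then show ?thesis using less_coeff_gen[OF assms(1,2), of 0 0] assms by simp
qed

lemma val_order:
  assumes "valid N P" "code_poly \<beta> s N P l p" "d \<in> {1..N}" "e \<in> {1..N}"
  shows "(-1) ^ l * val \<beta> s d p < (-1) ^ l * val \<beta> s e p \<longleftrightarrow> wt P d < wt P e"
proof -
  have *: "wt P d < wt P e \<Longrightarrow> (-1) ^ l * val \<beta> s d p < (-1) ^ l * val \<beta> s e p"
    if "d \<in> {1..N}" "e \<in> {1..N}" for d e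
    using assms(2) that unfolding code_poly_def by blast
  have "val \<beta> s d p = val \<beta> s e p" if "wt P d = wt P e"
  proof -
    have "rep P d = rep P e" using wt_eq_iff[OF assms(1), of d e] that assms(3,4) by simp
    moreover have "sat \<beta> s P p" using assms(2) by (simp add: code_poly_def)
    ultimately show ?thesis using sat_rep[OF assms(1)] by metis
  qed
  then show ?thesis using *[OF assms(3,4)] *[OF assms(4,3)]
    by (cases "wt P d" "wt P e" rule: linorder_cases) auto
qed

lemma val_order0: "valid N P \<Longrightarrow> d \<in> {1..N} \<Longrightarrow> e \<in> {1..N} \<Longrightarrow>
    val \<beta> s d (pp P 0) < val \<beta> s e (pp P 0) \<longleftrightarrow> wt P d < wt P e"
  using val_order[OF _ cp0, of P d e] by simp

lemma code_tab_val: "valid N P \<Longrightarrow> code_tab N P = level_rows (\<lambda>d. val \<beta> s d (pp P 0)) {1..N}"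
  by (rule level_rows_eqI) (auto simp: val_order0)

context
  fixes P :: code
  assumes P: "valid N P"
begin

text \<open>By uniqueness, every monic polynomial of degree \<open>length P + 1\<close> on the flat
  of \<open>P\<close> is some \<open>pt t\<close>. The parameter is the excess of its second
  coefficient over that of \<open>pp P 1\<close>, which is what \<open>tq\<close> reads off.\<close>

definition pt :: "real \<Rightarrow> real poly" where "pt t = pp P 1 + smult t (pp P 0)"

definition xt :: "real \<Rightarrow> nat \<Rightarrow> real" where "xt t d = val \<beta> s d (pt t)"

definition on_line :: "code \<Rightarrow> bool" where "on_line Q \<longleftrightarrow> sat \<beta> s P (pp Q 0)"

definition tq :: "code \<Rightarrow> real" where "tq Q = coeff (pp Q 0) (length P) - coeff (pp P 1) (length P)"

interpretation ln: line "{1..N}" xt "\<lambda>d. val \<beta> s d (pp P 1)" "\<lambda>d. val \<beta> s d (pp P 0)"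
  by unfold_locales (auto simp: xt_def pt_def)

lemma sat_pt: "sat \<beta> s P (pt t)"
  using cp0[OF P] cp1[OF P] unfolding pt_def code_poly_def by (auto intro: sat_add sat_smult)

lemma coeff_pt: "coeff (pt t) (Suc (length P)) = 1" "Suc (length P) < i \<Longrightarrow> coeff (pt t) i = 0"
  "coeff (pt t) (length P) = coeff (pp P 1) (length P) + t"
  using cp0[OF P] cp1[OF P] unfolding pt_def code_poly_def by auto

lemma on_line_eq:
  assumes "valid N Q" "length Q = Suc (length P)" "on_line Q"
  shows "pp Q 0 = pt (tq Q)"
proof -
  have cq: "code_poly \<beta> s N Q 0 (pp Q 0)" by (rule cp0[OF assms(1)])
  have "pp Q 0 - pt (tq Q) = 0"
  proof (rule uniq0[OF P])
    show "sat \<beta> s P (pp Q 0 - pt (tq Q))" using assms(3) sat_pt by (auto simp: on_line_def intro: sat_diff)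
    fix i assume i: "length P \<le> i"
    consider "i = length P" | "i = Suc (length P)" | "Suc (length P) < i" using i by linarith
    then show "coeff (pp Q 0 - pt (tq Q)) i = 0"
      by cases (use cq coeff_pt assms(2) in \<open>auto simp: code_poly_def tq_def\<close>)
  qed
  then show ?thesis by simp
qed

lemma on_line_tab: "valid N Q \<Longrightarrow> length Q = Suc (length P) \<Longrightarrow> on_line Q \<Longrightarrow> code_tab N Q = level_rows (xt (tq Q)) {1..N}"
  using code_tab_val on_line_eq unfolding xt_def by simp

text \<open>All points of the line satisfy the equalities of \<open>P\<close>. A coarser tableau
  inherits them, which would put the polynomial of \<open>Q\<close> on the flat of
  \<open>P\<close>.\<close>

lemma not_on_line_prec:
  assumes "valid N Q" "length Q = Suc (length P)" "\<not> on_line Q"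
  shows "\<not> level_rows (xt t) {1..N} \<prec>\<^sub>T code_tab N Q"
proof
  assume "level_rows (xt t) {1..N} \<prec>\<^sub>T code_tab N Q"
  then have prec: "\<And>i j. i \<in> {1..N} \<Longrightarrow> j \<in> {1..N} \<Longrightarrow> xt t i \<le> xt t j \<Longrightarrow> wt Q i \<le> wt Q j"
    by (simp add: tab_prec_level_rows)
  obtain b c where bc: "(b, c) \<in> set P" "val \<beta> s b (pp Q 0) \<noteq> val \<beta> s c (pp Q 0)"
    using assms(3) unfolding on_line_def sat_def by auto
  have r: "b \<in> {1..N}" "c \<in> {1..N}" using valid_fst[OF P bc(1)] by auto
  have "xt t b = xt t c" using sat_pt bc(1) by (auto simp: xt_def sat_def)
  then have "wt Q b = wt Q c" using prec[OF r] prec[OF r(2,1)] by simp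
  then have "rep Q b = rep Q c" using wt_eq_iff[OF assms(1)] r by simp
  moreover have "sat \<beta> s Q (pp Q 0)" using cp0[OF assms(1)] by (simp add: code_poly_def)
  ultimately have "val \<beta> s b (pp Q 0) = val \<beta> s c (pp Q 0)" using sat_rep[OF assms(1)] by metis
  then show False using bc by simp
qed

lemma merge_on_line:
  assumes "1 \<le> c" "c < c'" "c' \<le> N" "c \<notin> fst ` set P" "c' \<notin> fst ` set P" "xt t c = xt t c'"
  shows "on_line (merge P c c')" "tq (merge P c c') = t"
proof -
  let ?Q = "merge P c c'"
  have v: "valid N ?Q" by (rule valid_merge[OF P assms(1-5)])
  have s: "sat \<beta> s ?Q (pt t)" using sat_merge[OF sat_pt] assms(6) by (simp add: xt_def)
  have "pt t - pp ?Q 0 = 0"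
  proof (rule uniq0[OF v])
    show "sat \<beta> s ?Q (pt t - pp ?Q 0)" using s cp0[OF v] by (auto simp: code_poly_def intro: sat_diff)
    fix i assume "length ?Q \<le> i"
    then show "coeff (pt t - pp ?Q 0) i = 0"
      using cp0[OF v] coeff_pt by (cases "i = Suc (length P)") (auto simp: code_poly_def length_merge)
  qed
  then have e: "pp ?Q 0 = pt t" by simp
  show "on_line ?Q" unfolding on_line_def e by (rule sat_pt)
  show "tq ?Q = t" unfolding tq_def e by (simp add: coeff_pt)
qed

text \<open>A crossing ties two different blocks of \<open>P\<close>, so the point of the line lies
  on the flat of the merged code; this code has one more pair, and uniqueness identifies the point
  with its polynomial.\<close>

lemma crossing_merge:
  assumes "ln.crossing t d e" "d \<in> {1..N}" "e \<in> {1..N}"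
  obtains c c' where "1 \<le> c" "c < c'" "{c, c'} = {rep P d, rep P e}" "c' \<le> max d e"
    "c \<notin> fst ` set P" "c' \<notin> fst ` set P" "on_line (merge P c c')" "tq (merge P c c') = t"
proof -
  have ne: "rep P d \<noteq> rep P e"
  proof
    assume "rep P d = rep P e"
    then have "val \<beta> s d p = val \<beta> s e p" if "sat \<beta> s P p" for p using sat_rep[OF P that] by metis
    moreover have "sat \<beta> s P (pp P 0)" "sat \<beta> s P (pp P 1)"
      using cp0[OF P] cp1[OF P] unfolding code_poly_def by blast+
    ultimately show False using assms(1) unfolding ln.crossing_def by blast
  qed
  have r: "xt t (rep P d) = xt t (rep P e)"
    using assms(1) sat_rep[OF P sat_pt] unfolding ln.crossing_def xt_def by simp
  define c c' where "c = min (rep P d) (rep P e)" and "c' = max (rep P d) (rep P e)"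
  have c: "1 \<le> c" "c < c'" "{c, c'} = {rep P d, rep P e}" "c' \<le> max d e" "c \<notin> fst ` set P" "c' \<notin> fst ` set P" "xt t c = xt t c'"
    using ne r rep_ge1[OF P, of d] rep_ge1[OF P, of e] rep_le[OF P, of d] rep_le[OF P, of e] rep_range[OF P] assms(2,3)
    by (auto simp: c_def c'_def min_def max_def)
  then have "c' \<le> N" using assms(2,3) by auto
  then show ?thesis using that c merge_on_line[of c c' t] by blast
qed

text \<open>For large \<open>t\<close> the summand \<open>t\<close> times \<open>pp P 0\<close>
  dominates and imposes the order of \<open>wt P\<close>. The ties are exact, since the whole line
  lies on the flat of \<open>P\<close>.\<close>

lemma line_start:
  "\<forall>\<^sub>F t in at_top. level_rows (xt t) {1..N} = code_tab N P"
proof -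
  have "\<forall>\<^sub>F t in at_top. \<forall>d\<in>{1..N}. \<forall>e\<in>{1..N}. wt P d < wt P e \<longrightarrow> xt t d < xt t e"
  proof (intro eventually_ball_finite ballI)
    fix d e assume de: "d \<in> {1..N}" "e \<in> {1..N}"
    let ?u = "\<lambda>d. val \<beta> s d (pp P 1)" and ?v = "\<lambda>d. val \<beta> s d (pp P 0)"
    show "\<forall>\<^sub>F t in at_top. wt P d < wt P e \<longrightarrow> xt t d < xt t e"
    proof (cases "wt P d < wt P e")
      case True
      then have v: "?v d < ?v e" using val_order0[OF P de] by simp
      have "\<forall>\<^sub>F t in at_top. (?u d - ?u e) / (?v e - ?v d) < t" by (rule eventually_gt_at_top)
      then show ?thesis
      proof eventually_elim
        case (elim t)
        then have "?u d - ?u e < t * (?v e - ?v d)" using v by (simp add: pos_divide_less_eq)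
        then show ?case by (simp add: ln.x algebra_simps)
      qed
    qed simp
  qed auto
  then show ?thesis
  proof eventually_elim
    case (elim t)
    show ?case
    proof (rule level_rows_eqI)
      fix d e assume de: "d \<in> {1..N}" "e \<in> {1..N}"
      have "xt t d = xt t e" if "wt P d = wt P e"
        using that wt_eq_iff[OF P, of d e] de sat_rep[OF P sat_pt] unfolding xt_def by (metis atLeastAtMost_iff)
      moreover have "wt P d < wt P e \<Longrightarrow> xt t d < xt t e" "wt P e < wt P d \<Longrightarrow> xt t e < xt t d"
        using elim de by blast+
      ultimately show "xt t d < xt t e \<longleftrightarrow> wt P d < wt P e"
        by (cases "wt P d" "wt P e" rule: linorder_cases) auto
    qed simp
  qed
qed

text \<open>The reflections travel down the line from very large \<open>t\<close>, where the tableau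
  is that of \<open>P\<close>, to a parameter \<open>t1\<close> that separates the codes in
  \<open>pre\<close> from those in \<open>post\<close>. At \<open>t1\<close> the entries up to
  \<open>top_entry P\<close> already have the order of \<open>pp P 1\<close>, which is opposite to
  the initial one, while comparisons with a larger entry have not changed yet. Together this is the
  order of \<open>line_wt\<close>.\<close>

lemma reflect_previous_blocks:
  assumes N': "valid (N - 1) P" "2 \<le> N"
    and list: "codes (Suc (length P)) N = pre @ post"
    and child: "set (children N P) \<subseteq> set post"
    and before: "\<And>Q. Q \<in> set post \<Longrightarrow> \<not> code_less (tl Q) P"
  shows "reflect_block (map (code_tab N) pre) (code_tab N P) = level_rows (line_wt P (top_entry P + 1)) {1..N}"
proof -
  define k where "k = length P"
  have kN: "Suc k < N"
  proof -
    have "set (map fst P) \<subseteq> {2..N-1}" using valid_fst[OF N'(1)] by force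
    then have "card (set (map fst P)) \<le> card {2..N-1}" by (intro card_mono) auto
    then show ?thesis using distinct_card[OF distinct_code[OF P]] N' by (simp add: k_def)
  qed
  have sc: "set (pre @ post) = {Q. valid N Q \<and> length Q = Suc k}"
    using set_codes[OF kN] list by (simp add: k_def)
  have srt: "sorted_wrt code_less (pre @ post)" using sorted_codes[OF kN] list by (simp add: k_def)
  have tql: "tq Q' < tq Q" if "Q \<in> set (pre @ post)" "Q' \<in> set (pre @ post)" "code_less Q Q'" for Q Q'
    using that less_coeff[of Q Q'] unfolding sc by (simp add: tq_def k_def)
  have stq: "sorted_wrt (\<lambda>Q Q'. tq Q' < tq Q) (pre @ post)"
    by (rule sorted_wrt_mono_rel[OF _ srt]) (use tql in blast)
  have sep: "a < b" if "a \<in> tq ` set post" "b \<in> tq ` set pre" for a b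
    using that stq by (auto simp: sorted_wrt_append)
  have ff: "finite (tq ` set post)" "finite (tq ` set pre)" by auto
  obtain t1 where "(\<forall>a\<in>tq ` set post. a < t1) \<and> (\<forall>b\<in>tq ` set pre. t1 < b)"
    using separate_finite[OF ff sep] by blast
  then have t1: "\<And>Q. Q \<in> set post \<Longrightarrow> tq Q < t1" "\<And>Q. Q \<in> set pre \<Longrightarrow> t1 < tq Q"
    by simp_all
  have "\<forall>\<^sub>F t in at_top. level_rows (xt t) {1..N} = code_tab N P \<and> t1 < t \<and> (\<forall>Q\<in>set (pre @ post). tq Q < t)"
    by (intro eventually_conj line_start eventually_gt_at_top eventually_ball_finite ballI) auto
  then obtain t0 where t0: "level_rows (xt t0) {1..N} = code_tab N P" "t1 < t0" "\<And>Q. Q \<in> set (pre @ post) \<Longrightarrow> tq Q < t0"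
    unfolding eventually_at_top_linorder by blast
  have inlist: "merge P c c' \<in> set (pre @ post)" 
    if "1 \<le> c" "c < c'" "c' \<le> N" "c \<notin> fst ` set P" "c' \<notin> fst ` set P" for c c'
    unfolding sc using valid_merge[OF P that] by (simp add: length_merge k_def)
  have "reflect_block (map (code_tab N) pre) (level_rows (xt t0) {1..N}) = level_rows (xt t1) {1..N}"
  proof (rule ln.reflect_block_line[where on = on_line and tq = tq])
    show "code_tab N Q = level_rows (xt (tq Q)) {1..N}" if "Q \<in> set pre" "on_line Q" for Q
      using that sc by (intro on_line_tab) (auto simp: k_def)
    show "\<not> level_rows (xt t) {1..N} \<prec>\<^sub>T code_tab N Q" if "Q \<in> set pre" "\<not> on_line Q" for Q t
      using that sc by (intro not_on_line_prec) (auto simp: k_def)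
    show "sorted_wrt (\<lambda>P Q. on_line P \<and> on_line Q \<longrightarrow> tq Q < tq P) pre"
      by (rule sorted_wrt_mono_rel[of _ "\<lambda>Q Q'. tq Q' < tq Q"]) (use stq in \<open>auto simp: sorted_wrt_append\<close>)
    show "t1 < tq Q \<and> tq Q < t0" if "Q \<in> set pre" "on_line Q" for Q using that t1 t0 by auto
    show "t1 < t0" by (rule t0)
    show "\<exists>Q\<in>set pre. on_line Q \<and> tq Q = t"
      if t: "t1 \<le> t" "t \<le> t0" "d \<in> {1..N}" "e \<in> {1..N}" "ln.crossing t d e" for t d e
    proof -
      obtain c c' where c: "1 \<le> c" "c < c'" "c' \<le> max d e"
        "c \<notin> fst ` set P" "c' \<notin> fst ` set P" "on_line (merge P c c')" "tq (merge P c c') = t"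
        using crossing_merge[OF t(5,3,4)] by metis
      then have "merge P c c' \<in> set (pre @ post)" using inlist[of c c'] t by auto
      moreover have "merge P c c' \<notin> set post" using t1(1)[of "merge P c c'"] c t by auto
      ultimately show ?thesis using c by auto
    qed
  qed
  also have "level_rows (xt t1) {1..N} = level_rows (line_wt P (top_entry P + 1)) {1..N}"
  proof (rule level_rows_eqI)
    let ?w = "line_wt P (top_entry P + 1)"
    have "1 \<le> N - 1" using N'(2) by simp
    then have topN: "top_entry P < N" using top_entry_le[OF N'(1)] N'(2) by fastforce
    have post0: "Q \<in> set post" if "b \<le> N" "top_entry P < b" "c \<in> {1..<b}" "c \<notin> fst ` set P" "Q = (b, c) # P" for Q b c
    proof -
      have "valid (b - 1) P" using valid_mono[OF valid_top[OF P], of "b - 1"] that by simp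
      then have "Q \<in> set (children N P)" using set_children[OF P N, of N] that by auto
      then show ?thesis using child by blast
    qed
    \<comment> \<open>The child \<open>(N, 1) # P\<close> precedes \<open>P\<close> by the rule
      \<open>ext\<close>, so its second coefficient exceeds that of \<open>pp P 1\<close>. Its
      parameter is thus positive, and as a member of \<open>post\<close> it lies below
      \<open>t1\<close>.\<close>
    have t1pos: "0 < t1"
    proof -
      define Q where "Q = (N, 1) # P"
      have "1 \<notin> fst ` set P" using valid_fst[OF P] by force
      then have Q: "Q \<in> set post" using post0[of N 1 Q] topN N'(2) by (auto simp: Q_def)
      then have vQ: "valid N Q" using sc by auto
      have "code_less Q P" using code_less.ext[of "[]" N 1 P] by (simp add: Q_def)
      moreover have "length Q + 0 = length P + 1" "length Q + 0 \<le> M"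
        using length_less[OF vQ] NM by (simp_all add: Q_def)
      ultimately have "coeff (pp P 1) (length Q + 0 - 1) < coeff (pp Q 0) (length Q + 0 - 1)"
        using less_coeff_gen[OF vQ P] by blast
      then have "0 < tq Q" by (simp add: tq_def Q_def)
      then show ?thesis using t1(1)[OF Q] by simp
    qed
    \<comment> \<open>A crossing of two entries up to \<open>top_entry P\<close> gives a merged code
      whose tail comes before \<open>P\<close>. The hypothesis \<open>before\<close> keeps such a
      code out of \<open>post\<close>, so its parameter is above \<open>t1\<close>.\<close>
    have below: "\<not> ln.crossing t d e"
      if th: "d \<in> {1..N}" "e \<in> {1..N}" "d \<le> top_entry P" "e \<le> top_entry P" "t \<le> t1" for t d e
    proof
      assume "ln.crossing t d e"
      then obtain c c' where c: "1 \<le> c" "c < c'" "c' \<le> max d e"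
        "c \<notin> fst ` set P" "c' \<notin> fst ` set P" "on_line (merge P c c')" "tq (merge P c c') = t"
        using crossing_merge[of t d e] th(1,2) by metis
      have "P \<noteq> []" using c that by auto
      then have "c' \<noteq> top_entry P" using c(5) by (cases P) auto
      then have "c' < top_entry P" using c(3) that by auto
      then have "merge P c c' \<notin> set post" using merge_tl_less[OF \<open>P \<noteq> []\<close>] before by blast
      moreover have "merge P c c' \<in> set (pre @ post)" using inlist[of c c'] c that by auto
      ultimately show False using t1(2)[of "merge P c c'"] c that by auto
    qed
    \<comment> \<open>If the larger entry exceeds \<open>top_entry P\<close>, the merged code is
      \<open>P\<close> with one pair in front. This is a child of \<open>P\<close>, hence in
      \<open>post\<close>, and its parameter is below \<open>t1\<close>.\<close>
    have above: "\<not> ln.crossing t d e"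
      if th: "d \<in> {1..N}" "e \<in> {1..N}" "d < e" "top_entry P < e" "t1 \<le> t" for t d e
    proof
      assume "ln.crossing t d e"
      then obtain c c' where c: "1 \<le> c" "c < c'" "{c, c'} = {rep P d, rep P e}"
        "c \<notin> fst ` set P" "c' \<notin> fst ` set P" "tq (merge P c c') = t"
        using crossing_merge[of t d e] th(1,2) by metis
      have "valid (top_entry P) P" by (rule valid_top[OF P])
      then have "e \<notin> fst ` set P" using valid_fst[of "top_entry P" P] that(4) by force
      then have "rep P e = e" by (rule rep_notin)
      moreover have "rep P d < e" using rep_le[OF P, of d] that(3) by simp
      ultimately have "c' = e" using c(2,3) by (auto simp: doubleton_eq_iff)
      then have "merge P c c' = (e, c) # P" using merge_above that(4) by simp
      then have "merge P c c' \<in> set post" using post0[of e c] c \<open>c' = e\<close> that by auto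
      then show False using t1(1) c(6) that(5) by fastforce
    qed
    have low: "xt t1 d < xt t1 e" if de: "d \<in> {1..N}" "e \<in> {1..N}" "?w d < ?w e" for d e
    proof (cases "d \<le> top_entry P \<and> e \<le> top_entry P")
      case True
      then have "wt P e < wt P d" using de by (simp add: line_wt_def)
      then have "xt 0 d < xt 0 e"
        using val_order[OF P cp1[OF P] de(2,1)] by (simp add: xt_def pt_def)
      then show ?thesis
        using ln.order_transfer[of 0 d e t1] below[OF de(1,2)] True t1pos by auto
    next
      case False
      have ab: "\<bar>wt P a\<bar> \<le> int a - 1" if "1 \<le> a" for a
        using abs_wt[OF P that] rep_le[OF P, of a] by simp
      have l: "top_entry P < e" "d < e"
        using False de ab[of d] ab[of e] by (auto simp: line_wt_def split: if_splits)
      then have "wt P d < wt P e" using ab[of d] wt_above[of P e] de by simp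
      then have "row_of (code_tab N P) d < row_of (code_tab N P) e"
        using row_of_level_rows[of "{1..N}" d e "wt P"] de by simp
      then have "xt t0 d < xt t0 e"
        unfolding t0(1)[symmetric] using row_of_level_rows[of "{1..N}" d e "xt t0"] de by simp
      then show ?thesis
        using ln.order_transfer[of t0 d e t1] above[OF de(1,2) l(2,1)] t0(2) by auto
    qed
    show "xt t1 d < xt t1 e \<longleftrightarrow> ?w d < ?w e" if de: "d \<in> {1..N}" "e \<in> {1..N}" for d e
    proof -
      have "xt t1 d = xt t1 e" if "?w d = ?w e"
      proof -
        have "rep P d = rep P e" using line_wt_eq_iff[OF P, of "top_entry P + 1" d e] that de by simp
        then show ?thesis using sat_rep[OF P sat_pt] unfolding xt_def by metis
      qed
      then show ?thesis using low[OF de] low[OF de(2,1)]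
        by (cases "?w d" "?w e" rule: linorder_cases) auto
    qed
  qed simp
  finally show ?thesis using t0(1) by simp
qed

end

lemma code_less_irrefl: "valid N P \<Longrightarrow> \<not> code_less P P"
  using less_coeff[of P P] by auto

lemma code_less_asym: "valid N P \<Longrightarrow> valid N Q \<Longrightarrow> length P = length Q \<Longrightarrow> code_less P Q \<Longrightarrow> \<not> code_less Q P"
  using less_coeff[of P Q] less_coeff[of Q P] by auto

end

section \<open>The recursion that defines \<open>pi_tab\<close>\<close>

lemma reflect_block_append: "reflect_block (Q1 @ Q2) T = reflect_block Q2 (reflect_block Q1 T)"
  by (simp add: reflect_block_def)

text \<open>The blocks come from the diagonal tableaux and do not depend on \<open>i\<close>, so the
  successive reflections of one tableau merge into a single run through the concatenated
  blocks.\<close>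

lemma iter_tab_fold:
  "iter_tab k n Ts i (Suc j) =
     reflect_block (concat (map (\<lambda>j. block k n (n + 1 - k) (iter_tab k n Ts j j)) [1..<Suc j]))
       (incl_tab (n - 1) n (Ts ! (i - 1)))"
proof (induction j)
  case 0
  then show ?case by (simp add: reflect_block_def)
next
  case (Suc j)
  have "[1..<Suc (Suc j)] = [1..<Suc j] @ [Suc j]" by simp
  then show ?case using Suc by (simp add: reflect_block_append del: upt_Suc)
qed

lemma incl_code_tab:
  assumes "valid n P" "1 \<le> n"
  shows "incl_tab (n - 1) n (code_tab n P) = code_tab (n + 1) P"
proof -
  have "code_tab (n + 1) P = level_rows (wt P) ({1..n} \<union> {n + 1})"
    by (rule arg_cong[of _ _ "level_rows (wt P)"]) auto
  also have "\<dots> = code_tab n P @ level_rows (wt P) {n + 1}"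
  proof (rule level_rows_Un)
    fix a b assume "a \<in> {1..n}" "b \<in> {n + 1}"
    then show "wt P a < wt P b"
      using abs_wt[OF assms(1), of a] rep_le[OF assms(1), of a] wt_above[of P "n+1"] top_entry_le[OF assms] by auto
  qed auto
  finally show ?thesis using assms(2) by (simp add: incl_tab_def level_rows_singleton)
qed

text \<open>By the induction hypothesis the blocks of the earlier diagonal tableaux are the tableaux
  of the children of the earlier codes. Concatenated they form the segment of \<open>codes\<close>
  before the children of the current code, which is the situation of
  \<open>reflect_previous_blocks\<close>.\<close>

lemma iter_tab_codes:
  assumes k: "k < n" and i: "i < length (codes k n)"
  shows "iter_tab k n (map (code_tab n) (codes k n)) (Suc i) (Suc i) =
    level_rows (line_wt (codes k n ! i) (top_entry (codes k n ! i) + 1)) {1..n+1}"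
  using i
proof (induction i rule: less_induct)
  case (less i)
  define cs where "cs = codes k n"
  define P where "P = cs ! i"
  let ?Ts = "map (code_tab n) cs"
  have cs: "valid n P \<and> length P = k" if "P \<in> set cs" for P using set_codes[OF k] that by (auto simp: cs_def)
  have P: "valid n P" "length P = k" using cs less.prems by (auto simp: P_def cs_def)
  \<comment> \<open>Any polynomial system on \<open>n + 1\<close> entries serves here: the claim is
    purely combinatorial, and the polynomials only supply the line.\<close>
  obtain \<beta> s pp where g: "poly_system (n + 1) (n + 1) \<beta> s pp" using poly_system_exists[of "n + 1" "n + 1"] by auto
  interpret code_polys "n + 1" "n + 1" \<beta> s pp using g by unfold_locales auto
  have v: "valid (n + 1) Q" if "valid n Q" for Q using valid_mono[OF that] by simp
  have blk: "block k n (n + 1 - k) (iter_tab k n ?Ts (Suc j) (Suc j)) = map (code_tab (n + 1)) (children (n + 1) (cs ! j))"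
    if "j < i" for j
  proof -
    have "cs ! j \<in> set cs" using that less.prems by (simp add: cs_def)
    then have "valid n (cs ! j)" "length (cs ! j) = k" using cs by auto
    then show ?thesis
      using less.IH[OF that] that less.prems block_line_tab[of n "cs ! j"] k by (simp add: cs_def)
  qed
  define pre where "pre = concat (map (children (n + 1)) (take i cs))"
  define post where "post = concat (map (children (n + 1)) (drop i cs))"
  have "iter_tab k n ?Ts (Suc i) (Suc i) =
     reflect_block (concat (map (\<lambda>j. block k n (n + 1 - k) (iter_tab k n ?Ts j j)) [1..<Suc i]))
       (incl_tab (n - 1) n (?Ts ! i))"
    using iter_tab_fold[of k n ?Ts "Suc i" i] by simp
  also have "?Ts ! i = code_tab n P" using less.prems by (simp add: P_def cs_def)
  also have "incl_tab (n - 1) n (code_tab n P) = code_tab (n + 1) P"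
    using k by (intro incl_code_tab P) auto
  also have "map (\<lambda>j. block k n (n + 1 - k) (iter_tab k n ?Ts j j)) [1..<Suc i] =
    map (\<lambda>P. map (code_tab (n + 1)) (children (n + 1) P)) (take i cs)"
    using less.prems blk by (intro nth_equalityI) (auto simp: cs_def simp del: upt_Suc iter_tab.simps)
  also have "concat \<dots> = map (code_tab (n + 1)) pre"
    by (simp add: pre_def map_concat comp_def)
  also have "reflect_block (map (code_tab (n + 1)) pre) (code_tab (n + 1) P) = level_rows (line_wt P (top_entry P + 1)) {1..n + 1}"
  proof (rule reflect_previous_blocks)
    show "valid (n + 1) P" "valid (n + 1 - 1) P" using P v by auto
    show "2 \<le> n + 1" using k by simp
    have "codes (Suc k) (n + 1) = concat (map (children (n + 1)) (take i cs @ drop i cs))"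
      by (simp add: cs_def)
    then show "codes (Suc (length P)) (n + 1) = pre @ post" using P by (simp add: pre_def post_def del: append_take_drop_id)
    have dr: "drop i cs = P # drop (Suc i) cs" using less.prems by (simp add: P_def cs_def Cons_nth_drop_Suc)
    then show "set (children (n + 1) P) \<subseteq> set post" by (auto simp: post_def)
    fix Q assume "Q \<in> set post"
    then obtain R where R: "R \<in> set (drop i cs)" "Q \<in> set (children (n + 1) R)" by (auto simp: post_def)
    then have tl: "tl Q = R" by (auto simp: children_def children_at_def)
    have srt: "sorted_wrt code_less (drop i cs)"
      using sorted_codes[OF k] by (simp add: cs_def sorted_wrt_drop)
    have "R = P \<or> code_less P R" using R(1) srt unfolding dr by auto
    moreover have "valid n R" "length R = k" using R(1) cs by (auto dest: in_set_dropD)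
    ultimately show "\<not> code_less (tl Q) P"
      unfolding tl using code_less_irrefl[OF v[OF P(1)]] code_less_asym[OF v[OF P(1)] v, of R] P by auto
  qed
  finally show ?case by (simp add: cs_def P_def)
qed

theorem pi_tab_codes:
  "k \<le> n \<Longrightarrow> pi_tab k n = map (code_tab (n + 1)) (codes k (n + 1))"
proof (induction k n rule: pi_tab.induct)
  case (1 n)
  have "{1..n+1} = {1..<n+2}" by auto
  then have "code_tab (n + 1) [] = map (\<lambda>r. [r]) [1..<n+2]"
    using level_rows_upt[of 1 "n + 2" "wt []"] by simp
  then show ?case by simp
next
  case (3 k n)
  define cs where "cs = codes k (n + 1)"
  have Ts: "pi_tab k n = map (code_tab (n + 1)) cs" using 3 by (simp add: cs_def)
  have k: "k < n + 1" using 3 by simp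
  have blk: "block k (Suc n) (Suc n + 1 - k) (iter_tab k (Suc n) (pi_tab k n) (Suc i) (Suc i)) =
      map (code_tab (Suc n + 1)) (children (Suc n + 1) (cs ! i))" if "i < length cs" for i
  proof -
    have "cs ! i \<in> set cs" using that by simp
    then have "valid (n + 1) (cs ! i)" "length (cs ! i) = k" using set_codes[OF k] by (auto simp: cs_def)
    then show ?thesis
      using iter_tab_codes[OF k, of i] that block_line_tab[of "n + 1" "cs ! i"] unfolding Ts by (simp add: cs_def)
  qed
  have "map (\<lambda>i. block k (Suc n) (Suc n + 1 - k) (iter_tab k (Suc n) (pi_tab k n) i i)) [1..<length (pi_tab k n) + 1]
    = map (\<lambda>P. map (code_tab (Suc n + 1)) (children (Suc n + 1) P)) cs"
  proof (rule nth_equalityI)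
    fix i assume "i < length (map (\<lambda>i. block k (Suc n) (Suc n + 1 - k) (iter_tab k (Suc n) (pi_tab k n) i i)) [1..<length (pi_tab k n) + 1])"
    then have "i < length cs" using Ts by (simp del: upt_Suc)
    then show "map (\<lambda>i. block k (Suc n) (Suc n + 1 - k) (iter_tab k (Suc n) (pi_tab k n) i i)) [1..<length (pi_tab k n) + 1] ! i =
       map (\<lambda>P. map (code_tab (Suc n + 1)) (children (Suc n + 1) P)) cs ! i"
      using blk[of i] by (simp add: Ts del: upt_Suc iter_tab.simps)
  qed (simp add: Ts del: upt_Suc)
  then show ?case by (simp add: cs_def Let_def map_concat comp_def del: upt_Suc iter_tab.simps)
qed auto

section \<open>Polar coordinates\<close>

lemma L2_set_sq: "(L2_set y A)\<^sup>2 = (\<Sum>l\<in>A. (y l)\<^sup>2)"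
  by (simp add: L2_set_def sum_nonneg)

lemma L2_set_Cons: "i \<le> N \<Longrightarrow> (L2_set y {i..N})\<^sup>2 = (y i)\<^sup>2 + (L2_set y {Suc i..N})\<^sup>2"
  unfolding L2_set_sq by (simp add: sum.atLeast_Suc_atMost)

text \<open>The explicit solution of the polar equations. The last angle ranges over a full turn and
  is an argument of a complex number; the others are angles between a coordinate and its tail. The
  value 0 for a vanishing tail is the stated convention, which \<open>Arg\<close> also obeys at
  0.\<close>

definition polar_coord :: "nat \<Rightarrow> (nat \<Rightarrow> real) \<Rightarrow> nat \<Rightarrow> real" where
  "polar_coord N y i =
     (if i = 0 then L2_set y {1..N}
      else if i \<ge> N then 0
      else if i = N - 1 then Arg (Complex (y (N - 1)) (y N))
      else if L2_set y {i..N} = 0 then 0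
      else arccos (y i / L2_set y {i..N}))"

lemma polar_coord_sin_cos:
  assumes "1 \<le> i" "i + 2 \<le> N"
  shows "L2_set y {i..N} * cos (polar_coord N y i) = y i" "L2_set y {i..N} * sin (polar_coord N y i) = L2_set y {Suc i..N}"
    "polar_coord N y i \<in> {0..pi}"
proof -
  let ?r = "L2_set y {i..N}" and ?t = "L2_set y {Suc i..N}"
  have sq: "?r\<^sup>2 = (y i)\<^sup>2 + ?t\<^sup>2" using assms by (intro L2_set_Cons) simp
  have p: "polar_coord N y i = (if ?r = 0 then 0 else arccos (y i / ?r))" using assms by (simp add: polar_coord_def)
  have "?r * cos (polar_coord N y i) = y i \<and> ?r * sin (polar_coord N y i) = ?t \<and> polar_coord N y i \<in> {0..pi}"
  proof (cases "?r = 0")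
    case True
    then show ?thesis using sq p by (auto simp: sum_power2_eq_zero_iff)
  next
    case False
    then have r: "0 < ?r" using L2_set_nonneg[of y "{i..N}"] by linarith
    have "\<bar>y i\<bar> \<le> ?r" using sq by (intro abs_le_square_iff[THEN iffD2, of "y i" ?r, simplified]) (use r in auto)
    then have b: "-1 \<le> y i / ?r" "y i / ?r \<le> 1" using r by (auto simp: field_simps abs_le_iff)
    have "1 - (y i / ?r)\<^sup>2 = (?r\<^sup>2 - (y i)\<^sup>2) / ?r\<^sup>2" using r by (simp add: power_divide diff_divide_distrib)
    then have "1 - (y i / ?r)\<^sup>2 = (?t / ?r)\<^sup>2" using sq by (simp add: power_divide)
    then have "sqrt (1 - (y i / ?r)\<^sup>2) = ?t / ?r" using r by (simp add: real_sqrt_abs)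
    then show ?thesis using b r False by (simp add: p cos_arccos sin_arccos arccos_lbound arccos_ubound)
  qed
  then show "?r * cos (polar_coord N y i) = y i" "?r * sin (polar_coord N y i) = ?t" "polar_coord N y i \<in> {0..pi}" by blast+
qed

lemma L2_set_last2:
  assumes "2 \<le> (N::nat)"
  shows "L2_set y {N-1..N} = cmod (Complex (y (N-1)) (y N))"
proof -
  from assms have "{N-1..N} = {N-1, N}" "N - 1 \<noteq> N" by auto
  then show ?thesis by (simp add: L2_set_def complex_norm)
qed

lemma polar_coord_last:
  assumes "2 \<le> N"
  shows "L2_set y {N-1..N} * cos (polar_coord N y (N-1)) = y (N-1)" "L2_set y {N-1..N} * sin (polar_coord N y (N-1)) = y N"
    "polar_coord N y (N-1) \<in> {-pi<..pi}"
proof -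
  let ?z = "Complex (y (N-1)) (y N)"
  have p: "polar_coord N y (N-1) = Arg ?z" using assms by (simp add: polar_coord_def)
  have z: "rcis (cmod ?z) (Arg ?z) = ?z" by (rule rcis_cmod_Arg)
  show "L2_set y {N-1..N} * cos (polar_coord N y (N-1)) = y (N-1)" "L2_set y {N-1..N} * sin (polar_coord N y (N-1)) = y N"
    unfolding p L2_set_last2[OF assms] using arg_cong[OF z, of Re] arg_cong[OF z, of Im] by simp_all
  show "polar_coord N y (N-1) \<in> {-pi<..pi}" unfolding p using Arg_bounded[of ?z] by simp
qed

lemma polar_coord_prod:
  assumes "2 \<le> N" "1 \<le> i" "i < N"
  shows "polar_coord N y 0 * (\<Prod>j=1..<i. sin (polar_coord N y j)) = L2_set y {i..N}"
  using assms(2,3)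
proof (induction i rule: dec_induct)
  case base
  then show ?case by (simp add: polar_coord_def)
next
  case (step i)
  then have "polar_coord N y 0 * (\<Prod>j=1..<Suc i. sin (polar_coord N y j)) = L2_set y {i..N} * sin (polar_coord N y i)"
    by (simp add: mult.assoc[symmetric])
  then show ?case using polar_coord_sin_cos(2)[of i N y] step by simp
qed

lemma is_polar_pol:
  assumes N: "2 \<le> N"
  shows "is_polar_coords N y (polar_coord N y)"
  unfolding is_polar_coords_def
proof (intro conjI allI impI ballI)
  show "0 \<le> polar_coord N y 0" by (simp add: polar_coord_def)
  show "polar_coord N y i \<in> {0..pi}" if "1 \<le> i \<and> i + 2 \<le> N" for i using polar_coord_sin_cos(3) that by blast
  show "polar_coord N y (N - 1) \<in> {-pi<..pi}" by (rule polar_coord_last(3)[OF N])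
  show "y i = polar_coord N y 0 * (\<Prod>j=1..<i. sin (polar_coord N y j)) * cos (polar_coord N y i)" if i: "i \<in> {1..<N}" for i
    using polar_coord_prod[OF N, of i y] polar_coord_sin_cos(1)[of i N y] polar_coord_last(1)[OF N, of y] i
    by (cases "i = N - 1") auto
  have "y N = polar_coord N y 0 * (\<Prod>j=1..<N-1. sin (polar_coord N y j)) * sin (polar_coord N y (N-1))"
    using polar_coord_prod[OF N, of "N-1" y] polar_coord_last(2)[OF N, of y] N by simp
  also have "\<dots> = polar_coord N y 0 * (\<Prod>j=1..<Suc (N-1). sin (polar_coord N y j))"
    using N by (subst prod.atLeastLessThan_Suc) (auto simp: mult.assoc)
  finally show "y N = polar_coord N y 0 * (\<Prod>j=1..<N. sin (polar_coord N y j))" using N by simp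
  show "polar_coord N y i = 0" if "i \<in> {1..<N}" "\<forall>j\<in>{i..N}. y j = 0" for i
  proof (cases "i = N - 1")
    case True
    then have "Complex (y (N-1)) (y N) = 0" using that N by (auto simp: complex_eq_iff)
    then show ?thesis using True N that by (simp add: polar_coord_def Arg_zero)
  next
    case False
    have "L2_set y {i..N} = 0" using that by (intro L2_set_0') auto
    then show ?thesis using False that by (simp add: polar_coord_def)
  qed
  show "polar_coord N y i = 0" if "i \<ge> N" for i using that N by (simp add: polar_coord_def)
qed

text \<open>The product \<open>G i\<close> of the radius and the first sines is, up to sign, the
  norm of the coordinates from \<open>i\<close> on, by descending induction. For
  \<open>i < N\<close> it is nonnegative because the sines of angles in [0, pi] are; only
  \<open>G N\<close> can be negative. The angles are then read off from the tails.\<close>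

lemma is_polar_imp_pol:
  assumes N: "2 \<le> N" and p: "is_polar_coords N y \<theta>"
  shows "\<theta> = polar_coord N y"
proof -
  define G where "G i = \<theta> 0 * (\<Prod>j=1..<i. sin (\<theta> j))" for i
  have t0: "0 \<le> \<theta> 0" and ti: "\<And>i. 1 \<le> i \<Longrightarrow> i + 2 \<le> N \<Longrightarrow> \<theta> i \<in> {0..pi}" 
    and tl: "\<theta> (N-1) \<in> {-pi<..pi}" and yi: "\<And>i. i \<in> {1..<N} \<Longrightarrow> y i = G i * cos (\<theta> i)"
    and yN: "y N = G N" and z: "\<And>i. i \<in> {1..<N} \<Longrightarrow> (\<forall>j\<in>{i..N}. y j = 0) \<Longrightarrow> \<theta> i = 0"
    and big: "\<And>i. i \<ge> N \<Longrightarrow> \<theta> i = 0"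
    using p unfolding is_polar_coords_def G_def by blast+
  have Gs: "G (Suc i) = G i * sin (\<theta> i)" if "1 \<le> i" for i
    using that by (simp add: G_def mult.assoc)
  have G0: "0 \<le> G i" if "1 \<le> i" "i < N" for i
  proof -
    have "0 \<le> sin (\<theta> j)" if "j \<in> {1..<i}" for j
      using ti[of j] that \<open>i < N\<close> by (intro sin_ge_zero) auto
    then show ?thesis unfolding G_def using t0 by (intro mult_nonneg_nonneg prod_nonneg) auto
  qed
  have sq: "(L2_set y {i..N})\<^sup>2 = (G i)\<^sup>2" if "1 \<le> i" "i \<le> N" for i
    using that(2,1)
  proof (induction i rule: inc_induct)
    case base
    then show ?case using yN by (simp add: L2_set_sq)
  next
    case (step i)
    have "(L2_set y {i..N})\<^sup>2 = (y i)\<^sup>2 + (G (Suc i))\<^sup>2" using step L2_set_Cons[of i N y] by simp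
    also have "\<dots> = (G i)\<^sup>2 * ((cos (\<theta> i))\<^sup>2 + (sin (\<theta> i))\<^sup>2)"
    proof -
      have "y i = G i * cos (\<theta> i)" "G (Suc i) = G i * sin (\<theta> i)" using step yi[of i] Gs[of i] by auto
      then show ?thesis by (simp only: power_mult_distrib distrib_left)
    qed
    finally show ?case by simp
  qed
  have L: "L2_set y {i..N} = G i" if "1 \<le> i" "i < N" for i
    using sq[of i] G0[of i] that by (simp add: power2_eq_iff_nonneg)
  show ?thesis
  proof
    fix i
    consider "i = 0" | "N \<le> i" "i \<noteq> 0" | "i = N - 1" "i \<noteq> 0" "i < N" | "1 \<le> i" "i + 2 \<le> N" by linarith
    then show "\<theta> i = polar_coord N y i"
    proof cases
      case 1
      then show ?thesis using L[of 1] N by (simp add: polar_coord_def G_def)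
    next
      case 2
      then show ?thesis using big by (simp add: polar_coord_def)
    next
      case 3
      let ?z = "Complex (y (N-1)) (y N)"
      have p: "polar_coord N y i = Arg ?z" using 3 by (simp add: polar_coord_def)
      have N1: "Suc (N - 1) = N" using N by simp
      show ?thesis
      proof (cases "?z = 0")
        case True
        then have "y (N-1) = 0" "y N = 0" by (auto simp: complex_eq_iff)
        moreover have "{i..N} = {N-1, N}" using 3 N by auto
        ultimately have "\<theta> i = 0" using z[of i] 3 by auto
        then show ?thesis using True p by (simp add: Arg_zero)
      next
        case False
        have e: "y (N-1) = G (N-1) * cos (\<theta> (N-1))" "y N = G (N-1) * sin (\<theta> (N-1))"
          using yi[of "N-1"] yN Gs[of "N-1"] 3 N1 by auto
        have "cmod ?z = G (N-1)" using L[of "N-1"] 3 L2_set_last2[OF N, of y] by simp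
        then have "sgn ?z = cis (\<theta> (N-1))"
          using False by (auto simp: sgn_eq complex_eq_iff e[simplified])
        then have "Arg ?z = \<theta> (N-1)" using tl by (intro cis_Arg_unique) auto
        then show ?thesis using p 3 by simp
      qed
    next
      case 4
      have p: "polar_coord N y i = (if L2_set y {i..N} = 0 then 0 else arccos (y i / L2_set y {i..N}))"
        using 4 by (simp add: polar_coord_def)
      show ?thesis
      proof (cases "L2_set y {i..N} = 0")
        case True
        then have "\<forall>j\<in>{i..N}. y j = 0" by (simp add: L2_set_eq_0_iff)
        then show ?thesis using z[of i] p True 4 by simp
      next
        case False
        then have "y i / L2_set y {i..N} = cos (\<theta> i)" using yi[of i] L[of i] 4 by simp
        then show ?thesis using False p ti[of i] 4 by (simp add: arccos_cos)
      qed
    qed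
  qed
qed

lemma polar_eq_pol:
  fixes P :: "'a::euclidean_space"
  assumes "2 \<le> DIM('a)"
  shows "polar org e P = polar_coord (DIM('a)) (\<lambda>i. (P - org) \<bullet> e i)"
  unfolding polar_def
  using is_polar_pol[OF assms] is_polar_imp_pol[OF assms] by (intro the_equality) auto

lemma polar_coord_scale:
  assumes "0 < c" "1 \<le> i" "\<And>l. l \<in> {i..N} \<Longrightarrow> y' l = c * y l" "j \<in> {i..<N}"
  shows "polar_coord N y' j = polar_coord N y j"
proof -
  have L: "L2_set y' {j..N} = c * L2_set y {j..N}"
    using assms by (subst L2_set_right_distrib) (auto intro!: L2_set_cong)
  show ?thesis
  proof (cases "j = N - 1")
    case True
    have "Complex (y' (N-1)) (y' N) = of_real c * Complex (y (N-1)) (y N)"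
      using assms True by (simp add: complex_eq_iff)
    then show ?thesis using True assms by (simp add: polar_coord_def Arg_times_of_real)
  next
    case False
    then show ?thesis using assms L by (simp add: polar_coord_def)
  qed
qed

text \<open>From the index \<open>i\<close> on, each coordinate is a factor common to all of them,
  made of the radius and the earlier sines, times an expression \<open>g\<close> in the angles from
  \<open>i\<close> on. Equal angles give the same \<open>g\<close>.\<close>

lemma polar_coord_proportional:
  assumes N: "2 \<le> N" and i: "1 \<le> i" "i < N" and eq: "\<And>j. j \<in> {i..<N} \<Longrightarrow> polar_coord N y j = polar_coord N y' j"
    and ne: "\<exists>l\<in>{i..N}. y l \<noteq> 0"
  shows "\<exists>c. \<forall>l\<in>{i..N}. y' l = c * y l"
proof -
  define g where "g l = (\<Prod>j=i..<l. sin (polar_coord N y j)) * (if l = N then 1 else cos (polar_coord N y l))" for l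
  have split: "(\<Prod>j=1..<l. f j) = (\<Prod>j=1..<i. f j) * (\<Prod>j=i..<l. f j)" if "i \<le> l" for l and f :: "nat \<Rightarrow> real"
    using prod.atLeastLessThan_concat[of 1 i l f] i that by simp
  have A: "y l = (polar_coord N y 0 * (\<Prod>j=1..<i. sin (polar_coord N y j))) * g l" if "l \<in> {i..N}" for l
    using is_polar_pol[OF N, of y] that i split[of l "\<lambda>j. sin (polar_coord N y j)"]
    unfolding is_polar_coords_def g_def by (cases "l = N") (auto simp: mult.assoc)
  have B: "y' l = (polar_coord N y' 0 * (\<Prod>j=1..<i. sin (polar_coord N y' j))) * g l" if l: "l \<in> {i..N}" for l
  proof -
    have "g l = (\<Prod>j=i..<l. sin (polar_coord N y' j)) * (if l = N then 1 else cos (polar_coord N y' l))"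
      unfolding g_def using eq l by (intro arg_cong2[of _ _ _ _ "(*)"] prod.cong) auto
    then show ?thesis
      using is_polar_pol[OF N, of y'] l i split[of l "\<lambda>j. sin (polar_coord N y' j)"]
      unfolding is_polar_coords_def by (cases "l = N") (auto simp: mult.assoc)
  qed
  have "polar_coord N y 0 * (\<Prod>j=1..<i. sin (polar_coord N y j)) \<noteq> 0" using ne A by force
  then show ?thesis using A B
    by (intro exI[of _ "(polar_coord N y' 0 * (\<Prod>j=1..<i. sin (polar_coord N y' j))) / (polar_coord N y 0 * (\<Prod>j=1..<i. sin (polar_coord N y j)))"]) auto
qed

lemma polar_coord_arctan:
  assumes N: "2 \<le> N" and i: "1 \<le> i" "i < N" and y: "0 < y i" "i = N - 1 \<Longrightarrow> 0 \<le> y N"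
  shows "polar_coord N y i = arctan (L2_set y {Suc i..N} / y i)"
proof (cases "i = N - 1")
  case True
  have "L2_set y {Suc i..N} = y N" using True y N by (simp add: L2_set_def)
  then show ?thesis using True i y by (simp add: polar_coord_def arg_conv_arctan)
next
  case False
  let ?t = "L2_set y {Suc i..N}" and ?r = "L2_set y {i..N}"
  have sq: "?r\<^sup>2 = (y i)\<^sup>2 + ?t\<^sup>2" using i by (intro L2_set_Cons) simp
  have r: "0 < ?r" 
  proof -
    have "?r \<noteq> 0" using sq y by (auto simp: sum_power2_eq_zero_iff)
    then show ?thesis using L2_set_nonneg[of y "{i..N}"] by linarith
  qed
  have "cos (arctan (?t / y i)) = y i / ?r"
  proof -
    have "1 + (?t / y i)\<^sup>2 = (?r / y i)\<^sup>2" using sq y by (simp add: field_simps power2_eq_square)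
    then have "sqrt (1 + (?t / y i)\<^sup>2) = ?r / y i" using r y by (simp add: real_sqrt_abs)
    then show ?thesis by (simp add: cos_arctan)
  qed
  moreover have "0 \<le> arctan (?t / y i)" "arctan (?t / y i) \<le> pi"
  proof -
    show "0 \<le> arctan (?t / y i)" using y by (simp add: zero_le_arctan_iff)
    show "arctan (?t / y i) \<le> pi" using arctan_ubound[of "?t / y i"] pi_gt_zero by linarith
  qed
  ultimately have "arccos (y i / ?r) = arctan (?t / y i)" by (metis arccos_cos)
  then show ?thesis using False i r by (simp add: polar_coord_def)
qed

text \<open>With positive coordinates, the tangent of the angle at \<open>i\<close> is the norm of
  the tail beyond \<open>i\<close> divided by the coordinate at \<open>i\<close>. The sector thus
  becomes a convex cone given by explicit inequalities.\<close>

lemma sector_iff: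
  assumes N: "2 \<le> N" and d: "0 < \<delta>" "\<delta> < pi / 2"
  shows "(\<forall>i\<in>{1..<N}. polar_coord N y i \<in> {0<..<\<delta>}) \<and> 0 < polar_coord N y 0 \<longleftrightarrow>
    (\<forall>i\<in>{1..N}. 0 < y i) \<and> (\<forall>i\<in>{1..<N}. L2_set y {Suc i..N} < tan \<delta> * y i)"
proof -
  have key: "polar_coord N y i \<in> {0<..<\<delta>} \<longleftrightarrow> L2_set y {Suc i..N} < tan \<delta> * y i"
    if "\<forall>i\<in>{1..N}. 0 < y i" "i \<in> {1..<N}" for i
  proof -
    have "polar_coord N y i = arctan (L2_set y {Suc i..N} / y i)"
      using that by (intro polar_coord_arctan N) (auto intro: less_imp_le)
    moreover have "0 < L2_set y {Suc i..N}"
    proof -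
      have "0 < y N" using that N by simp
      then have "y N \<noteq> 0" by simp
      then have "L2_set y {Suc i..N} \<noteq> 0"
        using that by (subst L2_set_eq_0_iff) (auto intro!: bexI[of _ N] simp del: One_nat_def)
      then show ?thesis using L2_set_nonneg[of y "{Suc i..N}"] by linarith
    qed
    moreover have "arctan x < \<delta> \<longleftrightarrow> x < tan \<delta>" for x
      using arctan_less_iff[of x "tan \<delta>"] d by (simp add: arctan_tan)
    ultimately show ?thesis using that by (auto simp: zero_less_arctan_iff pos_divide_less_eq)
  qed
  have pos: "\<forall>i\<in>{1..N}. 0 < y i" if "\<forall>i\<in>{1..<N}. polar_coord N y i \<in> {0<..<\<delta>}" "0 < polar_coord N y 0"
  proof
    fix i assume i: "i \<in> {1..N}"
    have s: "0 < sin (polar_coord N y j)" "0 < cos (polar_coord N y j)" if "j \<in> {1..<N}" for j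
    proof -
      have "polar_coord N y j \<in> {0<..<\<delta>}" using \<open>\<forall>i\<in>{1..<N}. polar_coord N y i \<in> {0<..<\<delta>}\<close> that by blast
      then have *: "0 < polar_coord N y j" "polar_coord N y j < pi / 2" "polar_coord N y j < pi" using d pi_gt_zero by auto
      show "0 < sin (polar_coord N y j)" "0 < cos (polar_coord N y j)"
        using sin_gt_zero[OF *(1,3)] cos_gt_zero[OF *(1,2)] by auto
    qed
    have pr: "0 < (\<Prod>j=1..<i. sin (polar_coord N y j))"
    proof (rule prod_pos)
      fix j assume "j \<in> {1..<i}"
      then show "0 < sin (polar_coord N y j)" using i by (intro s(1)) auto
    qed
    show "0 < y i"
    proof (cases "i = N")
      case True
      then have "y i = polar_coord N y 0 * (\<Prod>j=1..<i. sin (polar_coord N y j))"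
        using is_polar_pol[OF N, of y] unfolding is_polar_coords_def by blast
      then show ?thesis using pr \<open>0 < polar_coord N y 0\<close> by (metis mult_pos_pos)
    next
      case False
      then have iN: "i \<in> {1..<N}" using i by auto
      then have "y i = polar_coord N y 0 * (\<Prod>j=1..<i. sin (polar_coord N y j)) * cos (polar_coord N y i)"
        using is_polar_pol[OF N, of y] unfolding is_polar_coords_def by blast
      then show ?thesis using pr \<open>0 < polar_coord N y 0\<close> s(2)[OF iN] by (metis mult_pos_pos)
    qed
  qed
  have "0 < polar_coord N y 0" if "\<forall>i\<in>{1..N}. 0 < y i"
  proof -
    have "1 \<in> {1..N}" using N by simp
    then have "0 < y 1" using that by blast
    then have "L2_set y {1..N} \<noteq> 0" using \<open>1 \<in> {1..N}\<close> L2_set_eq_0_iff[of "{1..N}" y] by force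
    then have "0 < L2_set y {1..N}" using L2_set_nonneg[of y "{1..N}"] by linarith
    then show ?thesis by (simp add: polar_coord_def)
  qed
  then show ?thesis using key pos by blast
qed

lemma polar_coord_eq_0:
  assumes N: "2 \<le> N" and k: "1 \<le> k" "k < N" and y: "0 < y k" "\<And>l. k < l \<Longrightarrow> l \<le> N \<Longrightarrow> y l = 0"
    and j: "k \<le> j"
  shows "polar_coord N y j = 0"
proof (cases "j = k")
  case True
  have "L2_set y {Suc k..N} = 0" using y by (intro L2_set_0') auto
  moreover have "polar_coord N y k = arctan (L2_set y {Suc k..N} / y k)"
    using k y by (intro polar_coord_arctan N) auto
  ultimately show ?thesis using True by simp
next
  case False
  then show ?thesis
    using is_polar_pol[OF N, of y] y k j unfolding is_polar_coords_def by (cases "j < N") auto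
qed

lemma polar_coord_pred:
  assumes N: "2 \<le> N" and k: "2 \<le> k" "k < N" and y: "0 < y k" "0 < y (k - 1)" "\<And>l. k < l \<Longrightarrow> l \<le> N \<Longrightarrow> y l = 0"
  shows "polar_coord N y (k - 1) = arctan (y k / y (k - 1))"
proof -
  have "(L2_set y {k..N})\<^sup>2 = (y k)\<^sup>2 + (L2_set y {Suc k..N})\<^sup>2" using k by (intro L2_set_Cons) simp
  moreover have "L2_set y {Suc k..N} = 0" using y by (intro L2_set_0') auto
  ultimately have "L2_set y {k..N} = y k" using y(1) by (simp add: power2_eq_iff_nonneg)
  moreover have "polar_coord N y (k-1) = arctan (L2_set y {Suc (k-1)..N} / y (k-1))"
    using k y by (intro polar_coord_arctan N) auto
  ultimately show ?thesis using k by simp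
qed

section \<open>Orthonormal frames and transversal flats\<close>

lemma sum_power_le:
  fixes \<epsilon> :: real
  assumes "0 < \<epsilon>" "\<epsilon> \<le> 1 / 2"
  shows "(\<Sum>i=a..N. \<epsilon> ^ i) \<le> 2 * \<epsilon> ^ a"
proof (cases "a \<le> N + 1")
  case True
  then show ?thesis
  proof (induction a rule: inc_induct)
    case base
    then show ?case using assms by simp
  next
    case (step a)
    have "(\<Sum>i=a..N. \<epsilon> ^ i) = \<epsilon> ^ a + (\<Sum>i=Suc a..N. \<epsilon> ^ i)"
      using step by (simp add: sum.atLeast_Suc_atMost)
    also have "\<dots> \<le> \<epsilon> ^ a + 2 * (\<epsilon> * \<epsilon> ^ a)" using step by simp
    also have "\<dots> \<le> \<epsilon> ^ a + 1 * \<epsilon> ^ a"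
      using assms by (simp add: mult.assoc[symmetric])
    finally show ?case by simp
  qed
qed (use assms in simp)

lemma L2_set_Un_le:
  assumes "finite A" "finite B" "A \<inter> B = {}"
  shows "L2_set y (A \<union> B) \<le> (\<Sum>l\<in>A. \<bar>y l\<bar>) + L2_set y B"
proof (rule power2_le_imp_le)
  have "(L2_set y (A \<union> B))\<^sup>2 = (L2_set y A)\<^sup>2 + (L2_set y B)\<^sup>2"
    unfolding L2_set_sq using assms by (rule sum.union_disjoint)
  also have "\<dots> \<le> (L2_set y A + L2_set y B)\<^sup>2" by (simp add: power2_sum)
  also have "\<dots> \<le> ((\<Sum>l\<in>A. \<bar>y l\<bar>) + L2_set y B)\<^sup>2"
    by (intro power_mono add_right_mono L2_set_le_sum_abs add_nonneg_nonneg L2_set_nonneg)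
  finally show "(L2_set y (A \<union> B))\<^sup>2 \<le> ((\<Sum>l\<in>A. \<bar>y l\<bar>) + L2_set y B)\<^sup>2" .
qed (simp add: sum_nonneg)

locale frame =
  fixes e :: "nat \<Rightarrow> 'a::euclidean_space" and N :: nat
  assumes N: "N = DIM('a)" and N2: "2 \<le> N" and orth: "orthonormal_frame e"
begin

lemma orthD: "i \<in> {1..N} \<Longrightarrow> j \<in> {1..N} \<Longrightarrow> e i \<bullet> e j = (if i = j then 1 else 0)"
  using orth unfolding orthonormal_frame_def N by blast

lemma sum_inner: "j \<in> {1..N} \<Longrightarrow> A \<subseteq> {1..N} \<Longrightarrow> (\<Sum>i\<in>A. c i *\<^sub>R e i) \<bullet> e j = (if j \<in> A then c j else 0)"
proof -
  assume j: "j \<in> {1..N}" "A \<subseteq> {1..N}"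
  then have "finite A" using finite_subset by blast
  have "(\<Sum>i\<in>A. c i *\<^sub>R e i) \<bullet> e j = (\<Sum>i\<in>A. if i = j then c i else 0)"
    using j by (auto simp: inner_sum_left orthD intro!: sum.cong)
  then show ?thesis using \<open>finite A\<close> by simp
qed

lemma inj_e: "inj_on e {1..N}"
  by (rule inj_onI) (metis orthD zero_neq_one)

lemma independent_e: "independent (e ` {1..N})"
proof (rule pairwise_orthogonal_independent)
  show "pairwise orthogonal (e ` {1..N})"
    by (auto simp: pairwise_def orthogonal_def orthD)
  show "0 \<notin> e ` {1..N}"
  proof
    assume "0 \<in> e ` {1..N}"
    then obtain i where "i \<in> {1..N}" "e i = 0" by force
    then show False using orthD[of i i] by simp
  qed
qed

lemma dim_span_e: "k \<le> N \<Longrightarrow> dim (span (e ` {1..k})) = k"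
proof -
  assume k: "k \<le> N"
  have "independent (e ` {1..k})" by (rule independent_mono[OF independent_e]) (use k in auto)
  then have "dim (e ` {1..k}) = card (e ` {1..k})" by (simp add: dim_eq_card_independent)
  also have "\<dots> = k" using k by (subst card_image) (auto intro: inj_on_subset[OF inj_e])
  finally show ?thesis by simp
qed

lemma expand: "x = (\<Sum>i=1..N. (x \<bullet> e i) *\<^sub>R e i)"
proof -
  have "span (e ` {1..N}) = UNIV"
    using dim_span_e[of N] dim_eq_full[of "e ` {1..N}"] by (simp add: N)
  then have "x \<in> span (e ` {1..N})" by simp
  then obtain u where "x = (\<Sum>v\<in>e ` {1..N}. u v *\<^sub>R v)" by (auto simp: span_finite)
  then have x: "x = (\<Sum>i=1..N. u (e i) *\<^sub>R e i)" using inj_e by (simp add: sum.reindex)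
  have "x \<bullet> e i = u (e i)" if "i \<in> {1..N}" for i
    using that sum_inner[of i "{1..N}" "\<lambda>i. u (e i)"] x by simp
  then show ?thesis by (subst x) (auto intro!: sum.cong)
qed

lemma eqI: "(\<And>i. i \<in> {1..N} \<Longrightarrow> x \<bullet> e i = y \<bullet> e i) \<Longrightarrow> x = y"
proof -
  assume "\<And>i. i \<in> {1..N} \<Longrightarrow> x \<bullet> e i = y \<bullet> e i"
  then have "(\<Sum>i=1..N. (x \<bullet> e i) *\<^sub>R e i) = (\<Sum>i=1..N. (y \<bullet> e i) *\<^sub>R e i)"
    by (intro sum.cong) auto
  then show "x = y" using expand[of x] expand[of y] by (simp only:)
qed

lemma norm_L2: "norm x = L2_set (\<lambda>i. x \<bullet> e i) {1..N}"
proof -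
  have "x \<bullet> x = x \<bullet> (\<Sum>i=1..N. (x \<bullet> e i) *\<^sub>R e i)" using expand[of x] by simp
  also have "\<dots> = (\<Sum>i=1..N. (x \<bullet> e i)\<^sup>2)"
    by (simp add: inner_sum_right power2_eq_square)
  finally show ?thesis by (simp add: norm_eq_sqrt_inner L2_set_def)
qed

lemma span_e_iff:
  assumes "k \<le> N"
  shows "x \<in> span (e ` {1..k}) \<longleftrightarrow> (\<forall>i\<in>{k<..N}. x \<bullet> e i = 0)"
proof
  assume "x \<in> span (e ` {1..k})"
  then show "\<forall>i\<in>{k<..N}. x \<bullet> e i = 0"
  proof (induction rule: span_induct)
    case base
    show ?case by (auto simp: subspace_def inner_add_left)
  next
    case (step x)
    then show ?case using assms by (auto simp: orthD)
  qed
next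
  assume z: "\<forall>i\<in>{k<..N}. x \<bullet> e i = 0"
  have "x = (\<Sum>i=1..k. (x \<bullet> e i) *\<^sub>R e i)"
  proof (rule eqI)
    fix j assume "j \<in> {1..N}"
    then show "x \<bullet> e j = (\<Sum>i=1..k. (x \<bullet> e i) *\<^sub>R e i) \<bullet> e j"
      using z assms by (subst sum_inner) auto
  qed
  also have "\<dots> \<in> span (e ` {1..k})" by (intro span_sum span_scale span_base) auto
  finally show "x \<in> span (e ` {1..k})" .
qed

lemma coord_space_iff:
  assumes "k \<le> N"
  shows "x \<in> coord_space org e k \<longleftrightarrow> (\<forall>i\<in>{k<..N}. (x - org) \<bullet> e i = 0)"
proof -
  have "x \<in> coord_space org e k \<longleftrightarrow> x - org \<in> span (e ` {1..k})"
  proof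
    show "x - org \<in> span (e ` {1..k})" if "x \<in> coord_space org e k"
      using that by (auto simp: coord_space_def)
    show "x \<in> coord_space org e k" if "x - org \<in> span (e ` {1..k})"
      using that by (auto simp: coord_space_def intro!: exI[of _ "x - org"])
  qed
  then show ?thesis using span_e_iff[OF assms] by simp
qed

lemma norm_inner_e: "i \<in> {1..N} \<Longrightarrow> \<bar>x \<bullet> e i\<bar> \<le> norm x"
proof -
  assume i: "i \<in> {1..N}"
  have "norm (e i) = 1" using orthD[OF i i] by (simp add: norm_eq_sqrt_inner)
  then show ?thesis using Cauchy_Schwarz_ineq2[of x "e i"] by simp
qed

text \<open>The direction of the affine span of a half-subspace V_i, when \<open>y\<close> holds the
  coordinates of one of its points: fixed angles from \<open>i\<close> on mean a fixed direction of
  the tail.\<close>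

definition tail_space :: "nat \<Rightarrow> (nat \<Rightarrow> real) \<Rightarrow> 'a set" where
  "tail_space i y = {v. \<exists>c. \<forall>l\<in>{i..N}. v \<bullet> e l = c * y l}"

lemma tail_space_subspace: "subspace (tail_space i y)"
  unfolding subspace_def tail_space_def
proof (intro conjI ballI allI)
  show "0 \<in> {v. \<exists>c. \<forall>l\<in>{i..N}. v \<bullet> e l = c * y l}" by (auto intro: exI[of _ 0])
  fix v w and a :: real assume "v \<in> {v. \<exists>c. \<forall>l\<in>{i..N}. v \<bullet> e l = c * y l}" "w \<in> {v. \<exists>c. \<forall>l\<in>{i..N}. v \<bullet> e l = c * y l}"
  then obtain c d where "\<forall>l\<in>{i..N}. v \<bullet> e l = c * y l" "\<forall>l\<in>{i..N}. w \<bullet> e l = d * y l" by auto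
  then show "v + w \<in> {v. \<exists>c. \<forall>l\<in>{i..N}. v \<bullet> e l = c * y l}"
    by (auto simp: inner_add_left algebra_simps intro!: exI[of _ "c + d"])
next
  fix v and a :: real assume "v \<in> {v. \<exists>c. \<forall>l\<in>{i..N}. v \<bullet> e l = c * y l}"
  then obtain c where "\<forall>l\<in>{i..N}. v \<bullet> e l = c * y l" by auto
  then show "a *\<^sub>R v \<in> {v. \<exists>c. \<forall>l\<in>{i..N}. v \<bullet> e l = c * y l}"
    by (auto intro!: exI[of _ "a * c"])
qed

lemma dim_tail_space:
  assumes i: "1 \<le> i" "i \<le> N" and y: "y i \<noteq> 0"
  shows "dim (tail_space i y) = i"
proof -
  define u where "u = (\<Sum>l=i..N. y l *\<^sub>R e l)"
  define B where "B = insert u (e ` {1..<i})"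
  have ue: "u \<bullet> e j = (if j \<in> {i..N} then y j else 0)" if "j \<in> {1..N}" for j
    unfolding u_def using that i by (intro sum_inner) auto
  have u0: "u \<noteq> 0" using ue[of i] i y by auto
  have "e j \<noteq> 0" if "j \<in> {1..N}" for j using orthD[of j j] that by auto
  then have ej: "e j \<noteq> 0" if "j \<in> {1..<i}" for j using that i by simp
  have "0 \<notin> e ` {1..<i}"
  proof
    assume "0 \<in> e ` {1..<i}"
    then obtain j where "j \<in> {1..<i}" "0 = e j" by (rule imageE)
    then show False using ej[of j] by simp
  qed
  then have nz: "0 \<notin> B" using u0 by (simp add: B_def)
  have "orthogonal u (e j)" if "j \<in> {1..<i}" for j
    using that i ue[of j] by (simp add: orthogonal_def)
  moreover have "orthogonal (e j) (e l)" if "j \<in> {1..<i}" "l \<in> {1..<i}" "e j \<noteq> e l" for j l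
    using that i orthD[of j l] by (cases "j = l") (auto simp: orthogonal_def)
  ultimately have "pairwise orthogonal B"
    unfolding B_def pairwise_insert by (auto simp: pairwise_def orthogonal_commute[of _ u])
  then have ind: "independent B" using nz by (rule pairwise_orthogonal_independent)
  have "u \<notin> e ` {1..<i}"
  proof
    assume "u \<in> e ` {1..<i}"
    then obtain j where "j \<in> {1..<i}" "u = e j" by auto
    then show False using ue[of i] orthD[of j i] i y by auto
  qed
  moreover have "card (e ` {1..<i}) = i - 1"
    using i by (subst card_image) (auto intro: inj_on_subset[OF inj_e])
  ultimately have card: "card B = i" using i by (simp add: B_def)
  have "tail_space i y = span B"
  proof
    have "e j \<in> tail_space i y" if "j \<in> {1..<i}" for j
      using that i by (auto simp: tail_space_def orthD intro!: exI[of _ 0])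
    moreover have "u \<in> tail_space i y" using i ue by (auto simp: tail_space_def intro!: exI[of _ 1])
    ultimately show "span B \<subseteq> tail_space i y"
      by (intro span_minimal tail_space_subspace) (auto simp: B_def)
    show "tail_space i y \<subseteq> span B"
    proof
      fix v assume "v \<in> tail_space i y"
      then obtain c where c: "\<forall>l\<in>{i..N}. v \<bullet> e l = c * y l" by (auto simp: tail_space_def)
      have "v = (\<Sum>l=1..<i. (v \<bullet> e l) *\<^sub>R e l) + c *\<^sub>R u"
      proof (rule eqI)
        fix j assume "j \<in> {1..N}"
        moreover have "{1..<i} \<subseteq> {1..N}" using i by auto
        ultimately show "v \<bullet> e j = ((\<Sum>l=1..<i. (v \<bullet> e l) *\<^sub>R e l) + c *\<^sub>R u) \<bullet> e j"
          using c i sum_inner[of j "{1..<i}" "\<lambda>l. v \<bullet> e l"] ue[of j] by (auto simp: inner_add_left)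
      qed
      also have "\<dots> \<in> span B"
        by (intro span_add span_sum span_scale span_base) (auto simp: B_def)
      finally show "v \<in> span B" .
    qed
  qed
  then show ?thesis using ind card by (simp add: dim_eq_card_independent)
qed

lemma sum_subspaces_UNIV:
  assumes "subspace S" "subspace (T::'a set)" "S \<inter> T \<subseteq> {0}" "dim S + dim T = N"
  shows "{x + y |x y. x \<in> S \<and> y \<in> T} = UNIV"
proof -
  have "S \<inter> T = {0}" using assms(1-3) by (auto simp: subspace_0)
  then have "dim {x + y |x y. x \<in> S \<and> y \<in> T} = N"
    using dim_sums_Int[OF assms(1,2)] assms(4) by simp
  then have "span {x + y |x y. x \<in> S \<and> y \<in> T} = UNIV"
    using dim_eq_full[of "{x + y |x y. x \<in> S \<and> y \<in> T}"] N by simp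
  moreover have "span {x + y |x y. x \<in> S \<and> y \<in> T} = {x + y |x y. x \<in> S \<and> y \<in> T}"
    by (rule span_eq_iff[THEN iffD2, OF subspace_sums[OF assms(1,2)]])
  ultimately show ?thesis by (simp only:)
qed

section \<open>Complements of the flag and projections along it\<close>

definition transversal :: "'a set \<Rightarrow> nat \<Rightarrow> bool" where
  "transversal L k \<longleftrightarrow> subspace L \<and> k < N \<and> dim L + k = N \<and> L \<inter> span (e ` {1..k}) \<subseteq> {0}"

definition proj :: "'a set \<Rightarrow> nat \<Rightarrow> 'a \<Rightarrow> 'a" where
  "proj L k x = (SOME p. p \<in> L \<and> x - p \<in> span (e ` {1..k}))"

lemma proj:
  assumes "transversal L k"
  shows "proj L k x \<in> L" "x - proj L k x \<in> span (e ` {1..k})"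
proof -
  have "{x + y |x y. x \<in> L \<and> y \<in> span (e ` {1..k})} = UNIV"
    using assms dim_span_e[of k] by (intro sum_subspaces_UNIV) (auto simp: transversal_def)
  then obtain a b where "x = a + b" "a \<in> L" "b \<in> span (e ` {1..k})" by blast
  then have "\<exists>p. p \<in> L \<and> x - p \<in> span (e ` {1..k})" by (intro exI[of _ a]) auto
  from someI_ex[OF this] show "proj L k x \<in> L" "x - proj L k x \<in> span (e ` {1..k})"
    unfolding proj_def by auto
qed

lemma proj_unique:
  assumes "transversal L k" "p \<in> L" "x - p \<in> span (e ` {1..k})"
  shows "proj L k x = p"
proof -
  have "subspace L" "L \<inter> span (e ` {1..k}) \<subseteq> {0}" using assms(1) unfolding transversal_def by blast+
  then have "proj L k x - p \<in> L" using proj(1)[OF assms(1)] assms(2) by (intro subspace_diff)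
  moreover have "(x - p) - (x - proj L k x) \<in> span (e ` {1..k})"
    by (rule span_diff[OF assms(3) proj(2)[OF assms(1)]])
  moreover have "(x - p) - (x - proj L k x) = proj L k x - p" by simp
  ultimately have "proj L k x - p \<in> {0}"
    using \<open>L \<inter> span (e ` {1..k}) \<subseteq> {0}\<close> by (metis IntI subsetD)
  then show ?thesis by simp
qed

lemma proj_linear:
  assumes "transversal L k"
  shows "linear (proj L k)"
proof (rule linearI)
  note p = proj[OF assms]
  have s: "subspace L" using assms by (simp add: transversal_def)
  fix x y and c :: real
  have "(x - proj L k x) + (y - proj L k y) \<in> span (e ` {1..k})" using p by (intro span_add)
  moreover have "(x - proj L k x) + (y - proj L k y) = (x + y) - (proj L k x + proj L k y)" by simp
  ultimately show "proj L k (x + y) = proj L k x + proj L k y"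
    using proj_unique[OF assms subspace_add[OF s p(1) p(1)]] by metis
  have "c *\<^sub>R (x - proj L k x) \<in> span (e ` {1..k})" using p by (intro span_scale)
  then show "proj L k (c *\<^sub>R x) = c *\<^sub>R proj L k x"
    using proj_unique[OF assms subspace_scale[OF s p(1)]] by (metis scaleR_diff_right)
qed

lemma proj_span:
  assumes "transversal L k" "x \<in> span (e ` {1..k})"
  shows "proj L k x = 0"
  by (rule proj_unique[OF assms(1)]) (use assms in \<open>simp_all add: transversal_def subspace_0\<close>)

lemma proj_id:
  assumes "transversal L k" "x \<in> L"
  shows "proj L k x = x"
  by (rule proj_unique[OF assms]) (simp add: span_zero)

text \<open>Seen from this origin the centre 0 has the coordinates \<open>\<epsilon> ^ i\<close>.
  For small \<epsilon> its tail beyond \<open>i\<close> has norm at most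
  \<open>2 * \<epsilon> ^ Suc i\<close>, so it lies strictly inside the cone where each tail is less
  than \<open>3 * \<epsilon>\<close> times the coordinate before it. That cone is the sector used
  below, with opening angle \<open>arctan (3 * \<epsilon>)\<close>.\<close>

definition org :: "real \<Rightarrow> 'a" where "org \<epsilon> = - (\<Sum>i=1..N. \<epsilon> ^ i *\<^sub>R e i)"

abbreviation Y :: "real \<Rightarrow> 'a \<Rightarrow> nat \<Rightarrow> real" where "Y \<epsilon> x \<equiv> \<lambda>i. (x - org \<epsilon>) \<bullet> e i"

lemma org_e: "i \<in> {1..N} \<Longrightarrow> org \<epsilon> \<bullet> e i = - (\<epsilon> ^ i)"
  unfolding org_def using sum_inner[of i "{1..N}" "\<lambda>i. \<epsilon> ^ i"] by simp

lemma Y_eq: "i \<in> {1..N} \<Longrightarrow> Y \<epsilon> x i = x \<bullet> e i + \<epsilon> ^ i"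
  by (simp add: inner_diff_left org_e)

definition pnt :: "'a set \<Rightarrow> nat \<Rightarrow> real \<Rightarrow> 'a" where "pnt L k \<epsilon> = proj L k (org \<epsilon>)"

lemma pnt_unique:
  assumes "transversal L k"
  shows "L \<inter> coord_space (org \<epsilon>) e k = {pnt L k \<epsilon>}"
proof -
  have k: "k \<le> N" using assms by (simp add: transversal_def)
  have "x \<in> coord_space (org \<epsilon>) e k \<longleftrightarrow> org \<epsilon> - x \<in> span (e ` {1..k})" for x
    unfolding coord_space_iff[OF k] span_e_iff[OF k] by (auto simp: inner_diff_left)
  then show ?thesis unfolding pnt_def
    using proj[OF assms, of "org \<epsilon>"] proj_unique[OF assms, of _ "org \<epsilon>"] by blast
qed

lemma Y_pnt:
  assumes "transversal L k"
  shows "i \<in> {k<..N} \<Longrightarrow> Y \<epsilon> (pnt L k \<epsilon>) i = 0"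
proof -
  assume i: "i \<in> {k<..N}"
  have "pnt L k \<epsilon> \<in> coord_space (org \<epsilon>) e k" using pnt_unique[OF assms, of \<epsilon>] by blast
  moreover have "k \<le> N" using assms by (simp add: transversal_def)
  ultimately show ?thesis using coord_space_iff[of k "pnt L k \<epsilon>" "org \<epsilon>"] i by blast
qed

lemma pnt_expand:
  assumes "transversal L k"
  shows "pnt L k \<epsilon> = - (\<Sum>i=Suc k..N. \<epsilon> ^ i *\<^sub>R proj L k (e i))"
proof -
  interpret l: linear "proj L k" by (rule proj_linear[OF assms])
  have "k < N" using assms unfolding transversal_def by blast
  then have "{1..N} = {1..k} \<union> {Suc k..N}" by auto
  then have "(\<Sum>i=1..N. \<epsilon> ^ i *\<^sub>R e i) = (\<Sum>i\<in>{1..k} \<union> {Suc k..N}. \<epsilon> ^ i *\<^sub>R e i)" by simp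
  also have "\<dots> = (\<Sum>i=1..k. \<epsilon> ^ i *\<^sub>R e i) + (\<Sum>i=Suc k..N. \<epsilon> ^ i *\<^sub>R e i)"
    by (rule sum.union_disjoint) auto
  finally have "pnt L k \<epsilon> = - (proj L k (\<Sum>i=1..k. \<epsilon> ^ i *\<^sub>R e i) + proj L k (\<Sum>i=Suc k..N. \<epsilon> ^ i *\<^sub>R e i))"
    unfolding pnt_def org_def l.neg by (simp only: l.add)
  moreover have "proj L k (\<Sum>i=1..k. \<epsilon> ^ i *\<^sub>R e i) = 0"
    by (rule proj_span[OF assms]) (intro span_sum span_scale span_base, auto)
  ultimately show ?thesis by (simp add: l.sum l.scale)
qed

text \<open>The projection annihilates the first \<open>k\<close> frame vectors, so the leading term
  of the projected origin comes from the vector \<open>e (Suc k)\<close>. The limit spans the line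
  in which \<open>L\<close> meets the span of the first \<open>k + 1\<close> frame vectors.\<close>

lemma pnt_tendsto:
  assumes "transversal L k"
  shows "((\<lambda>\<epsilon>. pnt L k \<epsilon> /\<^sub>R \<epsilon> ^ Suc k) \<longlongrightarrow> - proj L k (e (Suc k))) (at_right 0)"
proof -
  have k: "Suc k \<le> N" using assms unfolding transversal_def by simp
  have "((\<lambda>\<epsilon>::real. - (\<Sum>i=Suc k..N. \<epsilon> ^ (i - Suc k) *\<^sub>R proj L k (e i))) \<longlongrightarrow>
      - (\<Sum>i=Suc k..N. 0 ^ (i - Suc k) *\<^sub>R proj L k (e i))) (at_right 0)"
    by (intro tendsto_intros)
  moreover have "(\<Sum>i=Suc k..N. (0::real) ^ (i - Suc k) *\<^sub>R proj L k (e i)) = proj L k (e (Suc k))"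
    using k by (subst sum.atLeast_Suc_atMost) (auto intro!: sum.neutral)
  moreover have "\<forall>\<^sub>F \<epsilon> in at_right (0::real). - (\<Sum>i=Suc k..N. \<epsilon> ^ (i - Suc k) *\<^sub>R proj L k (e i)) = pnt L k \<epsilon> /\<^sub>R \<epsilon> ^ Suc k"
    using eventually_at_right_less[of "0::real"]
  proof eventually_elim
    case (elim \<epsilon>)
    have "inverse (\<epsilon> ^ Suc k) * \<epsilon> ^ i = \<epsilon> ^ (i - Suc k)" if "i \<in> {Suc k..N}" for i
      using that elim by (simp add: power_diff field_simps)
    then show ?case
      unfolding pnt_expand[OF assms] scaleR_minus_right scaleR_sum_right scaleR_scaleR
      by (intro arg_cong[of _ _ uminus] sum.cong) auto
  qed
  ultimately show ?thesis by (simp add: tendsto_cong)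
qed

end

section \<open>Points of flats near the origin\<close>

context frame
begin

lemma polar_pol: "polar x e P = polar_coord N (\<lambda>i. (P - x) \<bullet> e i)"
  using polar_eq_pol[of x e P] N N2 by simp

definition lead :: "'a set \<Rightarrow> nat \<Rightarrow> nat \<Rightarrow> real \<Rightarrow> real" where
  "lead L k i \<epsilon> = (pnt L k \<epsilon> /\<^sub>R \<epsilon> ^ Suc k) \<bullet> e i"

lemma Y_pnt_scaled:
  assumes "transversal L k" "i \<in> {1..N}" "0 < \<epsilon>"
  shows "Y \<epsilon> (pnt L k \<epsilon>) i = \<epsilon> ^ i + \<epsilon> ^ Suc k * lead L k i \<epsilon>"
proof -
  have "pnt L k \<epsilon> \<bullet> e i = \<epsilon> ^ Suc k * lead L k i \<epsilon>"
    using assms(3) unfolding lead_def inner_scaleR_left by (simp add: mult.assoc[symmetric] del: power_Suc)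
  then show ?thesis using assms by (simp add: Y_eq)
qed

lemma coeff_tendsto:
  assumes "transversal L k"
  shows "((\<lambda>\<epsilon>. lead L k i \<epsilon>) \<longlongrightarrow> - (proj L k (e (Suc k)) \<bullet> e i)) (at_right 0)"
  using tendsto_inner[OF pnt_tendsto[OF assms] tendsto_const[of "e i"]] unfolding lead_def inner_minus_left .

lemma Y_pnt_pos:
  assumes "transversal L k" "i \<in> {1..k}"
  shows "\<forall>\<^sub>F \<epsilon> in at_right 0. 0 < Y \<epsilon> (pnt L k \<epsilon>) i"
proof -
  have k: "k < N" using assms(1) unfolding transversal_def by blast
  have "((\<lambda>\<epsilon>. 1 + \<epsilon> ^ (Suc k - i) * lead L k i \<epsilon>) \<longlongrightarrow>
     1 + 0 ^ (Suc k - i) * - (proj L k (e (Suc k)) \<bullet> e i)) (at_right 0)"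
    by (intro tendsto_intros coeff_tendsto assms)
  then have "((\<lambda>\<epsilon>. 1 + \<epsilon> ^ (Suc k - i) * lead L k i \<epsilon>) \<longlongrightarrow> 1) (at_right 0)"
    using assms(2) by (simp add: Suc_diff_le)
  then have "\<forall>\<^sub>F \<epsilon> in at_right 0. 0 < 1 + \<epsilon> ^ (Suc k - i) * lead L k i \<epsilon>"
    by (rule order_tendstoD) simp
  then show ?thesis using eventually_at_right_less[of "0::real"]
  proof eventually_elim
    case (elim \<epsilon>)
    have "\<epsilon> ^ Suc k = \<epsilon> ^ i * \<epsilon> ^ (Suc k - i)" using assms(2) by (simp flip: power_add)
    then have "Y \<epsilon> (pnt L k \<epsilon>) i = \<epsilon> ^ i * (1 + \<epsilon> ^ (Suc k - i) * lead L k i \<epsilon>)"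
      using Y_pnt_scaled[OF assms(1), of i \<epsilon>] assms(2) k elim by (simp add: algebra_simps del: power_Suc)
    then show ?case using elim by simp
  qed
qed

lemma polar_pnt:
  assumes "transversal L k" "1 \<le> k" "\<And>i. i \<in> {1..k} \<Longrightarrow> 0 < Y \<epsilon> (pnt L k \<epsilon>) i"
  shows "k \<le> j \<Longrightarrow> polar (org \<epsilon>) e (pnt L k \<epsilon>) j = 0"
    and "k = 1 \<Longrightarrow> polar (org \<epsilon>) e (pnt L k \<epsilon>) 0 = Y \<epsilon> (pnt L k \<epsilon>) 1"
    and "2 \<le> k \<Longrightarrow> polar (org \<epsilon>) e (pnt L k \<epsilon>) (k - 1) = arctan (Y \<epsilon> (pnt L k \<epsilon>) k / Y \<epsilon> (pnt L k \<epsilon>) (k - 1))"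
proof -
  have k: "k < N" using assms(1) unfolding transversal_def by blast
  have z: "Y \<epsilon> (pnt L k \<epsilon>) i = 0" if "k < i" "i \<le> N" for i using Y_pnt[OF assms(1)] that by simp
  show "polar (org \<epsilon>) e (pnt L k \<epsilon>) j = 0" if "k \<le> j"
    unfolding polar_pol using N2 assms k z that by (intro polar_coord_eq_0[of N k]) auto
  show "polar (org \<epsilon>) e (pnt L k \<epsilon>) 0 = Y \<epsilon> (pnt L k \<epsilon>) 1" if "k = 1"
  proof -
    have "L2_set (Y \<epsilon> (pnt L k \<epsilon>)) {Suc 1..N} = 0" using z that by (intro L2_set_0') auto
    then have "(L2_set (Y \<epsilon> (pnt L k \<epsilon>)) {1..N})\<^sup>2 = (Y \<epsilon> (pnt L k \<epsilon>) 1)\<^sup>2"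
      using L2_set_Cons[of 1 N "Y \<epsilon> (pnt L k \<epsilon>)"] N2 by simp
    moreover have "0 < Y \<epsilon> (pnt L k \<epsilon>) 1" using assms(3)[of 1] that by simp
    ultimately have "L2_set (Y \<epsilon> (pnt L k \<epsilon>)) {1..N} = Y \<epsilon> (pnt L k \<epsilon>) 1"
      using L2_set_nonneg[of "Y \<epsilon> (pnt L k \<epsilon>)" "{1..N}"] by (simp add: power2_eq_iff_nonneg)
    then show ?thesis unfolding polar_pol by (simp add: polar_coord_def)
  qed
  show "polar (org \<epsilon>) e (pnt L k \<epsilon>) (k - 1) = arctan (Y \<epsilon> (pnt L k \<epsilon>) k / Y \<epsilon> (pnt L k \<epsilon>) (k - 1))" if "2 \<le> k"
    unfolding polar_pol using N2 assms k z that by (intro polar_coord_pred[of N k]) auto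
qed

text \<open>For both points all angles from \<open>k\<close> on vanish, so the coordinate with index
  \<open>k - 1\<close> decides: the radius for \<open>k = 1\<close>, otherwise the arctangent of the
  quotient of the coordinates \<open>k\<close> and \<open>k - 1\<close>. These are
  \<open>\<epsilon> ^ k * (1 + \<epsilon> * a \<epsilon>)\<close> and
  \<open>\<epsilon> ^ (k-1) * (1 + \<epsilon>\<^sup>2 * b \<epsilon>)\<close>, so that to first
  order only \<open>a\<close> counts; its limit is the negative of a coordinate of the projection,
  which reverses the inequality in \<open>less\<close>.\<close>

lemma polar_less_eventually:
  assumes L: "transversal L k" and L': "transversal L' k" and k: "1 \<le> k"
    and less: "proj L' k (e (Suc k)) \<bullet> e k < proj L k (e (Suc k)) \<bullet> e k"
  shows "\<forall>\<^sub>F \<epsilon> in at_right 0. polar_less (org \<epsilon>) e (pnt L k \<epsilon>) (pnt L' k \<epsilon>)"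
proof -
  have kN: "k < N" using L unfolding transversal_def by blast
  define a a' b b' where "a \<epsilon> = lead L k k \<epsilon>" and "a' \<epsilon> = lead L' k k \<epsilon>"
    and "b \<epsilon> = lead L k (k - 1) \<epsilon>" and "b' \<epsilon> = lead L' k (k - 1) \<epsilon>" for \<epsilon>
  note t = coeff_tendsto[OF L, of k, folded a_def] coeff_tendsto[OF L', of k, folded a'_def]
    coeff_tendsto[OF L, of "k - 1", folded b_def] coeff_tendsto[OF L', of "k - 1", folded b'_def]
  define G where "G \<epsilon> = (a' \<epsilon> - a \<epsilon>) + \<epsilon> * (b \<epsilon> - b' \<epsilon>) + \<epsilon>\<^sup>2 * (a' \<epsilon> * b \<epsilon> - a \<epsilon> * b' \<epsilon>)" for \<epsilon>
  let ?A = "- (proj L k (e (Suc k)) \<bullet> e k)" and ?A' = "- (proj L' k (e (Suc k)) \<bullet> e k)"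
  let ?B = "- (proj L k (e (Suc k)) \<bullet> e (k - 1))" and ?B' = "- (proj L' k (e (Suc k)) \<bullet> e (k - 1))"
  have "(G \<longlongrightarrow> (?A' - ?A) + 0 * (?B - ?B') + 0\<^sup>2 * (?A' * ?B - ?A * ?B')) (at_right 0)"
    unfolding G_def by (intro tendsto_intros t)
  then have "\<forall>\<^sub>F \<epsilon> in at_right 0. 0 < G \<epsilon>"
    by (rule order_tendstoD) (use less in simp)
  moreover have "((\<lambda>\<epsilon>. a' \<epsilon> - a \<epsilon>) \<longlongrightarrow> ?A' - ?A) (at_right 0)" by (intro tendsto_intros t)
  then have "\<forall>\<^sub>F \<epsilon> in at_right 0. 0 < a' \<epsilon> - a \<epsilon>" by (rule order_tendstoD) (use less in simp)
  moreover have "\<forall>\<^sub>F \<epsilon> in at_right 0. \<forall>i\<in>{1..k}. 0 < Y \<epsilon> (pnt L k \<epsilon>) i \<and> 0 < Y \<epsilon> (pnt L' k \<epsilon>) i"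
    using Y_pnt_pos[OF L] Y_pnt_pos[OF L'] by (intro eventually_ball_finite ballI eventually_conj) auto
  ultimately show ?thesis using eventually_at_right_less[of "0::real"]
  proof eventually_elim
    case (elim \<epsilon>)
    note p = polar_pnt[OF L k, of \<epsilon>] and p' = polar_pnt[OF L' k, of \<epsilon>]
    have pos: "\<And>i. i \<in> {1..k} \<Longrightarrow> 0 < Y \<epsilon> (pnt L k \<epsilon>) i" "\<And>i. i \<in> {1..k} \<Longrightarrow> 0 < Y \<epsilon> (pnt L' k \<epsilon>) i"
      using elim by blast+
    have yk: "Y \<epsilon> (pnt L k \<epsilon>) k = \<epsilon> ^ k * (1 + \<epsilon> * a \<epsilon>)" "Y \<epsilon> (pnt L' k \<epsilon>) k = \<epsilon> ^ k * (1 + \<epsilon> * a' \<epsilon>)"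
      using Y_pnt_scaled[OF L, of k \<epsilon>] Y_pnt_scaled[OF L', of k \<epsilon>] k kN elim
      by (simp_all add: a_def a'_def distrib_left)
    have "polar (org \<epsilon>) e (pnt L k \<epsilon>) (k - 1) < polar (org \<epsilon>) e (pnt L' k \<epsilon>) (k - 1)"
    proof (cases "k = 1")
      case True
      have "Y \<epsilon> (pnt L k \<epsilon>) k < Y \<epsilon> (pnt L' k \<epsilon>) k" unfolding yk using elim by simp
      then show ?thesis using p(2) p'(2) pos True by simp
    next
      case False
      then have k2: "2 \<le> k" using k by simp
      then have "\<epsilon> ^ Suc k = \<epsilon> ^ (k - 1) * \<epsilon>\<^sup>2" by (simp flip: power_add)
      moreover have "k - 1 \<in> {1..N}" using k2 kN by auto
      ultimately have yk1: "Y \<epsilon> (pnt L k \<epsilon>) (k-1) = \<epsilon> ^ (k-1) * (1 + \<epsilon>\<^sup>2 * b \<epsilon>)" "Y \<epsilon> (pnt L' k \<epsilon>) (k-1) = \<epsilon> ^ (k-1) * (1 + \<epsilon>\<^sup>2 * b' \<epsilon>)"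
        using Y_pnt_scaled[OF L, of "k-1" \<epsilon>] Y_pnt_scaled[OF L', of "k-1" \<epsilon>] k2 kN elim
        by (simp_all add: b_def b'_def distrib_left mult.assoc del: power_Suc)
      have "Y \<epsilon> (pnt L' k \<epsilon>) k * Y \<epsilon> (pnt L k \<epsilon>) (k-1) - Y \<epsilon> (pnt L k \<epsilon>) k * Y \<epsilon> (pnt L' k \<epsilon>) (k-1) =
        \<epsilon> ^ k * \<epsilon> ^ (k-1) * (\<epsilon> * G \<epsilon>)"
        unfolding yk yk1 G_def by (simp add: algebra_simps power2_eq_square)
      moreover have "0 < \<epsilon> ^ k * \<epsilon> ^ (k-1) * (\<epsilon> * G \<epsilon>)" using elim by simp
      ultimately have "Y \<epsilon> (pnt L k \<epsilon>) k * Y \<epsilon> (pnt L' k \<epsilon>) (k-1) < Y \<epsilon> (pnt L' k \<epsilon>) k * Y \<epsilon> (pnt L k \<epsilon>) (k-1)" by simp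
      then have "Y \<epsilon> (pnt L k \<epsilon>) k / Y \<epsilon> (pnt L k \<epsilon>) (k-1) < Y \<epsilon> (pnt L' k \<epsilon>) k / Y \<epsilon> (pnt L' k \<epsilon>) (k-1)"
        using pos(1)[of "k-1"] pos(2)[of "k-1"] k2 by (simp add: divide_simps mult.commute)
      then show ?thesis using p(3) p'(3) pos k2 by (simp add: arctan_less_iff)
    qed
    moreover have "polar (org \<epsilon>) e (pnt L k \<epsilon>) m = polar (org \<epsilon>) e (pnt L' k \<epsilon>) m" if "m \<in> {k - 1<..<DIM('a)}" for m
      using p(1)[of m] p'(1)[of m] pos that by auto
    ultimately show ?case unfolding polar_less_def using kN N by (intro exI[of _ "k - 1"]) auto
  qed
qed

lemma norm_pnt_le:
  assumes L: "transversal L k" and C: "0 \<le> C" "\<And>x. norm (proj L k x) \<le> C * norm x" and \<epsilon>: "0 < \<epsilon>" "\<epsilon> \<le> 1 / 2"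
  shows "norm (pnt L k \<epsilon>) \<le> 2 * C * \<epsilon> ^ Suc k"
proof -
  have ne: "norm (e i) = 1" if "i \<in> {1..N}" for i using orthD[OF that that] by (simp add: norm_eq_sqrt_inner)
  have "norm (pnt L k \<epsilon>) \<le> (\<Sum>i=Suc k..N. norm (\<epsilon> ^ i *\<^sub>R proj L k (e i)))"
    unfolding pnt_expand[OF L] norm_minus_cancel by (rule norm_sum)
  also have "\<dots> \<le> (\<Sum>i=Suc k..N. C * \<epsilon> ^ i)"
  proof (rule sum_mono)
    fix i assume "i \<in> {Suc k..N}"
    then show "norm (\<epsilon> ^ i *\<^sub>R proj L k (e i)) \<le> C * \<epsilon> ^ i"
      using C(2)[of "e i"] ne[of i] \<epsilon> by (simp add: mult.commute)
  qed
  also have "\<dots> = C * (\<Sum>i=Suc k..N. \<epsilon> ^ i)" by (simp add: sum_distrib_left)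
  also have "\<dots> \<le> C * (2 * \<epsilon> ^ Suc k)" using sum_power_le[OF \<epsilon>] C(1) by (intro mult_left_mono)
  finally show ?thesis by simp
qed

text \<open>The point is sought as \<open>q\<close> plus \<open>t\<close> times
  \<open>proj L k u\<close>, where \<open>q\<close> is the point of V_k on \<open>L\<close> and
  \<open>u\<close> carries the coordinates of \<open>c\<close> beyond \<open>k\<close>. Both terms
  are small against \<open>\<epsilon> ^ k\<close>: the first is of order
  \<open>\<epsilon> ^ Suc k\<close>, the second inherits the small tail of \<open>c\<close>. The
  bound \<open>1 / (100 * C)\<close> keeps the deviation from the centre 0, in the coordinates up to
  \<open>k\<close>, at a few percent of \<open>\<epsilon> ^ k\<close>.\<close>

lemma cone_meets_flat:
  assumes L: "transversal L k" and C: "1 \<le> C" "\<And>x. norm (proj L k x) \<le> C * norm x"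
    and \<epsilon>: "0 < \<epsilon>" "\<epsilon> \<le> 1 / (100 * C)" and k: "1 \<le> k"
    and c: "c k = 1" "L2_set c {Suc k..N} \<le> 3 * \<epsilon>"
  shows "tail_space k c \<inter> L \<subseteq> {0}"
    and "\<exists>p\<in>L. \<exists>t>0. (\<forall>l\<in>{k..N}. Y \<epsilon> p l = t * c l) \<and>
           (\<forall>j\<in>{1..<k}. 0 < Y \<epsilon> p j \<and> L2_set (Y \<epsilon> p) {Suc j..N} \<le> 3 * \<epsilon> * Y \<epsilon> p j)"
proof -
  have kN: "k < N" using L unfolding transversal_def by blast
  have "C * \<epsilon> \<le> 1 / 100" using \<epsilon>(2) C(1) by (simp add: field_simps)
  moreover have "\<epsilon> \<le> C * \<epsilon>" using C(1) \<epsilon>(1) by simp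
  ultimately have Ce: "C * \<epsilon> \<le> 1 / 100" and e1: "\<epsilon> \<le> 1 / 100" by auto
  interpret l: linear "proj L k" by (rule proj_linear[OF L])
  define u where "u = (\<Sum>i=Suc k..N. c i *\<^sub>R e i)"
  have ue: "u \<bullet> e j = (if j \<in> {Suc k..N} then c j else 0)" if "j \<in> {1..N}" for j
    unfolding u_def using that by (intro sum_inner) auto
  have "norm u = L2_set c {Suc k..N}"
    unfolding norm_L2 L2_set_def
    by (rule arg_cong[of _ _ sqrt], rule sum.mono_neutral_cong_right) (use ue kN in auto)
  then have nu: "norm u \<le> 3 * \<epsilon>" using c by simp
  have "norm (proj L k u) \<le> C * (3 * \<epsilon>)"
    using C(2)[of u] nu C(1) by (meson mult_left_mono order_trans zero_le_one)
  then have npu: "norm (proj L k u) \<le> 3 / 100" using Ce by simp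
  define \<alpha> where "\<alpha> = proj L k u \<bullet> e k"
  have \<alpha>: "\<bar>\<alpha>\<bar> \<le> 3 / 100" using norm_inner_e[of k "proj L k u"] npu k kN by (simp add: \<alpha>_def)
  have pu0: "(u - proj L k u) \<bullet> e l = 0" if "l \<in> {k<..N}" for l
    using span_e_iff[of k "u - proj L k u"] proj(2)[OF L, of u] that kN by simp
  show "tail_space k c \<inter> L \<subseteq> {0}"
  proof
    fix z assume z: "z \<in> tail_space k c \<inter> L"
    then obtain t where t: "\<forall>l\<in>{k..N}. z \<bullet> e l = t * c l" by (auto simp: tail_space_def)
    have "z - t *\<^sub>R u \<in> span (e ` {1..k})"
      using span_e_iff[of k "z - t *\<^sub>R u"] t ue kN by (auto simp: inner_diff_left)
    then have "proj L k (z - t *\<^sub>R u) = 0" by (rule proj_span[OF L])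
    moreover have "proj L k z = z" using z by (intro proj_id[OF L]) auto
    ultimately have zt: "z = t *\<^sub>R proj L k u" by (simp add: l.diff l.scale)
    then have "z \<bullet> e k = t * \<alpha>" unfolding \<alpha>_def by (metis inner_scaleR_left)
    then have "t = t * \<alpha>" using t c k kN by simp
    then have "t = 0" using \<alpha> by auto
    then show "z \<in> {0}" using zt by simp
  qed
  define q where "q = pnt L k \<epsilon>"
  define E where "E = \<epsilon> ^ k"
  have E: "0 < E" using \<epsilon> by (simp add: E_def)
  have "norm q \<le> 2 * C * \<epsilon> ^ Suc k"
    unfolding q_def using C e1 \<epsilon> by (intro norm_pnt_le[OF L]) auto
  also have "\<dots> = 2 * (C * \<epsilon>) * E" by (simp add: E_def)
  also have "\<dots> \<le> 2 * (1 / 100) * E" using Ce E by (intro mult_right_mono mult_left_mono) auto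
  finally have nq: "norm q \<le> 2 / 100 * E" by simp
  have qe: "\<bar>q \<bullet> e l\<bar> \<le> 2 / 100 * E" if "l \<in> {1..N}" for l
    using norm_inner_e[OF that, of q] nq by simp
  \<comment> \<open>The coordinate \<open>k\<close> of the point, relative to the origin, is
    \<open>E + q \<bullet> e k + t * \<alpha>\<close>. It has to equal \<open>t\<close>, because
    \<open>c k = 1\<close>.\<close>
  define t where "t = (E + q \<bullet> e k) / (1 - \<alpha>)"
  have ta: "t * (1 - \<alpha>) = E + q \<bullet> e k" using \<alpha> by (simp add: t_def)
  have qk: "\<bar>q \<bullet> e k\<bar> \<le> 2 / 100 * E" using qe k kN by simp
  have t0: "0 < t" unfolding t_def using qk \<alpha> E by (intro divide_pos_pos) auto
  have "t * (97 / 100) \<le> t * (1 - \<alpha>)" using t0 \<alpha> by (intro mult_left_mono) auto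
  then have t1: "t \<le> 106 / 100 * E" using ta qk E by simp
  define p where "p = q + t *\<^sub>R proj L k u"
  have pL: "p \<in> L"
    using L pnt_unique[OF L, of \<epsilon>] proj(1)[OF L, of u] unfolding p_def q_def transversal_def
    by (blast intro: subspace_add subspace_scale)
  have Yp: "Y \<epsilon> p l = Y \<epsilon> q l + t * (proj L k u \<bullet> e l)" for l
    by (simp add: p_def inner_diff_left inner_add_left)
  have high: "Y \<epsilon> p l = t * c l" if l: "l \<in> {k..N}" for l
  proof (cases "l = k")
    case True
    then show ?thesis using Yp[of k] Y_eq[of k q \<epsilon>] ta c k kN by (simp add: \<alpha>_def E_def algebra_simps)
  next
    case False
    then have l': "l \<in> {k<..N}" using l by auto
    have "proj L k u \<bullet> e l = c l" using pu0[OF l'] ue[of l] l' by (simp add: inner_diff_left)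
    then show ?thesis using Yp[of l] Y_pnt[OF L l', of \<epsilon>] by (simp add: q_def)
  qed
  have close: "\<bar>Y \<epsilon> p l - \<epsilon> ^ l\<bar> \<le> 6 / 100 * E" if l: "l \<in> {1..k}" for l
  proof -
    have lN: "l \<in> {1..N}" using l kN by auto
    have "\<bar>t * (proj L k u \<bullet> e l)\<bar> \<le> t * (3 / 100)"
      using norm_inner_e[OF lN, of "proj L k u"] npu t0 by (simp add: abs_mult)
    also have "\<dots> \<le> 4 / 100 * E" using t1 E by simp
    finally show ?thesis using Yp[of l] Y_eq[OF lN, of q \<epsilon>] qe[OF lN] by linarith
  qed
  have low: "99 / 100 * \<epsilon> ^ j \<le> Y \<epsilon> p j" if j: "j \<in> {1..<k}" for j
  proof -
    have "E \<le> \<epsilon> ^ Suc j" unfolding E_def using j \<epsilon> e1 by (intro power_decreasing) auto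
    also have "\<dots> \<le> 1 / 100 * \<epsilon> ^ j" using e1 \<epsilon> by (simp add: mult_right_mono)
    finally have "E \<le> 1 / 100 * \<epsilon> ^ j" .
    moreover have "\<bar>Y \<epsilon> p j - \<epsilon> ^ j\<bar> \<le> 6 / 100 * E" using close[of j] j by simp
    ultimately show ?thesis using E by linarith
  qed
  have "0 < Y \<epsilon> p j \<and> L2_set (Y \<epsilon> p) {Suc j..N} \<le> 3 * \<epsilon> * Y \<epsilon> p j" if j: "j \<in> {1..<k}" for j
  proof
    have ej: "0 < \<epsilon> ^ j" using \<epsilon> by simp
    then show "0 < Y \<epsilon> p j" using low[OF j] by (smt (verit) mult_pos_pos divide_pos_pos)
    have up: "\<bar>Y \<epsilon> p l\<bar> \<le> 106 / 100 * \<epsilon> ^ l" if "l \<in> {Suc j..k}" for l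
    proof -
      have "E \<le> \<epsilon> ^ l" unfolding E_def using that \<epsilon> e1 by (intro power_decreasing) auto
      moreover have "0 < \<epsilon> ^ l" using \<epsilon> by simp
      moreover have "\<bar>Y \<epsilon> p l - \<epsilon> ^ l\<bar> \<le> 6 / 100 * E" using close[of l] that j by simp
      ultimately show ?thesis using E by linarith
    qed
    have "{Suc j..N} = {Suc j..k} \<union> {Suc k..N}" using j kN by auto
    then have "L2_set (Y \<epsilon> p) {Suc j..N} \<le> (\<Sum>l=Suc j..k. \<bar>Y \<epsilon> p l\<bar>) + L2_set (Y \<epsilon> p) {Suc k..N}"
      using L2_set_Un_le[of "{Suc j..k}" "{Suc k..N}" "Y \<epsilon> p"] by auto
    also have "L2_set (Y \<epsilon> p) {Suc k..N} = t * L2_set c {Suc k..N}"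
      using t0 high by (subst L2_set_right_distrib) (auto intro!: L2_set_cong)
    also have "\<dots> \<le> (106 / 100 * E) * (3 * \<epsilon>)"
      using t0 t1 c \<epsilon> E by (intro mult_mono) auto
    also have "\<dots> \<le> (106 / 100 * E) * (3 / 100)" using e1 E by (intro mult_left_mono) auto
    also have "(\<Sum>l=Suc j..k. \<bar>Y \<epsilon> p l\<bar>) \<le> (\<Sum>l=Suc j..k. 106 / 100 * \<epsilon> ^ l)"
      by (rule sum_mono) (rule up)
    also have "\<dots> = 106 / 100 * (\<Sum>l=Suc j..k. \<epsilon> ^ l)" by (simp add: sum_distrib_left)
    also have "\<dots> \<le> 106 / 100 * (2 * \<epsilon> ^ Suc j)"
      using \<epsilon> e1 by (intro mult_left_mono sum_power_le) auto
    finally have 1: "L2_set (Y \<epsilon> p) {Suc j..N} \<le> 106 / 100 * (2 * \<epsilon> ^ Suc j) + 106 / 100 * E * (3 / 100)" by simp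
    have "E \<le> \<epsilon> ^ Suc j" unfolding E_def using j \<epsilon> e1 by (intro power_decreasing) auto
    then have 2: "L2_set (Y \<epsilon> p) {Suc j..N} \<le> 216 / 100 * \<epsilon> ^ Suc j" using 1 E by simp
    \<comment> \<open>The tail is at most 2.16 times \<open>\<epsilon> ^ Suc j\<close>, while the
      cone admits 2.97 times this power. The slope 3 \<epsilon>, in place of the 2 \<epsilon> that
      bounds a geometric tail, is what leaves this room for errors.\<close>
    have "3 * \<epsilon> * (99 / 100 * \<epsilon> ^ j) \<le> 3 * \<epsilon> * Y \<epsilon> p j"
      using low[OF j] \<epsilon> by (intro mult_left_mono) auto
    moreover have "3 * \<epsilon> * (99 / 100 * \<epsilon> ^ j) = 297 / 100 * \<epsilon> ^ Suc j" by simp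
    moreover have "0 < \<epsilon> ^ Suc j" using \<epsilon> by simp
    ultimately show "L2_set (Y \<epsilon> p) {Suc j..N} \<le> 3 * \<epsilon> * Y \<epsilon> p j" using 2 by linarith
  qed
  then show "\<exists>p\<in>L. \<exists>t>0. (\<forall>l\<in>{k..N}. Y \<epsilon> p l = t * c l) \<and>
           (\<forall>j\<in>{1..<k}. 0 < Y \<epsilon> p j \<and> L2_set (Y \<epsilon> p) {Suc j..N} \<le> 3 * \<epsilon> * Y \<epsilon> p j)"
    using pL t0 high by blast
qed

end

section \<open>Generic polar coordinates\<close>

context frame
begin

abbreviation sector :: "real \<Rightarrow> 'a set" where
  "sector \<epsilon> \<equiv> polar_sector (org \<epsilon>) e (arctan (3 * \<epsilon>))"

lemma arctan_range: "0 < \<epsilon> \<Longrightarrow> arctan (3 * \<epsilon>) \<in> {0<..<pi/2}"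
  using arctan_ubound[of "3 * \<epsilon>"] by (simp add: zero_less_arctan_iff)

lemma sector_eq:
  assumes "0 < \<epsilon>"
  shows "x \<in> sector \<epsilon> \<longleftrightarrow> (\<forall>i\<in>{1..N}. 0 < Y \<epsilon> x i) \<and> (\<forall>i\<in>{1..<N}. L2_set (Y \<epsilon> x) {Suc i..N} < 3 * \<epsilon> * Y \<epsilon> x i)"
proof -
  have "x \<in> sector \<epsilon> \<longleftrightarrow> (\<forall>i\<in>{1..<N}. polar_coord N (Y \<epsilon> x) i \<in> {0<..<arctan (3 * \<epsilon>)}) \<and> 0 < polar_coord N (Y \<epsilon> x) 0"
    unfolding polar_sector_def polar_pol N by blast
  also have "\<dots> \<longleftrightarrow> (\<forall>i\<in>{1..N}. 0 < Y \<epsilon> x i) \<and> (\<forall>i\<in>{1..<N}. L2_set (Y \<epsilon> x) {Suc i..N} < tan (arctan (3 * \<epsilon>)) * Y \<epsilon> x i)"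
    using arctan_range[OF assms] by (intro sector_iff N2) auto
  finally show ?thesis by (simp only: tan_arctan)
qed

lemma zero_sector:
  assumes "0 < \<epsilon>" "\<epsilon> \<le> 1 / 2"
  shows "0 \<in> sector \<epsilon>"
proof -
  have Y0: "Y \<epsilon> 0 i = \<epsilon> ^ i" if "i \<in> {1..N}" for i using Y_eq[OF that, of 0 \<epsilon>] by simp
  have "L2_set (Y \<epsilon> 0) {Suc i..N} < 3 * \<epsilon> * Y \<epsilon> 0 i" if i: "i \<in> {1..<N}" for i
  proof -
    have "L2_set (Y \<epsilon> 0) {Suc i..N} = L2_set (\<lambda>l. \<epsilon> ^ l) {Suc i..N}"
      using Y0 by (intro L2_set_cong) auto
    also have "\<dots> \<le> (\<Sum>l=Suc i..N. \<epsilon> ^ l)" using assms by (intro L2_set_le_sum) auto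
    also have "\<dots> \<le> 2 * \<epsilon> ^ Suc i" by (rule sum_power_le[OF assms])
    also have "\<dots> < 3 * \<epsilon> * \<epsilon> ^ i" using assms by simp
    finally show ?thesis using Y0[of i] i by simp
  qed
  moreover have "0 < Y \<epsilon> 0 i" if "i \<in> {1..N}" for i using Y0[OF that] assms by simp
  ultimately show ?thesis unfolding sector_eq[OF assms(1)] by blast
qed

lemma Y_add: "Y \<epsilon> (x + y) i = Y \<epsilon> x i + y \<bullet> e i"
  by (simp add: inner_diff_left inner_add_left)

lemma ray_in_sector:
  assumes "0 < \<epsilon>" "\<epsilon> \<le> 1 / 2"
  shows "\<forall>\<^sub>F t in at_right 0. t *\<^sub>R x \<in> sector \<epsilon>"
proof -
  have t: "((\<lambda>t. Y \<epsilon> (t *\<^sub>R x) i) \<longlongrightarrow> Y \<epsilon> (0 *\<^sub>R x) i) (at_right 0)" for i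
    by (intro tendsto_intros)
  have tL: "((\<lambda>t. L2_set (Y \<epsilon> (t *\<^sub>R x)) A) \<longlongrightarrow> L2_set (Y \<epsilon> (0 *\<^sub>R x)) A) (at_right 0)" for A
    unfolding L2_set_def by (intro tendsto_intros)
  have z: "\<And>i. i \<in> {1..N} \<Longrightarrow> 0 < Y \<epsilon> (0 *\<^sub>R x) i"
    "\<And>i. i \<in> {1..<N} \<Longrightarrow> L2_set (Y \<epsilon> (0 *\<^sub>R x)) {Suc i..N} < 3 * \<epsilon> * Y \<epsilon> (0 *\<^sub>R x) i"
    using zero_sector[OF assms] unfolding sector_eq[OF assms(1)] scaleR_zero_left by blast+
  have "\<forall>\<^sub>F t in at_right 0. \<forall>i\<in>{1..N}. 0 < Y \<epsilon> (t *\<^sub>R x) i"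
    using z(1) by (intro eventually_ball_finite ballI order_tendstoD(1)[OF t]) auto
  moreover have "\<forall>\<^sub>F t in at_right 0. \<forall>i\<in>{1..<N}. L2_set (Y \<epsilon> (t *\<^sub>R x)) {Suc i..N} < 3 * \<epsilon> * Y \<epsilon> (t *\<^sub>R x) i"
  proof (intro eventually_ball_finite ballI)
    fix i assume i: "i \<in> {1..<N}"
    have "((\<lambda>t. 3 * \<epsilon> * Y \<epsilon> (t *\<^sub>R x) i - L2_set (Y \<epsilon> (t *\<^sub>R x)) {Suc i..N}) \<longlongrightarrow>
       3 * \<epsilon> * Y \<epsilon> (0 *\<^sub>R x) i - L2_set (Y \<epsilon> (0 *\<^sub>R x)) {Suc i..N}) (at_right 0)"
      by (intro tendsto_diff tendsto_mult tendsto_const t tL)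
    then have "\<forall>\<^sub>F t in at_right 0. 0 < 3 * \<epsilon> * Y \<epsilon> (t *\<^sub>R x) i - L2_set (Y \<epsilon> (t *\<^sub>R x)) {Suc i..N}"
      by (rule order_tendstoD) (use z(2)[OF i] in simp)
    then show "\<forall>\<^sub>F t in at_right 0. L2_set (Y \<epsilon> (t *\<^sub>R x)) {Suc i..N} < 3 * \<epsilon> * Y \<epsilon> (t *\<^sub>R x) i"
      by (rule eventually_mono) simp
  qed auto
  ultimately show ?thesis
    by eventually_elim (simp only: sector_eq[OF assms(1)] simp_thms)
qed

text \<open>The weak inequalities are closed conditions. Conversely, adding a small positive
  multiple of the vector from the origin to the centre 0, which satisfies the strict inequalities,
  makes weak inequalities strict.\<close>

lemma closure_sector:
  assumes "0 < \<epsilon>" "\<epsilon> \<le> 1 / 2"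
  shows "x \<in> closure (sector \<epsilon>) \<longleftrightarrow>
    (\<forall>i\<in>{1..N}. 0 \<le> Y \<epsilon> x i) \<and> (\<forall>i\<in>{1..<N}. L2_set (Y \<epsilon> x) {Suc i..N} \<le> 3 * \<epsilon> * Y \<epsilon> x i)"
proof
  define K where "K = (\<Inter>i\<in>{1..N}. {x. 0 \<le> Y \<epsilon> x i}) \<inter> (\<Inter>i\<in>{1..<N}. {x. L2_set (Y \<epsilon> x) {Suc i..N} \<le> 3 * \<epsilon> * Y \<epsilon> x i})"
  have "closed {x. L2_set (Y \<epsilon> x) A \<le> 3 * \<epsilon> * Y \<epsilon> x i}" for A i
    unfolding L2_set_def by (intro closed_Collect_le continuous_intros)
  moreover have "closed {x. 0 \<le> Y \<epsilon> x i}" for i by (intro closed_Collect_le continuous_intros)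
  ultimately have "closed K" unfolding K_def by (intro closed_Int closed_INT ballI) auto
  moreover have "sector \<epsilon> \<subseteq> K"
  proof
    fix z assume "z \<in> sector \<epsilon>"
    then show "z \<in> K" unfolding sector_eq[OF assms(1)] K_def by (auto intro: less_imp_le)
  qed
  ultimately have "closure (sector \<epsilon>) \<subseteq> K" by (rule closure_minimal[rotated])
  moreover assume "x \<in> closure (sector \<epsilon>)"
  ultimately show "(\<forall>i\<in>{1..N}. 0 \<le> Y \<epsilon> x i) \<and> (\<forall>i\<in>{1..<N}. L2_set (Y \<epsilon> x) {Suc i..N} \<le> 3 * \<epsilon> * Y \<epsilon> x i)"
    unfolding K_def by blast
next
  assume x: "(\<forall>i\<in>{1..N}. 0 \<le> Y \<epsilon> x i) \<and> (\<forall>i\<in>{1..<N}. L2_set (Y \<epsilon> x) {Suc i..N} \<le> 3 * \<epsilon> * Y \<epsilon> x i)"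
  have z: "\<And>i. i \<in> {1..N} \<Longrightarrow> 0 < Y \<epsilon> 0 i"
    "\<And>i. i \<in> {1..<N} \<Longrightarrow> L2_set (Y \<epsilon> 0) {Suc i..N} < 3 * \<epsilon> * Y \<epsilon> 0 i"
    using zero_sector[OF assms] unfolding sector_eq[OF assms(1)] by blast+
  define g where "g t = x + t *\<^sub>R (0 - org \<epsilon>)" for t :: real
  have Yg: "Y \<epsilon> (g t) i = Y \<epsilon> x i + t * Y \<epsilon> 0 i" for t i
    unfolding g_def Y_add by simp
  have in_sec: "g t \<in> sector \<epsilon>" if t: "0 < t" for t
    unfolding sector_eq[OF assms(1)]
  proof (intro conjI ballI)
    fix i assume i: "i \<in> {1..N}"
    have "0 \<le> Y \<epsilon> x i" using x i by blast
    moreover have "0 < t * Y \<epsilon> 0 i" using z(1)[OF i] t by (rule mult_pos_pos[rotated])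
    ultimately show "0 < Y \<epsilon> (g t) i" unfolding Yg by simp
  next
    fix i assume i: "i \<in> {1..<N}"
    have "L2_set (Y \<epsilon> (g t)) {Suc i..N} \<le> L2_set (Y \<epsilon> x) {Suc i..N} + L2_set (\<lambda>i. t * Y \<epsilon> 0 i) {Suc i..N}"
      unfolding Yg by (rule L2_set_triangle_ineq)
    also have "L2_set (\<lambda>i. t * Y \<epsilon> 0 i) {Suc i..N} = t * L2_set (Y \<epsilon> 0) {Suc i..N}"
      using t by (simp add: L2_set_right_distrib)
    also have "L2_set (Y \<epsilon> x) {Suc i..N} + t * L2_set (Y \<epsilon> 0) {Suc i..N} < 3 * \<epsilon> * Y \<epsilon> x i + t * (3 * \<epsilon> * Y \<epsilon> 0 i)"
      using x i t z(2)[OF i] by (intro add_le_less_mono mult_strict_left_mono) auto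
    also have "3 * \<epsilon> * a + t * (3 * \<epsilon> * b) = 3 * \<epsilon> * (a + t * b)" for a b by (simp add: distrib_left)
    also note Yg[symmetric]
    finally show "L2_set (Y \<epsilon> (g t)) {Suc i..N} < 3 * \<epsilon> * Y \<epsilon> (g t) i" .
  qed
  have "(g \<longlongrightarrow> x + 0 *\<^sub>R (0 - org \<epsilon>)) (at_right 0)" unfolding g_def by (intro tendsto_intros)
  then have lim: "(g \<longlongrightarrow> x) (at_right 0)" by simp
  have ev: "\<forall>\<^sub>F t in at_right 0. g t \<in> closure (sector \<epsilon>)"
    using eventually_at_right_less[of "0::real"]
    by eventually_elim (use in_sec closure_subset in blast)
  show "x \<in> closure (sector \<epsilon>)"
    by (rule Lim_in_closed_set[OF closed_closure ev _ lim]) simp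
qed

text \<open>In the closed cone the coordinate \<open>i\<close> bounds its own tail, so if it
  vanished then all later ones would vanish too, and the point would lie in V_(i-1).\<close>

lemma closure_sector_point:
  assumes \<epsilon>: "0 < \<epsilon>" "\<epsilon> \<le> 1 / 2" and i: "i \<in> {1..N}"
    and P: "P \<in> closure (sector \<epsilon>)" "P \<notin> coord_space (org \<epsilon>) e (i - 1)"
  shows "0 < Y \<epsilon> P i"
proof (rule ccontr)
  have c: "\<And>j. j \<in> {1..N} \<Longrightarrow> 0 \<le> Y \<epsilon> P j" "\<And>j. j \<in> {1..<N} \<Longrightarrow> L2_set (Y \<epsilon> P) {Suc j..N} \<le> 3 * \<epsilon> * Y \<epsilon> P j"
    using P(1) unfolding closure_sector[OF \<epsilon>] by blast+
  assume "\<not> 0 < Y \<epsilon> P i"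
  then have z: "Y \<epsilon> P i = 0" using c(1)[OF i] by simp
  have "Y \<epsilon> P l = 0" if l: "l \<in> {i - 1<..N}" for l
  proof (cases "l = i")
    case False
    then have i': "i \<in> {1..<N}" using l i by auto
    have "L2_set (Y \<epsilon> P) {Suc i..N} \<le> 0" using c(2)[OF i'] z by simp
    then have "L2_set (Y \<epsilon> P) {Suc i..N} = 0" using L2_set_nonneg[of "Y \<epsilon> P" "{Suc i..N}"] by linarith
    then have "\<forall>l\<in>{Suc i..N}. Y \<epsilon> P l = 0" by (subst (asm) L2_set_eq_0_iff) auto
    then show ?thesis using l False by auto
  qed (use z in simp)
  moreover have "i \<le> N" using i by simp
  then have "i - 1 \<le> N" by linarith
  ultimately show False using P(2) coord_space_iff[of "i - 1" P "org \<epsilon>"] by blast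
qed

lemma half_subspace_super:
  assumes i: "i \<in> {1..N}" and P: "P \<in> half_subspace (org \<epsilon>) e i th" and x: "0 < c" "\<And>l. l \<in> {i..N} \<Longrightarrow> Y \<epsilon> x l = c * Y \<epsilon> P l"
  shows "x \<in> half_subspace (org \<epsilon>) e i th"
proof -
  have PP: "P \<notin> coord_space (org \<epsilon>) e (i - 1)" "\<And>j. j \<in> {i..<N} \<Longrightarrow> polar (org \<epsilon>) e P j = th j"
    using P unfolding half_subspace_def N by blast+
  have i1: "i - 1 \<le> N" "{i - 1<..N} = {i..N}" using i by auto
  obtain l where l: "l \<in> {i..N}" "Y \<epsilon> P l \<noteq> 0"
    using PP(1) unfolding coord_space_iff[OF i1(1)] i1(2) by blast
  then have "Y \<epsilon> x l \<noteq> 0" using x by simp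
  then have "x \<notin> coord_space (org \<epsilon>) e (i - 1)" unfolding coord_space_iff[OF i1(1)] i1(2) using l by blast
  moreover have "polar (org \<epsilon>) e x j = th j" if j: "j \<in> {i..<N}" for j
  proof -
    have "polar_coord N (Y \<epsilon> x) j = polar_coord N (Y \<epsilon> P) j" using i x j by (intro polar_coord_scale[of c i]) auto
    then show ?thesis using PP(2)[OF j] unfolding polar_pol by simp
  qed
  ultimately show ?thesis unfolding half_subspace_def N by blast
qed

lemma half_subspace_sub:
  assumes i: "i \<in> {1..N}" and P: "P \<in> half_subspace (org \<epsilon>) e i th" and x: "x \<in> half_subspace (org \<epsilon>) e i th"
  shows "\<exists>c. \<forall>l\<in>{i..N}. Y \<epsilon> x l = c * Y \<epsilon> P l"
proof -
  have PP: "P \<notin> coord_space (org \<epsilon>) e (i - 1)" "\<And>j. j \<in> {i..<N} \<Longrightarrow> polar (org \<epsilon>) e P j = polar (org \<epsilon>) e x j"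
    using P x unfolding half_subspace_def N by auto
  have i1: "i - 1 \<le> N" "{i - 1<..N} = {i..N}" using i by auto
  have l: "\<exists>l\<in>{i..N}. Y \<epsilon> P l \<noteq> 0"
    using PP(1) unfolding coord_space_iff[OF i1(1)] i1(2) by blast
  show ?thesis
  proof (cases "i = N")
    case True
    then show ?thesis using l by (intro exI[of _ "Y \<epsilon> x N / Y \<epsilon> P N"]) auto
  next
    case False
    then show ?thesis
      using i l PP(2) unfolding polar_pol by (intro polar_coord_proportional N2) auto
  qed
qed

lemma affine_hull_half_subspace:
  assumes i: "i \<in> {1..N}" and P: "P \<in> half_subspace (org \<epsilon>) e i th"
  shows "affine hull (half_subspace (org \<epsilon>) e i th) = {x. x - org \<epsilon> \<in> tail_space i (Y \<epsilon> P)}"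
proof
  let ?S = "tail_space i (Y \<epsilon> P)" and ?H = "half_subspace (org \<epsilon>) e i th"
  have "affine {x. x - org \<epsilon> \<in> ?S}"
    unfolding affine_def
  proof (intro ballI allI impI)
    fix x y u v assume xy: "x \<in> {x. x - org \<epsilon> \<in> ?S}" "y \<in> {x. x - org \<epsilon> \<in> ?S}" and uv: "u + v = (1::real)"
    have "u *\<^sub>R (x - org \<epsilon>) + v *\<^sub>R (y - org \<epsilon>) \<in> ?S"
      using xy tail_space_subspace by (intro subspace_add subspace_scale) auto
    moreover have "u *\<^sub>R (x - org \<epsilon>) + v *\<^sub>R (y - org \<epsilon>) = u *\<^sub>R x + v *\<^sub>R y - (u + v) *\<^sub>R org \<epsilon>"
      by (simp add: algebra_simps)
    ultimately show "u *\<^sub>R x + v *\<^sub>R y \<in> {x. x - org \<epsilon> \<in> ?S}" using uv by simp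
  qed
  moreover have "?H \<subseteq> {x. x - org \<epsilon> \<in> ?S}"
    using half_subspace_sub[OF i P] unfolding tail_space_def by blast
  ultimately show "affine hull ?H \<subseteq> {x. x - org \<epsilon> \<in> ?S}" by (simp add: hull_minimal)
  show "{x. x - org \<epsilon> \<in> ?S} \<subseteq> affine hull ?H"
  proof
    fix x assume "x \<in> {x. x - org \<epsilon> \<in> ?S}"
    then obtain c where c: "\<And>l. l \<in> {i..N} \<Longrightarrow> Y \<epsilon> x l = c * Y \<epsilon> P l" unfolding tail_space_def by blast
    define v where "v = (\<Sum>l=i..N. Y \<epsilon> P l *\<^sub>R e l)"
    have ve: "v \<bullet> e l = Y \<epsilon> P l" if "l \<in> {i..N}" for l
      unfolding v_def using that i by (subst sum_inner) auto
    \<comment> \<open>Moving along \<open>v\<close> changes the proportionality factor of the tail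
      from \<open>c\<close> to \<open>t\<close>. The points with factors 1 and 2 lie in the
      half-subspace, and \<open>x\<close> is an affine combination of them.\<close>
    define g where "g t = x + (t - c) *\<^sub>R v" for t
    have "g t \<in> ?H" if "0 < t" for t
    proof (rule half_subspace_super[OF i P that])
      fix l assume l: "l \<in> {i..N}"
      show "Y \<epsilon> (g t) l = t * Y \<epsilon> P l"
        unfolding g_def Y_add c[OF l] inner_scaleR_left ve[OF l] by (simp add: algebra_simps)
    qed
    then have "g 1 \<in> affine hull ?H" "g 2 \<in> affine hull ?H" by (auto intro: hull_inc)
    then have "(2 - c) *\<^sub>R g 1 + (c - 1) *\<^sub>R g 2 \<in> affine hull ?H"
      by (intro mem_affine[OF affine_affine_hull]) auto
    moreover have "(2 - c) *\<^sub>R g 1 + (c - 1) *\<^sub>R g 2 = x"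
      unfolding g_def by (simp add: algebra_simps flip: scaleR_2)
    ultimately show "x \<in> affine hull ?H" by simp
  qed
qed

text \<open>The half-subspace contains a smaller one of dimension \<open>k\<close>, whose tail
  direction \<open>c\<close> continues that of \<open>P\<close> and stays in the cone. This one
  already meets \<open>L\<close>, and its direction is a complement of \<open>L\<close>; hence the
  direction of the larger one and \<open>L\<close> together span everything, which fixes the
  dimension of the intersection.\<close>

lemma half_subspace_flat:
  assumes L: "transversal L k" and C: "1 \<le> C" "\<And>x. norm (proj L k x) \<le> C * norm x"
    and \<epsilon>: "0 < \<epsilon>" "\<epsilon> \<le> 1 / (100 * C)" and i: "i \<in> {1..N}" and ki: "k \<le> i"
    and P: "P \<in> half_subspace (org \<epsilon>) e i th" "P \<in> closure (sector \<epsilon>)"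
  shows "half_subspace (org \<epsilon>) e i th \<inter> L \<inter> closure (sector \<epsilon>) \<noteq> {}"
    and "aff_dim (affine hull (half_subspace (org \<epsilon>) e i th) \<inter> L) = int i - int k"
proof -
  have kN: "k < N" and sL: "subspace L" and dL: "dim L + k = N" using L unfolding transversal_def by blast+
  have "\<epsilon> * 100 \<le> \<epsilon> * (100 * C)" using C(1) \<epsilon>(1) by simp
  also have "\<dots> \<le> 1" using \<epsilon>(2) C(1) by (simp add: field_simps)
  finally have e1: "\<epsilon> \<le> 1 / 100" by simp
  then have e2: "\<epsilon> \<le> 1 / 2" by simp
  define y where "y = Y \<epsilon> P"
  have yi: "0 < y i"
    unfolding y_def using P by (intro closure_sector_point[OF \<epsilon>(1) e2 i]) (auto simp: half_subspace_def)
  have yc: "\<And>j. j \<in> {1..N} \<Longrightarrow> 0 \<le> y j" "\<And>j. j \<in> {1..<N} \<Longrightarrow> L2_set y {Suc j..N} \<le> 3 * \<epsilon> * y j"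
    using P(2) unfolding closure_sector[OF \<epsilon>(1) e2] y_def by blast+
  define S where "S = tail_space i y"
  have S: "subspace S" "dim S = i"
    unfolding S_def using tail_space_subspace dim_tail_space[of i y] i yi by auto
  have main: "half_subspace (org \<epsilon>) e i th \<inter> L \<inter> closure (sector \<epsilon>) \<noteq> {} \<and> {a + b |a b. a \<in> S \<and> b \<in> L} = UNIV"
  proof (cases "k = 0")
    case True
    then have "span L = UNIV" using dL N dim_eq_full[of L] by simp
    moreover have "span L = L" using sL by (simp add: span_eq_iff)
    ultimately have "L = UNIV" by simp
    moreover have "0 \<in> S" using S(1) by (rule subspace_0)
    ultimately have "\<exists>a b. x = a + b \<and> a \<in> S \<and> b \<in> L" for x by (intro exI[of _ 0] exI[of _ x]) simp
    then show ?thesis using P \<open>L = UNIV\<close> by blast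
  next
    case False
    then have k1: "1 \<le> k" by simp
    \<comment> \<open>From \<open>i\<close> on, \<open>c\<close> is proportional to
      \<open>y\<close>. Between \<open>k\<close> and \<open>i\<close> it decreases by the factor
      \<epsilon>, which gives \<open>c k = 1\<close> and keeps the tails below the slope 3
      \<epsilon>.\<close>
    define c where "c l = (if l < i then \<epsilon> ^ (l - k) else \<epsilon> ^ (i - k) * (y l / y i))" for l
    have ck: "c k = 1" using ki yi by (auto simp: c_def)
    have cpos: "0 \<le> c l" if "l \<in> {k..N}" for l
      using that yc(1)[of l] yi \<epsilon> k1 by (auto simp: c_def)
    have ci: "c l = \<epsilon> ^ (i - k) / y i * y l" if "l \<in> {i..N}" for l
      using that by (auto simp: c_def)
    have Lci: "L2_set c {Suc j..N} = \<epsilon> ^ (i - k) / y i * L2_set y {Suc j..N}" if "i \<le> j" for j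
    proof -
      have "L2_set c {Suc j..N} = L2_set (\<lambda>l. \<epsilon> ^ (i - k) / y i * y l) {Suc j..N}"
        using ci that by (intro L2_set_cong) auto
      moreover have "0 \<le> \<epsilon> ^ (i - k) / y i" using \<epsilon> yi by simp
      ultimately show ?thesis using L2_set_right_distrib[of "\<epsilon> ^ (i - k) / y i" y "{Suc j..N}"] by (simp only:)
    qed
    have Lc: "L2_set c {Suc j..N} \<le> 3 * \<epsilon> * c j" if j: "j \<in> {k..<N}" for j
    proof (cases "i \<le> j")
      case True
      have "L2_set c {Suc j..N} \<le> \<epsilon> ^ (i - k) / y i * (3 * \<epsilon> * y j)"
        unfolding Lci[OF True] using yc(2)[of j] j k1 \<epsilon> yi by (intro mult_left_mono) auto
      then show ?thesis using ci[of j] True j by (simp add: algebra_simps)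
    next
      case False
      have un: "{Suc j..N} = {Suc j..i} \<union> {Suc i..N}" using False i j by auto
      have cl: "c l = \<epsilon> ^ (l - k)" if "l \<in> {Suc j..i}" for l using that yi by (auto simp: c_def)
      have "L2_set c {Suc j..N} \<le> (\<Sum>l=Suc j..i. \<bar>c l\<bar>) + L2_set c {Suc i..N}"
        unfolding un by (rule L2_set_Un_le) auto
      also have "(\<Sum>l=Suc j..i. \<bar>c l\<bar>) = (\<Sum>l=Suc j..i. \<epsilon> ^ (l - k))"
        using cl \<epsilon> by (intro sum.cong) auto
      also have "\<dots> = (\<Sum>l=Suc j - k..i - k. \<epsilon> ^ l)"
        using j ki by (intro sum.reindex_bij_witness[of _ "\<lambda>l. l + k" "\<lambda>l. l - k"]) auto
      also have "\<dots> \<le> 2 * \<epsilon> ^ (Suc j - k)" by (rule sum_power_le[OF \<epsilon>(1) e2])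
      also have "Suc j - k = Suc (j - k)" using j by (simp add: Suc_diff_le)
      also have "L2_set c {Suc i..N} \<le> \<epsilon> ^ (i - k) * (3 * \<epsilon>)"
      proof (cases "i = N")
        case True
        then show ?thesis using \<epsilon> by simp
      next
        case False
        then have "L2_set y {Suc i..N} \<le> 3 * \<epsilon> * y i" using i by (intro yc(2)) auto
        then have "\<epsilon> ^ (i - k) / y i * L2_set y {Suc i..N} \<le> \<epsilon> ^ (i - k) / y i * (3 * \<epsilon> * y i)"
          using \<epsilon> yi by (intro mult_left_mono) auto
        then show ?thesis unfolding Lci[OF order_refl] using yi by simp
      qed
      also have "\<epsilon> ^ (i - k) * (3 * \<epsilon>) \<le> \<epsilon> ^ Suc (j - k) * (3 / 100)"
        using \<epsilon> e1 False j by (intro mult_mono power_decreasing) auto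
      finally have "L2_set c {Suc j..N} \<le> 2 * \<epsilon> ^ Suc (j - k) + \<epsilon> ^ Suc (j - k) * (3 / 100)" by simp
      moreover have "c j = \<epsilon> ^ (j - k)" using False by (simp add: c_def)
      then have "3 * \<epsilon> * c j = 3 * \<epsilon> ^ Suc (j - k)" by simp
      moreover have "0 < \<epsilon> ^ Suc (j - k)" using \<epsilon> by simp
      ultimately show ?thesis by linarith
    qed
    have "L2_set c {Suc k..N} \<le> 3 * \<epsilon>" using Lc[of k] kN ck by simp
    note cone = cone_meets_flat[OF L C \<epsilon> k1 ck this]
    obtain p t where p: "p \<in> L" "0 < t" "\<And>l. l \<in> {k..N} \<Longrightarrow> Y \<epsilon> p l = t * c l"
      "\<And>j. j \<in> {1..<k} \<Longrightarrow> 0 < Y \<epsilon> p j \<and> L2_set (Y \<epsilon> p) {Suc j..N} \<le> 3 * \<epsilon> * Y \<epsilon> p j"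
      using cone(2) by blast
    have "p \<in> closure (sector \<epsilon>)"
      unfolding closure_sector[OF \<epsilon>(1) e2]
    proof (intro conjI ballI)
      fix j assume "j \<in> {1..N}"
      then show "0 \<le> Y \<epsilon> p j" using p(2) p(3)[of j] p(4)[of j] cpos[of j] by (cases "j < k") auto
    next
      fix j assume j: "j \<in> {1..<N}"
      show "L2_set (Y \<epsilon> p) {Suc j..N} \<le> 3 * \<epsilon> * Y \<epsilon> p j"
      proof (cases "j < k")
        case True
        then show ?thesis using p(4) j by simp
      next
        case False
        have "L2_set (Y \<epsilon> p) {Suc j..N} = L2_set (\<lambda>l. t * c l) {Suc j..N}"
          using p(3) False by (intro L2_set_cong) auto
        also have "\<dots> = t * L2_set c {Suc j..N}" using p(2) by (simp add: L2_set_right_distrib)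
        also have "\<dots> \<le> t * (3 * \<epsilon> * c j)" using Lc[of j] False j p(2) by (intro mult_left_mono) auto
        finally show ?thesis using p(3)[of j] False j by (simp add: algebra_simps)
      qed
    qed
    moreover have "p \<in> half_subspace (org \<epsilon>) e i th"
    proof (rule half_subspace_super[OF i P(1), of "t * (\<epsilon> ^ (i - k) / y i)"])
      show "0 < t * (\<epsilon> ^ (i - k) / y i)" using p(2) \<epsilon> yi by simp
      fix l assume "l \<in> {i..N}"
      then show "Y \<epsilon> p l = t * (\<epsilon> ^ (i - k) / y i) * Y \<epsilon> P l"
        using p(3)[of l] ci[of l] ki by (simp add: y_def)
    qed
    moreover have "{a + b |a b. a \<in> S \<and> b \<in> L} = UNIV"
    proof -
      have "tail_space k c \<subseteq> S"
      proof
        fix v assume "v \<in> tail_space k c"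
        then obtain s where s: "\<forall>l\<in>{k..N}. v \<bullet> e l = s * c l" unfolding tail_space_def by blast
        then have "\<forall>l\<in>{i..N}. v \<bullet> e l = (s * (\<epsilon> ^ (i - k) / y i)) * y l" using ci ki by simp
        then show "v \<in> S" unfolding S_def tail_space_def by blast
      qed
      moreover have "{a + b |a b. a \<in> tail_space k c \<and> b \<in> L} = UNIV"
        using cone(1) dL k1 kN ck dim_tail_space[of k c] tail_space_subspace sL
        by (intro sum_subspaces_UNIV) auto
      ultimately show ?thesis by blast
    qed
    ultimately show ?thesis using p(1) by blast
  qed
  then show ne: "half_subspace (org \<epsilon>) e i th \<inter> L \<inter> closure (sector \<epsilon>) \<noteq> {}" by blast
  have "dim (S \<inter> L) + N = i + dim L"
    using dim_sums_Int[OF S(1) sL] main S(2) by (simp add: N)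
  then have dSL: "int (dim (S \<inter> L)) = int i - int k" using dL by simp
  obtain p where p: "p \<in> half_subspace (org \<epsilon>) e i th" "p \<in> L" using ne by blast
  have hull: "affine hull (half_subspace (org \<epsilon>) e i th) = {x. x - org \<epsilon> \<in> S}"
    unfolding S_def y_def by (rule affine_hull_half_subspace[OF i P(1)])
  have pS: "p - org \<epsilon> \<in> S" using hull_inc[OF p(1), of affine] hull by blast
  have "{x. x - org \<epsilon> \<in> S} \<inter> L = (+) p ` (S \<inter> L)"
  proof (intro equalityI subsetI)
    fix x assume x: "x \<in> {x. x - org \<epsilon> \<in> S} \<inter> L"
    then have x': "x - org \<epsilon> \<in> S" "x \<in> L" by blast+
    have "(x - org \<epsilon>) - (p - org \<epsilon>) \<in> S" by (rule subspace_diff[OF S(1) x'(1) pS])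
    moreover have "x - p \<in> L" by (rule subspace_diff[OF sL x'(2) p(2)])
    ultimately show "x \<in> (+) p ` (S \<inter> L)" by (auto intro!: image_eqI[of _ _ "x - p"])
  next
    fix x assume "x \<in> (+) p ` (S \<inter> L)"
    then obtain v where v: "v \<in> S" "v \<in> L" "x = p + v" by auto
    have "(p - org \<epsilon>) + v \<in> S" using pS v(1) by (rule subspace_add[OF S(1)])
    moreover have "p + v \<in> L" using p(2) v(2) by (rule subspace_add[OF sL])
    ultimately show "x \<in> {x. x - org \<epsilon> \<in> S} \<inter> L" using v by (simp add: algebra_simps)
  qed
  then have "aff_dim (affine hull (half_subspace (org \<epsilon>) e i th) \<inter> L) = aff_dim (S \<inter> L)"
    unfolding hull by (simp add: aff_dim_translation_eq)
  also have "\<dots> = int (dim (S \<inter> L))" using S(1) sL by (intro aff_dim_subspace subspace_inter)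
  finally show "aff_dim (affine hull (half_subspace (org \<epsilon>) e i th) \<inter> L) = int i - int k" using dSL by simp
qed

text \<open>Each facet contains an open ray starting at the centre 0, and 0 lies in the interior of
  the sector, so the beginning of the ray is a common part of the two. The conditions on
  half-subspaces hold flat by flat, with one constant \<open>C\<close> for all projections.\<close>

lemma generic_polar_org:
  assumes C: "1 \<le> C" and \<epsilon>: "0 < \<epsilon>" "\<epsilon> \<le> 1 / (100 * C)"
    and flats: "\<And>k L. L \<in> codim_flats \<A> k \<Longrightarrow> transversal L k \<and> (\<forall>x. norm (proj L k x) \<le> C * norm x)"
    and facets: "\<And>F. F \<in> facets \<A> \<Longrightarrow> \<not> bounded F \<and> (\<exists>x. \<forall>t>0. t *\<^sub>R x \<in> F)"
    and chamber: "\<exists>F\<in>codim_facets \<A> 0. org \<epsilon> \<in> F"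
  shows "generic_polar \<A> (org \<epsilon>) e"
proof -
  have "\<epsilon> * 100 \<le> \<epsilon> * (100 * C)" using C \<epsilon>(1) by simp
  also have "\<dots> \<le> 1" using \<epsilon>(2) C by (simp add: field_simps)
  finally have e2: "\<epsilon> \<le> 1 / 2" by simp
  have "F \<inter> sector \<epsilon> \<noteq> {}" if F: "F \<in> facets \<A>" for F
  proof -
    obtain x where x: "\<And>t. 0 < t \<Longrightarrow> t *\<^sub>R x \<in> F" using facets[OF F] by blast
    have "\<forall>\<^sub>F t in at_right 0. t *\<^sub>R x \<in> F \<and> t *\<^sub>R x \<in> sector \<epsilon>"
      using ray_in_sector[OF \<epsilon>(1) e2, of x] eventually_at_right_less[of "0::real"]
      by eventually_elim (use x in blast)
    then have "\<exists>t. t *\<^sub>R x \<in> F \<and> t *\<^sub>R x \<in> sector \<epsilon>"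
      using eventually_happens[of _ "at_right (0::real)"] trivial_limit_at_right_real[of "0::real"] by blast
    then show ?thesis by blast
  qed
  moreover have "half_subspace (org \<epsilon>) e i th \<inter> L \<inter> closure (sector \<epsilon>) \<noteq> {} \<and>
      aff_dim (affine hull (half_subspace (org \<epsilon>) e i th) \<inter> L) = int i - int k"
    if "i \<in> {1..N}" "half_subspace (org \<epsilon>) e i th \<inter> closure (sector \<epsilon>) \<noteq> {}" "k \<le> i" "L \<in> codim_flats \<A> k" for i th k L
  proof -
    from that(2) obtain P where P: "P \<in> half_subspace (org \<epsilon>) e i th" "P \<in> closure (sector \<epsilon>)" by blast
    have "transversal L k" "\<And>x. norm (proj L k x) \<le> C * norm x" using flats[OF that(4)] by blast+
    then show ?thesis using half_subspace_flat[OF _ C _ \<epsilon> that(1,3) P] by blast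
  qed
  ultimately show ?thesis
    unfolding generic_polar_def N[symmetric]
    using chamber facets arctan_range[OF \<epsilon>(1)] by (intro conjI bexI[of _ "arctan (3 * \<epsilon>)"]) blast+
qed

end

section \<open>Flats and facets of the braid arrangement\<close>

text \<open>Gram-Schmidt. The positive inner products fix the signs of the frame vectors; later they
  let the second coefficients of polynomials determine the polar order with the right sign.\<close>

lemma orthonormal_flag:
  fixes f :: "nat \<Rightarrow> 'a::euclidean_space"
  assumes f: "\<And>k. k < m \<Longrightarrow> f (Suc k) \<notin> span (f ` {1..k})"
  shows "\<exists>e. (\<forall>i\<in>{1..m}. \<forall>j\<in>{1..m}. e i \<bullet> e j = (if i = j then 1 else 0)) \<and>
    (\<forall>k\<le>m. span (e ` {1..k}) = span (f ` {1..k})) \<and> (\<forall>k\<in>{1..m}. 0 < f k \<bullet> e k)"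
  using f
proof (induction m)
  case 0
  then show ?case by auto
next
  case (Suc m)
  then obtain e where e: "\<And>i j. i \<in> {1..m} \<Longrightarrow> j \<in> {1..m} \<Longrightarrow> e i \<bullet> e j = (if i = j then 1 else 0)"
    "\<And>k. k \<le> m \<Longrightarrow> span (e ` {1..k}) = span (f ` {1..k})" "\<And>k. k \<in> {1..m} \<Longrightarrow> 0 < f k \<bullet> e k"
    by (metis less_Suc_eq)
  define w where "w = (\<Sum>i=1..m. (f (Suc m) \<bullet> e i) *\<^sub>R e i)"
  define g where "g = f (Suc m) - w"
  have w: "w \<in> span (f ` {1..m})"
    unfolding w_def e(2)[OF order_refl, symmetric] by (intro span_sum span_scale span_base) auto
  have "g \<noteq> 0" using Suc.prems[of m] w by (auto simp: g_def)
  then have ng: "0 < norm g" by simp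
  have ge: "g \<bullet> e j = 0" if j: "j \<in> {1..m}" for j
  proof -
    have "w \<bullet> e j = (\<Sum>i=1..m. if i = j then f (Suc m) \<bullet> e j else 0)"
      unfolding w_def inner_sum_left using e(1) j by (intro sum.cong) auto
    also have "\<dots> = f (Suc m) \<bullet> e j" using j by simp
    finally show ?thesis by (simp add: g_def inner_diff_left)
  qed
  have gw: "g \<bullet> w = 0" unfolding w_def inner_sum_right using ge by simp
  define u where "u = g /\<^sub>R norm g"
  define e' where "e' = e(Suc m := u)"
  have uu: "u \<bullet> u = 1" using ng by (simp add: u_def power2_norm_eq_inner[symmetric] power2_eq_square field_simps)
  have ue: "u \<bullet> e j = 0" if "j \<in> {1..m}" for j using ge[OF that] by (simp add: u_def)
  have im: "e' ` {1..k} = e ` {1..k}" if "k \<le> m" for k using that by (auto simp: e'_def)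
  have ins: "{1..Suc m} = insert (Suc m) {1..m}" by auto
  have span_eq: "span (e' ` {1..Suc m}) = span (f ` {1..Suc m})"
  proof -
    have "span (e' ` {1..Suc m}) = span (insert u (e ` {1..m}))"
      unfolding ins image_insert im[OF order_refl] by (simp add: e'_def)
    also have "\<dots> = {x. \<exists>k. x - k *\<^sub>R u \<in> span (f ` {1..m})}"
      unfolding span_insert e(2)[OF order_refl] ..
    also have "\<dots> = {x. \<exists>k. x - k *\<^sub>R f (Suc m) \<in> span (f ` {1..m})}"
    proof (intro Collect_cong iffI)
      fix x
      assume "\<exists>k. x - k *\<^sub>R u \<in> span (f ` {1..m})"
      then obtain k where k: "x - k *\<^sub>R u \<in> span (f ` {1..m})" by blast
      have "(x - k *\<^sub>R u) - (k / norm g) *\<^sub>R w \<in> span (f ` {1..m})"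
        by (rule span_diff[OF k span_scale[OF w]])
      moreover have "(x - k *\<^sub>R u) - (k / norm g) *\<^sub>R w = x - (k / norm g) *\<^sub>R f (Suc m)"
        by (simp add: u_def g_def algebra_simps divide_inverse)
      ultimately show "\<exists>k. x - k *\<^sub>R f (Suc m) \<in> span (f ` {1..m})" by metis
    next
      fix x
      assume "\<exists>k. x - k *\<^sub>R f (Suc m) \<in> span (f ` {1..m})"
      then obtain k where k: "x - k *\<^sub>R f (Suc m) \<in> span (f ` {1..m})" by blast
      have "(x - k *\<^sub>R f (Suc m)) + k *\<^sub>R w \<in> span (f ` {1..m})"
        by (rule span_add[OF k span_scale[OF w]])
      moreover have "(x - k *\<^sub>R f (Suc m)) + k *\<^sub>R w = x - (k * norm g) *\<^sub>R u"
        using ng by (simp add: u_def g_def algebra_simps)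
      ultimately show "\<exists>k. x - k *\<^sub>R u \<in> span (f ` {1..m})" by metis
    qed
    also have "\<dots> = span (f ` {1..Suc m})" unfolding ins image_insert span_insert ..
    finally show ?thesis .
  qed
  have pos: "0 < f (Suc m) \<bullet> u"
  proof -
    have "f (Suc m) \<bullet> g = g \<bullet> g" using gw by (simp add: g_def inner_commute algebra_simps)
    then have "f (Suc m) \<bullet> u = (g \<bullet> g) / norm g" by (simp add: u_def divide_inverse mult.commute)
    then show ?thesis using ng by simp
  qed
  show ?case
  proof (intro exI[of _ e'] conjI ballI allI impI)
    fix i j assume "i \<in> {1..Suc m}" "j \<in> {1..Suc m}"
    then show "e' i \<bullet> e' j = (if i = j then 1 else 0)"
      using e(1)[of i j] uu ue[of i] ue[of j] by (auto simp: e'_def ins inner_commute)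
  next
    fix k assume "k \<le> Suc m"
    then show "span (e' ` {1..k}) = span (f ` {1..k})"
      using span_eq im[of k] e(2)[of k] by (cases "k = Suc m") auto
  next
    fix k assume "k \<in> {1..Suc m}"
    then show "0 < f k \<bullet> e' k" using e(3)[of k] pos by (auto simp: e'_def ins)
  qed
qed

text \<open>Every partition has a code: in the step the new entry either joins the block of an older
  one, and is coded by the minimum of that block, or it is a new minimum and adds no pair.\<close>

lemma code_exists:
  "\<exists>P. valid N P \<and> (\<forall>d\<in>{1..N}. \<forall>e\<in>{1..N}. rep P d = rep P e \<longleftrightarrow> f d = f e)"
proof (induction N)
  case 0
  then show ?case by (intro exI[of _ "[]"]) auto
next
  case (Suc N)
  then obtain P where P: "valid N P" "\<And>d e. d \<in> {1..N} \<Longrightarrow> e \<in> {1..N} \<Longrightarrow> rep P d = rep P e \<longleftrightarrow> f d = f e" by blast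
  have ins: "{1..Suc N} = insert (Suc N) {1..N}" by auto
  show ?case
  proof (cases "\<exists>c\<in>{1..N}. f c = f (Suc N)")
    case True
    then obtain c where c: "c \<in> {1..N}" "f c = f (Suc N)" by blast
    define r where "r = rep P c"
    have r: "r \<in> {1..N}" "r \<notin> fst ` set P" "rep P r = r" 
      using rep_range[OF P(1), of c] rep_le[OF P(1), of c] rep_ge1[OF P(1), of c] c rep_rep[OF P(1), of c] by (auto simp: r_def)
    then have fr: "f r = f (Suc N)" using P(2)[of r c] c by (simp add: r_def)
    let ?Q = "(Suc N, r) # P"
    have g: "rep ?Q d = rep P (if d = Suc N then r else d)" for d using r by simp
    have "rep ?Q d = rep ?Q e \<longleftrightarrow> f d = f e" if "d \<in> {1..Suc N}" "e \<in> {1..Suc N}" for d e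
    proof -
      define h where "h d = (if d = Suc N then r else d)" for d
      have "h d \<in> {1..N}" "f (h d) = f d" if "d \<in> {1..Suc N}" for d using that r fr by (auto simp: h_def)
      then show ?thesis unfolding g h_def[symmetric] using P(2)[of "h d" "h e"] that by simp
    qed
    moreover have "valid (Suc N) ?Q" using r P(1) by auto
    ultimately show ?thesis by blast
  next
    case False
    have t: "rep P (Suc N) = Suc N" using valid_fst[OF P(1)] by (intro rep_notin) force
    have le: "rep P d \<noteq> Suc N" if "d \<in> {1..N}" for d using rep_le[OF P(1), of d] that by auto
    have "rep P d = rep P e \<longleftrightarrow> f d = f e" if "d \<in> {1..Suc N}" "e \<in> {1..Suc N}" for d e
      using that unfolding ins
    proof (elim insertE)
      assume "d = Suc N" "e \<in> {1..N}"
      then show ?thesis using t le[of e] False by force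
    next
      assume "e = Suc N" "d \<in> {1..N}"
      then show ?thesis using t le[of d] False by force
    qed (use P(2) in auto)
    moreover have "valid (Suc N) P" using valid_mono[OF P(1)] by simp
    ultimately show ?thesis by blast
  qed
qed

lemma polar_less_irrefl: "\<not> polar_less x e P P"
  by (simp add: polar_less_def)

lemma polar_less_asym: "polar_less x e P (Q::'a::euclidean_space) \<Longrightarrow> \<not> polar_less x e Q P"
proof
  assume "polar_less x e P Q" "polar_less x e Q P"
  then obtain i j where i: "i < DIM('a)" "polar x e P i < polar x e Q i" "\<And>m. m \<in> {i<..<DIM('a)} \<Longrightarrow> polar x e P m = polar x e Q m"
    and j: "j < DIM('a)" "polar x e Q j < polar x e P j" "\<And>m. m \<in> {j<..<DIM('a)} \<Longrightarrow> polar x e Q m = polar x e P m"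
    unfolding polar_less_def by blast
  show False
    using i(2) j(2) i(3)[of j] j(3)[of i] i(1) j(1) by (cases i j rule: linorder_cases) auto
qed

locale braid_polys =
  fixes n :: nat and idx :: "nat \<Rightarrow> 'n::finite" and N :: nat
    and \<beta> s :: "nat \<Rightarrow> real" and pp :: "code \<Rightarrow> nat \<Rightarrow> real poly"
  assumes n: "1 \<le> n" and NN: "N = n + 1" and idx: "bij_betw idx {1..N} (UNIV :: 'n set)"
    and gd: "poly_system N N \<beta> s pp"

sublocale braid_polys \<subseteq> code_polys N N \<beta> s pp
  by unfold_locales (use n NN gd in auto)

context braid_polys
begin

abbreviation X :: "real ^ 'n \<Rightarrow> nat \<Rightarrow> real" where "X x \<equiv> \<lambda>d. x $ idx d"

lemma dimN: "DIM(real ^ 'n) = N"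
  using bij_betw_same_card[OF idx] by simp

lemma idx_eq: "d \<in> {1..N} \<Longrightarrow> e \<in> {1..N} \<Longrightarrow> idx d = idx e \<longleftrightarrow> d = e"
  using idx by (meson bij_betw_imp_inj_on inj_on_eq_iff)

text \<open>The entry 1 always has value 0, so the values alone fill only a hyperplane. Adding
  \<open>coeff p n\<close> times the diagonal vector supplies the missing dimension without changing
  differences of coordinates, hence without affecting any relation or order.\<close>

definition poly_vec :: "real poly \<Rightarrow> real ^ 'n" where
  "poly_vec p = (\<chi> a. coeff p n - val \<beta> s (the_inv_into {1..N} idx a) p)"

lemma X_poly_vec: "d \<in> {1..N} \<Longrightarrow> X (poly_vec p) d = coeff p n - val \<beta> s d p"
  using idx by (simp add: poly_vec_def the_inv_into_f_f bij_betw_imp_inj_on)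

lemma poly_vec_add: "poly_vec (p + q) = poly_vec p + poly_vec q"
  and poly_vec_diff: "poly_vec (p - q) = poly_vec p - poly_vec q"
  and poly_vec_smult: "poly_vec (smult t p) = t *\<^sub>R poly_vec p"
  and poly_vec_0: "poly_vec 0 = 0"
  by (simp_all add: poly_vec_def vec_eq_iff algebra_simps)

definition code_flat :: "code \<Rightarrow> (real ^ 'n) set" where
  "code_flat P = {x. \<forall>(b, c)\<in>set P. X x b = X x c}"

lemma mem_code_flat: "x \<in> code_flat P \<longleftrightarrow> (\<forall>b c. (b, c) \<in> set P \<longrightarrow> X x b = X x c)"
  unfolding code_flat_def by blast

lemma subspace_code_flat: "subspace (code_flat P)"
  by (intro subspaceI) (auto simp: mem_code_flat)

lemma code_flat_rep:
  assumes "valid K P" "x \<in> code_flat P"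
  shows "X x (rep P d) = X x d"
  using assms by (induction K P rule: valid.induct) (auto simp: code_flat_def)

lemma code_flat_poly_vec:
  assumes "valid N P"
  shows "poly_vec p \<in> code_flat P \<longleftrightarrow> sat \<beta> s P p"
proof -
  have "b \<in> {1..N}" "c \<in> {1..N}" if "(b, c) \<in> set P" for b c using valid_fst[OF assms that] by auto
  then show ?thesis unfolding code_flat_def sat_def using X_poly_vec by fastforce
qed

definition monom_vec :: "nat \<Rightarrow> real ^ 'n" where "monom_vec i = poly_vec (monom 1 (i - 1))"

lemma span_monom_vec: "x \<in> span (monom_vec ` {1..k}) \<Longrightarrow> \<exists>p. x = poly_vec p \<and> (\<forall>i\<ge>k. coeff p i = 0)"
proof (induction rule: span_induct_alt)
  case base
  then show ?case by (intro exI[of _ 0]) (simp add: poly_vec_0)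
next
  case (step c x y)
  then obtain p i where p: "y = poly_vec p" "\<forall>i\<ge>k. coeff p i = 0" and i: "i \<in> {1..k}" "x = monom_vec i" by auto
  then show ?case
    by (intro exI[of _ "smult c (monom 1 (i - 1)) + p"]) (auto simp: poly_vec_add poly_vec_smult monom_vec_def)
qed

lemma poly_vec_expand:
  assumes "\<forall>i>k. coeff p i = 0"
  shows "poly_vec p = (\<Sum>i\<le>k. coeff p i *\<^sub>R monom_vec (Suc i))"
proof -
  have "poly_vec (\<Sum>i\<in>S. monom (coeff p i) i) = (\<Sum>i\<in>S. coeff p i *\<^sub>R monom_vec (Suc i))" if "finite S" for S
    using that
  proof (induction S)
    case (insert i S)
    have "monom (coeff p i) i = smult (coeff p i) (monom 1 i)" by (simp add: smult_monom)
    then show ?case using insert by (simp add: poly_vec_add poly_vec_smult monom_vec_def)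
  qed (simp add: poly_vec_0)
  moreover have "degree p \<le> k" using assms by (intro degree_le) auto
  then have "p = (\<Sum>i\<le>k. monom (coeff p i) i)" by (simp add: poly_as_sum_of_monoms')
  ultimately show ?thesis by (metis finite_atMost)
qed

lemma code_flat_inter_span:
  assumes "valid N P"
  shows "code_flat P \<inter> span (monom_vec ` {1..length P}) \<subseteq> {0}"
proof
  fix x assume x: "x \<in> code_flat P \<inter> span (monom_vec ` {1..length P})"
  then obtain p where p: "x = poly_vec p" "\<forall>i\<ge>length P. coeff p i = 0" using span_monom_vec by blast
  then have "p = 0" using x code_flat_poly_vec[OF assms] by (intro uniq0[OF assms]) auto
  then show "x \<in> {0}" using p by (simp add: poly_vec_0)
qed

lemma beta1: "val \<beta> s 1 p = 0"
  using gd by (simp add: poly_system_def val_def)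

text \<open>The first coordinate isolates \<open>coeff q n\<close>, since the value at the entry 1
  is 0. So all values of \<open>q\<close> vanish; \<open>q\<close> then has degree below
  \<open>n\<close> and satisfies the \<open>n\<close> pairs that code the partition into one block,
  and uniqueness gives \<open>q = 0\<close>.\<close>

lemma monom_vec_indep:
  assumes "k < N"
  shows "monom_vec (Suc k) \<notin> span (monom_vec ` {1..k})"
proof
  assume "monom_vec (Suc k) \<in> span (monom_vec ` {1..k})"
  then obtain p where p: "monom_vec (Suc k) = poly_vec p" "\<forall>i\<ge>k. coeff p i = 0" using span_monom_vec by blast
  define q where "q = monom 1 k - p"
  have q: "poly_vec q = 0" "coeff q k = 1" "\<And>i. k < i \<Longrightarrow> coeff q i = 0"
    using p by (auto simp: q_def poly_vec_diff monom_vec_def)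
  have "coeff q n = X (poly_vec q) 1" using X_poly_vec[of 1 q] N beta1[of q] by simp
  then have qn: "coeff q n = 0" using q by simp
  then have v: "val \<beta> s d q = 0" if "d \<in> {1..N}" for d using X_poly_vec[OF that, of q] q by simp
  obtain P where P: "valid N P" "\<And>d e. d \<in> {1..N} \<Longrightarrow> e \<in> {1..N} \<Longrightarrow> rep P d = rep P e"
    using code_exists[of N "\<lambda>_. 0 :: nat"] by blast
  define g where "g = (\<lambda>_::nat. 0 :: nat)"
  have "card (g ` {1..N}) + length P = N" unfolding g_def by (rule card_code_classes[OF P(1)]) (rule iffI, rule P(2), assumption+, rule refl)
  moreover have "g ` {1..N} = {0}" using N by (auto simp: g_def)
  then have "card (g ` {1..N}) = 1" by simp
  ultimately have lP: "length P = n" using NN by linarith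
  have "q = 0"
  proof (rule uniq0[OF P(1)])
    have "val \<beta> s b q = val \<beta> s c q" if "(b, c) \<in> set P" for b c
      using v[of b] v[of c] valid_fst[OF P(1) that] by simp
    then show "sat \<beta> s P q" unfolding sat_def by blast
    fix i assume "length P \<le> i"
    then show "coeff q i = 0" using lP qn q(3)[of i] assms NN by (cases "i = n") auto
  qed
  then show False using q by simp
qed

text \<open>Each pair lowers the dimension by at most 1. The opposite bound follows from the trivial
  intersection with the flag.\<close>

lemma dim_code_flat_ge: "valid N P \<Longrightarrow> N \<le> dim (code_flat P) + length P"
proof (induction P)
  case Nil
  have "code_flat [] = UNIV" by (simp add: code_flat_def)
  then show ?case using dimN by simp
next
  case (Cons x P)
  obtain b c where x: "x = (b, c)" by (cases x)
  have v: "valid N P" "b \<in> {1..N}" "c \<in> {1..N}" "b \<noteq> c" using Cons.prems by (auto simp: x intro: valid_mono)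
  define a :: "real ^ 'n" where "a = axis (idx b) 1 - axis (idx c) 1"
  have "idx b \<noteq> idx c" using idx_eq v by simp
  then have "a $ idx b = 1" by (simp add: a_def axis_def)
  then have "a \<noteq> 0" by auto
  define H where "H = {x. a \<bullet> x = 0}"
  have "dim H = N - 1" using dim_hyperplane[OF \<open>a \<noteq> 0\<close>] dimN by (simp add: H_def)
  have "code_flat (x # P) = code_flat P \<inter> H"
    by (auto simp: code_flat_def H_def a_def x inner_diff_left inner_axis_axis inner_axis' )
  moreover have "subspace H" unfolding H_def by (rule subspace_hyperplane)
  ultimately have "dim {x + y |x y. x \<in> code_flat P \<and> y \<in> H} + dim (code_flat (x # P)) = dim (code_flat P) + dim H"
    using dim_sums_Int[OF subspace_code_flat] by simp
  moreover have "dim {x + y |x y. x \<in> code_flat P \<and> y \<in> H} \<le> N"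
    using dim_subset_UNIV[of "{x + y |x y. x \<in> code_flat P \<and> y \<in> H}"] dimN by simp
  ultimately show ?case using Cons.IH[OF v(1)] \<open>dim H = N - 1\<close> N by simp
qed

text \<open>The relevant partition groups entries whose coordinates coincide on all of
  \<open>L\<close>. Taking \<open>f d\<close> to be the coordinate as a function on \<open>L\<close>
  turns this relation into equality of values of \<open>f\<close>.\<close>

lemma flat_code:
  assumes "L \<in> codim_flats (braid idx n) k"
  shows "\<exists>P. valid N P \<and> L = code_flat P"
proof -
  obtain B where B: "B \<subseteq> braid idx n" "L = \<Inter>B" using assms unfolding codim_flats_def by blast
  define f where "f d = (\<lambda>x. if x \<in> L then X x d else 0)" for d
  have f: "f d = f e \<longleftrightarrow> (\<forall>x\<in>L. X x d = X x e)" for d e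
    by (auto simp: f_def fun_eq_iff)
  obtain P where P: "valid N P" "\<And>d e. d \<in> {1..N} \<Longrightarrow> e \<in> {1..N} \<Longrightarrow> rep P d = rep P e \<longleftrightarrow> f d = f e"
    using code_exists[of N f] by blast
  have "L = code_flat P"
  proof
    show "L \<subseteq> code_flat P"
    proof
      fix x assume x: "x \<in> L"
      have "X x b = X x c" if bc: "(b, c) \<in> set P" for b c
      proof -
        have r: "b \<in> {1..N}" "c \<in> {1..N}" using valid_fst[OF P(1) bc] by auto
        have "rep P b = c" by (rule rep_snd[OF P(1) bc])
        then have "rep P b = rep P c" using rep_rep[OF P(1), of b] by simp
        then show ?thesis using P(2)[OF r] f x by blast
      qed
      then show "x \<in> code_flat P" by (auto simp: code_flat_def)
    qed
    show "code_flat P \<subseteq> L"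
    proof
      fix x assume x: "x \<in> code_flat P"
      have "x \<in> H" if H: "H \<in> B" for H
      proof -
        obtain i j where ij: "1 \<le> i" "i < j" "j \<le> n + 1" "H = {x. X x i = X x j}"
          using H B(1) unfolding braid_def by blast
        have "f i = f j" unfolding f using B(2) H ij(4) by blast
        then have "rep P i = rep P j" using P(2)[of i j] ij NN by simp
        then have "X x i = X x j" using code_flat_rep[OF P(1) x] by metis
        then show ?thesis using ij by simp
      qed
      then show "x \<in> L" using B by blast
    qed
  qed
  then show ?thesis using P by blast
qed

section \<open>Facets as cells of weak orders\<close>

definition cell :: "real ^ 'n \<Rightarrow> (real ^ 'n) set" where
  "cell x = {y. \<forall>d\<in>{1..N}. \<forall>e\<in>{1..N}. X y d < X y e \<longleftrightarrow> X x d < X x e}"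

lemma cell_eq: "y \<in> cell x \<Longrightarrow> d \<in> {1..N} \<Longrightarrow> e \<in> {1..N} \<Longrightarrow> X y d = X y e \<longleftrightarrow> X x d = X x e"
proof -
  assume "y \<in> cell x" "d \<in> {1..N}" "e \<in> {1..N}"
  then have "X y d < X y e \<longleftrightarrow> X x d < X x e" "X y e < X y d \<longleftrightarrow> X x e < X x d" unfolding cell_def by blast+
  then show ?thesis by linarith
qed

lemma same_position_braid:
  assumes "d \<in> {1..N}" "e \<in> {1..N}" "d \<noteq> e"
  shows "same_position {z. X z d = X z e} x y \<longleftrightarrow> (X x d < X x e \<longleftrightarrow> X y d < X y e) \<and> (X x e < X x d \<longleftrightarrow> X y e < X y d)"
proof
  have ne: "idx d \<noteq> idx e" using idx_eq assms by simp
  assume R: "(X x d < X x e \<longleftrightarrow> X y d < X y e) \<and> (X x e < X x d \<longleftrightarrow> X y e < X y d)"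
  define a :: "real ^ 'n" where "a = axis (idx d) 1 - axis (idx e) 1"
  have ai: "a \<bullet> z = X z d - X z e" for z by (simp add: a_def inner_diff_left inner_axis')
  have "a $ idx d = 1" using ne by (simp add: a_def axis_def)
  then have a0: "a \<noteq> 0" by auto
  have H1: "{z. X z d = X z e} = {z. a \<bullet> z = 0}" "{z. X z d = X z e} = {z. (- a) \<bullet> z = 0}"
    by (auto simp: ai)
  consider "X x d = X x e" | "X x d < X x e" | "X x e < X x d" by linarith
  then show "same_position {z. X z d = X z e} x y"
  proof cases
    case 1
    then have "X y d = X y e" using R by auto
    then show ?thesis using 1 unfolding same_position_def by simp
  next
    case 2
    then have "a \<bullet> x < 0" "a \<bullet> y < 0" using R by (auto simp: ai)
    then show ?thesis unfolding same_position_def using a0 H1(1) by blast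
  next
    case 3
    then have "(- a) \<bullet> x < 0" "(- a) \<bullet> y < 0" using R by (auto simp: ai)
    then show ?thesis unfolding same_position_def using a0 H1(2) by (metis neg_equal_0_iff_equal)
  qed
next
  assume sp: "same_position {z. X z d = X z e} x y"
  show "(X x d < X x e \<longleftrightarrow> X y d < X y e) \<and> (X x e < X x d \<longleftrightarrow> X y e < X y d)"
  proof (cases "X x d = X x e \<and> X y d = X y e")
    case True
    then show ?thesis by simp
  next
    case False
    then obtain a b where ab: "{z. X z d = X z e} = {z. a \<bullet> z = b}" "a \<bullet> x < b" "a \<bullet> y < b"
      using sp unfolding same_position_def by blast
    have "0 \<in> {z. a \<bullet> z = b}" unfolding ab(1)[symmetric] by simp
    then have b: "b = 0" by simp
    have no: "X z d \<noteq> X z e" if "a \<bullet> z < 0" for z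
      using that ab(1) b by (metis (mono_tags, lifting) less_irrefl mem_Collect_eq)
    define p q where "p = X x d - X x e" and "q = X y d - X y e"
    have "0 < p * q"
    proof (rule ccontr)
      assume "\<not> 0 < p * q"
      moreover have "p \<noteq> 0" "q \<noteq> 0" using no ab b by (auto simp: p_def q_def)
      ultimately have "p * q < 0" by (simp add: not_less order.order_iff_strict)
      \<comment> \<open>If the two differences had opposite signs, this positive combination of
        \<open>x\<close> and \<open>y\<close> would lie on the hyperplane, although the functional
        \<open>a\<close> is negative at both points.\<close>
      define z where "z = \<bar>q\<bar> *\<^sub>R x + \<bar>p\<bar> *\<^sub>R y"
      have "X z d - X z e = \<bar>q\<bar> * p + \<bar>p\<bar> * q" by (simp add: z_def p_def q_def algebra_simps)
      also have "\<dots> = 0" using \<open>p * q < 0\<close> by (auto simp: mult_less_0_iff)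
      finally have "X z d = X z e" by simp
      moreover have "\<bar>q\<bar> * (a \<bullet> x) < 0" "\<bar>p\<bar> * (a \<bullet> y) < 0"
        using ab b \<open>p \<noteq> 0\<close> \<open>q \<noteq> 0\<close> by (auto simp: mult_less_0_iff)
      then have "a \<bullet> z < 0" by (simp add: z_def inner_add_right)
      ultimately show False using no by blast
    qed
    then show ?thesis by (auto simp: p_def q_def zero_less_mult_iff)
  qed
qed

lemma facets_braid: "F \<in> facets (braid idx n) \<longleftrightarrow> (\<exists>x. F = cell x)"
proof -
  have "(\<forall>H\<in>braid idx n. same_position H x y) \<longleftrightarrow> y \<in> cell x" for x y
  proof
    assume H: "\<forall>H\<in>braid idx n. same_position H x y"
    have *: "(X x i < X x j \<longleftrightarrow> X y i < X y j) \<and> (X x j < X x i \<longleftrightarrow> X y j < X y i)" if "1 \<le> i" "i < j" "j \<le> N" for i j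
    proof -
      have "{z. X z i = X z j} \<in> braid idx n" unfolding braid_def using that NN by blast
      then show ?thesis using H same_position_braid[of i j x y] that by auto
    qed
    show "y \<in> cell x" unfolding cell_def
    proof (intro CollectI ballI)
      fix d e assume "d \<in> {1..N}" "e \<in> {1..N}"
      then show "X y d < X y e \<longleftrightarrow> X x d < X x e" using *[of d e] *[of e d] by (cases d e rule: linorder_cases) auto
    qed
  next
    assume y: "y \<in> cell x"
    show "\<forall>H\<in>braid idx n. same_position H x y"
    proof
      fix H assume "H \<in> braid idx n"
      then obtain i j where ij: "1 \<le> i" "i < j" "j \<le> n + 1" "H = {x. X x i = X x j}" unfolding braid_def by blast
      then have "i \<in> {1..N}" "j \<in> {1..N}" "i \<noteq> j" using NN by auto
      then show "same_position H x y" unfolding ij(4) using same_position_braid[of i j x y] y unfolding cell_def by blast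
    qed
  qed
  then have "{(x, y). \<forall>H\<in>braid idx n. same_position H x y} `` {x} = cell x" for x by auto
  then show ?thesis unfolding facets_def quotient_def by auto
qed

lemma cell_self: "x \<in> cell x" by (simp add: cell_def)

text \<open>Facets of the braid arrangement are invariant under translations along the
  diagonal.\<close>

lemma cell_unbounded: "\<not> bounded (cell x)"
proof
  assume "bounded (cell x)"
  then obtain B where B: "\<And>y. y \<in> cell x \<Longrightarrow> norm y \<le> B" unfolding bounded_iff by blast
  define t where "t = \<bar>B\<bar> + 1 - X x 1"
  define y where "y = x + t *\<^sub>R (\<chi> a. 1)"
  have "y \<in> cell x" by (simp add: cell_def y_def)
  then have "\<bar>X y 1\<bar> \<le> B" using B component_le_norm_cart[of y "idx 1"] by (meson order_trans)
  moreover have "X y 1 = \<bar>B\<bar> + 1" by (simp add: y_def t_def)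
  ultimately show False by simp
qed

lemma cell_scale: "0 < t \<Longrightarrow> t *\<^sub>R x \<in> cell x"
  by (simp add: cell_def)

text \<open>The cell is cut out of its flat by finitely many strict inequalities, so it is a
  nonempty relatively open subset of the flat and has the same affine dimension.\<close>

lemma aff_dim_cell:
  assumes P: "valid N P" "\<And>d e. d \<in> {1..N} \<Longrightarrow> e \<in> {1..N} \<Longrightarrow> rep P d = rep P e \<longleftrightarrow> X x d = X x e"
  shows "aff_dim (cell x) = int (dim (code_flat P))" "cell x \<subseteq> code_flat P"
proof -
  have sub: "y \<in> code_flat P" if y: "y \<in> cell x" for y
    unfolding code_flat_def
  proof (intro CollectI, clarify)
    fix b c assume bc: "(b, c) \<in> set P"
    have r: "b \<in> {1..N}" "c \<in> {1..N}" using valid_fst[OF P(1) bc] by auto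
    have "rep P b = rep P c" using rep_snd[OF P(1) bc] rep_rep[OF P(1), of b] by simp
    then show "X y b = X y c" using P(2)[OF r] cell_eq[OF y r] by simp
  qed
  then show "cell x \<subseteq> code_flat P" by blast
  define U where "U = (\<Inter>d\<in>{1..N}. \<Inter>e\<in>{e\<in>{1..N}. X x d < X x e}. {y. X y d < X y e})"
  have "open {y::real^'n. X y d < X y e}" for d e by (intro open_Collect_less continuous_intros)
  then have "open U" unfolding U_def by (intro open_INT ballI) auto
  have "cell x = code_flat P \<inter> U"
  proof
    show "cell x \<subseteq> code_flat P \<inter> U" using sub unfolding U_def cell_def by blast
    show "code_flat P \<inter> U \<subseteq> cell x"
    proof
      fix y assume y: "y \<in> code_flat P \<inter> U"
      have lt: "X y d < X y e" if "d \<in> {1..N}" "e \<in> {1..N}" "X x d < X x e" for d e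
        using y that unfolding U_def by blast
      have eq: "X y d = X y e" if "d \<in> {1..N}" "e \<in> {1..N}" "X x d = X x e" for d e
      proof -
        have "rep P d = rep P e" using P(2) that by blast
        then show ?thesis using code_flat_rep[OF P(1), of y] y by (metis IntD1)
      qed
      show "y \<in> cell x" unfolding cell_def
      proof (intro CollectI ballI)
        fix d e assume de: "d \<in> {1..N}" "e \<in> {1..N}"
        show "X y d < X y e \<longleftrightarrow> X x d < X x e"
          using lt[OF de] lt[OF de(2,1)] eq[OF de] by (cases "X x d" "X x e" rule: linorder_cases) auto
      qed
    qed
  qed
  then have "openin (top_of_set (code_flat P)) (cell x)" using \<open>open U\<close> by (simp add: openin_open_Int)
  then have "aff_dim (cell x) = aff_dim (code_flat P)"
    using cell_self[of x] by (intro aff_dim_openin subspace_imp_affine subspace_code_flat) auto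
  then show "aff_dim (cell x) = int (dim (code_flat P))" using aff_dim_subspace[OF subspace_code_flat] by simp
qed

lemma tableau_of_cell:
  assumes P: "valid N P" "\<And>d e. d \<in> {1..N} \<Longrightarrow> e \<in> {1..N} \<Longrightarrow> rep P d = rep P e \<longleftrightarrow> X x d = X x e"
  shows "tableau_of idx (length P) n (cell x) = level_rows (X x) {1..N}"
  unfolding tableau_of_def
proof (rule the_equality)
  have "card (X x ` {1..n+1}) + length P = n + 1"
    using card_code_classes[OF P(1), of "X x"] P(2) NN by simp
  then have "is_tableau (length P) n (level_rows (X x) {1..n+1})" by (rule is_tableau_level_rows)
  moreover have "represents idx (level_rows (X x) {1..N}) (cell x)"
    unfolding represents_def cell_def by (simp add: tableau_cell_level_rows)
  ultimately show "is_tableau (length P) n (level_rows (X x) {1..N}) \<and> represents idx (level_rows (X x) {1..N}) (cell x)"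
    using NN by simp
next
  fix T assume T: "is_tableau (length P) n T \<and> represents idx T (cell x)"
  then have T': "T = level_rows (row_of T) {1..N}" using is_tableau_eq_level_rows NN by blast
  have "X x \<in> tableau_cell T" using T cell_self[of x] unfolding represents_def by blast
  then have "X x \<in> tableau_cell (level_rows (row_of T) {1..N})" using T' by (rule subst[rotated])
  then have "\<forall>i\<in>{1..N}. \<forall>j\<in>{1..N}. X x i < X x j \<longleftrightarrow> row_of T i < row_of T j"
    unfolding tableau_cell_level_rows[OF finite_atLeastAtMost] by blast
  then have "level_rows (X x) {1..N} = level_rows (row_of T) {1..N}" by (intro level_rows_eqI) auto
  then show "T = level_rows (X x) {1..N}" using T' by simp
qed

end

section \<open>The polar order\<close>

locale braid_frame = braid_polys n idx N \<beta> s pp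
  for n :: nat and idx :: "nat \<Rightarrow> 'n::finite" and N \<beta> s pp +
  fixes e :: "nat \<Rightarrow> real ^ 'n"
  assumes e_orth: "orthonormal_frame e"
    and e_span: "\<And>k. k \<le> N \<Longrightarrow> span (e ` {1..k}) = span (monom_vec ` {1..k})"
    and e_pos: "\<And>k. k \<in> {1..N} \<Longrightarrow> 0 < monom_vec k \<bullet> e k"

sublocale braid_frame \<subseteq> fr: frame e N
  by unfold_locales (use dimN n NN e_orth in auto)

context braid_frame
begin

lemma transversal_code_flat:
  assumes "valid N P"
  shows "fr.transversal (code_flat P) (length P)"
proof -
  let ?W = "span (e ` {1..length P})"
  have k: "length P < N" by (rule length_less[OF assms])
  have inter: "code_flat P \<inter> ?W \<subseteq> {0}" using code_flat_inter_span[OF assms] e_span[of "length P"] k by simp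
  have "dim (code_flat P \<inter> ?W) = 0" using inter by (simp add: dim_eq_0)
  moreover have "dim {x + y |x y. x \<in> code_flat P \<and> y \<in> ?W} \<le> N"
    using dim_subset_UNIV[of "{x + y |x y. x \<in> code_flat P \<and> y \<in> ?W}"] dimN by simp
  moreover have "dim ?W = length P" using fr.dim_span_e[of "length P"] k by simp
  ultimately have "dim (code_flat P) + length P \<le> N"
    using dim_sums_Int[OF subspace_code_flat[of P] subspace_span[of "e ` {1..length P}"]] by linarith
  then show ?thesis
    using dim_code_flat_ge[OF assms] k inter subspace_code_flat unfolding fr.transversal_def by simp
qed

lemma span_monom_vec_inner: "m \<le> N \<Longrightarrow> x \<in> span (monom_vec ` {1..m}) \<Longrightarrow> j \<in> {m<..N} \<Longrightarrow> x \<bullet> e j = 0"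
  using fr.span_e_iff[of m x] e_span[of m] by simp

lemma sum_monom_vec_span: "(\<Sum>i<m. c i *\<^sub>R monom_vec (Suc i)) \<in> span (monom_vec ` {1..m})"
  by (intro span_sum span_scale span_base) auto

lemma poly_vec_pp:
  assumes "valid N P"
  shows "poly_vec (pp P 0) = monom_vec (Suc (length P)) + (\<Sum>i<length P. coeff (pp P 0) i *\<^sub>R monom_vec (Suc i))"
proof -
  have c: "coeff (pp P 0) (length P) = 1" "\<forall>i>length P. coeff (pp P 0) i = 0"
    using cp0[OF assms] unfolding code_poly_def by auto
  have "poly_vec (pp P 0) = (\<Sum>i<Suc (length P). coeff (pp P 0) i *\<^sub>R monom_vec (Suc i))"
    unfolding poly_vec_expand[OF c(2)] lessThan_Suc_atMost ..
  then show ?thesis using c(1) by simp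
qed

text \<open>The vector of \<open>pp P 0\<close> lies on the flat and in the span of the first
  \<open>length P + 1\<close> frame vectors. Scaled to have the last of these coordinates equal to
  1, it differs from \<open>e (Suc (length P))\<close> by a vector in the span of the first
  \<open>length P\<close> frame vectors.\<close>

lemma proj_code_flat:
  assumes "valid N P"
  shows "fr.proj (code_flat P) (length P) (e (Suc (length P))) =
    (1 / (monom_vec (Suc (length P)) \<bullet> e (Suc (length P)))) *\<^sub>R poly_vec (pp P 0)"
proof (rule fr.proj_unique[OF transversal_code_flat[OF assms]])
  let ?k = "length P"
  let ?g = "monom_vec (Suc ?k) \<bullet> e (Suc ?k)"
  have k: "?k < N" by (rule length_less[OF assms])
  have g: "0 < ?g" using e_pos[of "Suc ?k"] k by simp
  have "sat \<beta> s P (pp P 0)" using cp0[OF assms] unfolding code_poly_def by blast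
  then show "(1 / ?g) *\<^sub>R poly_vec (pp P 0) \<in> code_flat P"
    using code_flat_poly_vec[OF assms] subspace_code_flat by (intro subspace_scale) auto
  have in_span: "poly_vec (pp P 0) \<in> span (monom_vec ` {1..Suc ?k})"
    unfolding poly_vec_pp[OF assms] by (intro span_add span_sum span_scale span_base) auto
  have ek: "poly_vec (pp P 0) \<bullet> e (Suc ?k) = ?g"
    unfolding poly_vec_pp[OF assms] inner_add_left
    using span_monom_vec_inner[OF _ sum_monom_vec_span, of ?k "Suc ?k"] k by simp
  have "(e (Suc ?k) - (1 / ?g) *\<^sub>R poly_vec (pp P 0)) \<bullet> e i = 0" if i: "i \<in> {?k<..N}" for i
  proof (cases "i = Suc ?k")
    case True
    then show ?thesis using ek g fr.orthD[of i i] i by (simp add: inner_diff_left)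
  next
    case False
    then have "poly_vec (pp P 0) \<bullet> e i = 0" using span_monom_vec_inner[OF _ in_span, of i] i k by auto
    then show ?thesis using False i fr.orthD[of "Suc ?k" i] by (simp add: inner_diff_left)
  qed
  then show "e (Suc ?k) - (1 / ?g) *\<^sub>R poly_vec (pp P 0) \<in> span (e ` {1..?k})"
    using fr.span_e_iff[of ?k] k by simp
qed

text \<open>The right side is an increasing function of the second coefficient of
  \<open>pp P 0\<close>, because both diagonal inner products are positive. This is the link between
  the order of codes and the polar order.\<close>

lemma proj_code_flat_inner:
  assumes "valid N P" "length P = Suc k"
  shows "fr.proj (code_flat P) (Suc k) (e (Suc (Suc k))) \<bullet> e (Suc k) =
    (monom_vec (Suc (Suc k)) \<bullet> e (Suc k) + coeff (pp P 0) k * (monom_vec (Suc k) \<bullet> e (Suc k))) / (monom_vec (Suc (Suc k)) \<bullet> e (Suc (Suc k)))"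
proof -
  have kN: "Suc k < N" using length_less[OF assms(1)] assms(2) by simp
  have "poly_vec (pp P 0) \<bullet> e (Suc k) = monom_vec (Suc (Suc k)) \<bullet> e (Suc k) + coeff (pp P 0) k * (monom_vec (Suc k) \<bullet> e (Suc k))"
    unfolding poly_vec_pp[OF assms(1)] assms(2) sum.lessThan_Suc inner_add_left inner_scaleR_left
    using span_monom_vec_inner[OF _ sum_monom_vec_span, of k "Suc k"] kN by simp
  then show ?thesis using proj_code_flat[OF assms(1)] unfolding assms(2) by simp
qed

definition pt_of :: "code \<Rightarrow> real \<Rightarrow> real ^ 'n" where
  "pt_of P \<epsilon> = fr.pnt (code_flat P) (length P) \<epsilon>"

lemma pt_of_inter: "valid N P \<Longrightarrow> code_flat P \<inter> coord_space (fr.org \<epsilon>) e (length P) = {pt_of P \<epsilon>}"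
  unfolding pt_of_def by (rule fr.pnt_unique[OF transversal_code_flat])

text \<open>The leading term of the point is a negative multiple of the vector of
  \<open>pp P 0\<close>, whose coordinates are negated values up to a common shift. The signs
  cancel, so the order is that of the values and hence of the weights; ties are exact because the
  point lies on the flat.\<close>

lemma pt_of_order:
  assumes P: "valid N P"
  shows "\<forall>\<^sub>F \<epsilon> in at_right 0. \<forall>d\<in>{1..N}. \<forall>d'\<in>{1..N}. X (pt_of P \<epsilon>) d < X (pt_of P \<epsilon>) d' \<longleftrightarrow> wt P d < wt P d'"
proof -
  let ?k = "length P"
  let ?g = "monom_vec (Suc ?k) \<bullet> e (Suc ?k)"
  have k: "?k < N" by (rule length_less[OF P])
  have g: "0 < ?g" using e_pos[of "Suc ?k"] k by simp
  have lim: "((\<lambda>\<epsilon>. (pt_of P \<epsilon> /\<^sub>R \<epsilon> ^ Suc ?k) $ a) \<longlongrightarrow> (- ((1 / ?g) *\<^sub>R poly_vec (pp P 0))) $ a) (at_right 0)" for a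
    using tendsto_vec_nth[OF fr.pnt_tendsto[OF transversal_code_flat[OF P]]] unfolding pt_of_def proj_code_flat[OF P] .
  have "\<forall>\<^sub>F \<epsilon> in at_right 0. \<forall>d\<in>{1..N}. \<forall>d'\<in>{1..N}. wt P d < wt P d' \<longrightarrow> X (pt_of P \<epsilon>) d < X (pt_of P \<epsilon>) d'"
  proof (intro eventually_ball_finite ballI)
    fix d d' assume d: "d \<in> {1..N}" "d' \<in> {1..N}"
    show "\<forall>\<^sub>F \<epsilon> in at_right 0. wt P d < wt P d' \<longrightarrow> X (pt_of P \<epsilon>) d < X (pt_of P \<epsilon>) d'"
    proof (cases "wt P d < wt P d'")
      case True
      then have "val \<beta> s d (pp P 0) < val \<beta> s d' (pp P 0)" using val_order0[OF P d] by simp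
      then have lt: "0 < (- ((1 / ?g) *\<^sub>R poly_vec (pp P 0))) $ idx d' - (- ((1 / ?g) *\<^sub>R poly_vec (pp P 0))) $ idx d"
        using X_poly_vec[OF d(1), of "pp P 0"] X_poly_vec[OF d(2), of "pp P 0"] g by (simp add: field_simps)
      have "\<forall>\<^sub>F \<epsilon> in at_right 0. 0 < (pt_of P \<epsilon> /\<^sub>R \<epsilon> ^ Suc ?k) $ idx d' - (pt_of P \<epsilon> /\<^sub>R \<epsilon> ^ Suc ?k) $ idx d"
        by (rule order_tendstoD(1)[OF tendsto_diff[OF lim lim] lt])
      then show ?thesis using eventually_at_right_less[of "0::real"]
      proof eventually_elim
        case (elim \<epsilon>)
        have "(pt_of P \<epsilon> /\<^sub>R \<epsilon> ^ Suc ?k) $ idx d' - (pt_of P \<epsilon> /\<^sub>R \<epsilon> ^ Suc ?k) $ idx d =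
          (X (pt_of P \<epsilon>) d' - X (pt_of P \<epsilon>) d) / \<epsilon> ^ Suc ?k"
          by (simp add: divide_inverse algebra_simps del: power_Suc)
        then have "0 < (X (pt_of P \<epsilon>) d' - X (pt_of P \<epsilon>) d) / \<epsilon> ^ Suc ?k" using elim(1) by simp
        then show ?case using elim(2) by (simp add: zero_less_divide_iff del: power_Suc)
      qed
    qed simp
  qed auto
  then show ?thesis
  proof eventually_elim
    case (elim \<epsilon>)
    show ?case
    proof (intro ballI)
      fix d d' assume d: "d \<in> {1..N}" "d' \<in> {1..N}"
      have "pt_of P \<epsilon> \<in> code_flat P" using pt_of_inter[OF P, of \<epsilon>] by blast
      then have "X (pt_of P \<epsilon>) d = X (pt_of P \<epsilon>) d'" if "wt P d = wt P d'"
        using that wt_eq_iff[OF P, of d d'] code_flat_rep[OF P] d by (metis atLeastAtMost_iff)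
      moreover have "wt P d < wt P d' \<Longrightarrow> X (pt_of P \<epsilon>) d < X (pt_of P \<epsilon>) d'"
        "wt P d' < wt P d \<Longrightarrow> X (pt_of P \<epsilon>) d' < X (pt_of P \<epsilon>) d" using elim d by blast+
      ultimately show "X (pt_of P \<epsilon>) d < X (pt_of P \<epsilon>) d' \<longleftrightarrow> wt P d < wt P d'"
        by (cases "wt P d" "wt P d'" rule: linorder_cases) auto
    qed
  qed
qed

lemma pt_of_less:
  assumes P: "valid N P" and Q: "valid N Q" and len: "length P = length Q" "P \<noteq> []" and less: "code_less P Q"
  shows "\<forall>\<^sub>F \<epsilon> in at_right 0. polar_less (fr.org \<epsilon>) e (pt_of P \<epsilon>) (pt_of Q \<epsilon>)"
proof -
  obtain k where k: "length P = Suc k" using len(2) by (cases P) auto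
  then have kQ: "length Q = Suc k" using len(1) by simp
  have kN: "Suc k < N" using length_less[OF P] k by simp
  have g: "0 < monom_vec (Suc k) \<bullet> e (Suc k)" "0 < monom_vec (Suc (Suc k)) \<bullet> e (Suc (Suc k))"
    using e_pos[of "Suc k"] e_pos[of "Suc (Suc k)"] kN by auto
  have "coeff (pp Q 0) k < coeff (pp P 0) k" using less_coeff[OF P Q len(1) less] k by simp
  then have "fr.proj (code_flat Q) (Suc k) (e (Suc (Suc k))) \<bullet> e (Suc k) < fr.proj (code_flat P) (Suc k) (e (Suc (Suc k))) \<bullet> e (Suc k)"
    unfolding proj_code_flat_inner[OF P k] proj_code_flat_inner[OF Q kQ] using g by (simp add: divide_strict_right_mono)
  then show ?thesis
    using fr.polar_less_eventually[of "code_flat P" "Suc k" "code_flat Q"] transversal_code_flat[OF P] transversal_code_flat[OF Q] k kQ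
    unfolding pt_of_def by simp
qed

lemma flat_transversal:
  assumes "L \<in> codim_flats (braid idx n) k"
  shows "\<exists>P. valid N P \<and> length P = k \<and> L = code_flat P"
proof -
  obtain P where P: "valid N P" "L = code_flat P" using flat_code[OF assms] by blast
  have "aff_dim L = int N - int k" using assms dimN unfolding codim_flats_def by simp
  moreover have "aff_dim L = int (dim (code_flat P))" using P(2) aff_dim_subspace[OF subspace_code_flat] by simp
  moreover have "dim (code_flat P) + length P = N" using transversal_code_flat[OF P(1)] unfolding fr.transversal_def by blast
  ultimately have "length P = k" by simp
  then show ?thesis using P by blast
qed

lemma codim_cell:
  assumes "valid N P" "\<And>d d'. d \<in> {1..N} \<Longrightarrow> d' \<in> {1..N} \<Longrightarrow> rep P d = rep P d' \<longleftrightarrow> X x d = X x d'"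
  shows "cell x \<in> codim_facets (braid idx n) k \<longleftrightarrow> length P = k"
proof -
  have "aff_dim (cell x) = int (dim (code_flat P))" using assms by (rule aff_dim_cell)
  moreover have "dim (code_flat P) + length P = N" using transversal_code_flat[OF assms(1)] unfolding fr.transversal_def by blast
  moreover have "cell x \<in> facets (braid idx n)" using facets_braid by blast
  then have "cell x \<in> codim_facets (braid idx n) k \<longleftrightarrow> aff_dim (cell x) = int N - int k"
    unfolding codim_facets_def dimN by simp
  ultimately show ?thesis by linarith
qed

lemma proj_bound: "\<exists>C\<ge>1. \<forall>P. valid N P \<longrightarrow> (\<forall>x. norm (fr.proj (code_flat P) (length P) x) \<le> C * norm x)"
proof -
  have "\<exists>B. \<forall>x. norm (fr.proj (code_flat P) (length P) x) \<le> B * norm x" if "valid N P" for P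
    using linear_bounded[OF fr.proj_linear[OF transversal_code_flat[OF that]]] .
  then obtain B where B: "\<And>P x. valid N P \<Longrightarrow> norm (fr.proj (code_flat P) (length P) x) \<le> B P * norm x" by metis
  define C where "C = 1 + (\<Sum>P\<in>{P. valid N P}. \<bar>B P\<bar>)"
  have "B P \<le> C" if "valid N P" for P
  proof -
    have "\<bar>B P\<bar> \<le> (\<Sum>P\<in>{P. valid N P}. \<bar>B P\<bar>)"
      using that by (intro member_le_sum finite_valid) auto
    then show ?thesis unfolding C_def by simp
  qed
  then have "norm (fr.proj (code_flat P) (length P) x) \<le> C * norm x" if "valid N P" for P x
    using B[OF that, of x] that by (meson mult_right_mono norm_ge_zero order_trans)
  moreover have "1 \<le> C" unfolding C_def by (simp add: sum_nonneg)
  ultimately show ?thesis by blast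
qed

text \<open>One \<epsilon> is taken that is small enough for all codes and all pairs of codes. A
  facet of codimension \<open>k\<close> has at most the point of its code in common with V_k, so it
  meets V_k exactly when its tableau is that of a code. The list of points increases strictly in the
  polar order, and this order is asymmetric, so positions in the list and polar comparisons
  determine each other.\<close>

lemma generic_polar_pi_tab:
  "\<exists>(org :: real ^ 'n) e.
    orthonormal_frame e \<and>
    generic_polar (braid idx n) org e \<and>
    (\<forall>k\<le>n.
       (\<forall>F\<in>codim_facets (braid idx n) k.
          F \<inter> coord_space org e k \<noteq> {} \<longleftrightarrow> tableau_of idx k n F \<in> set (pi_tab k n)) \<and>
       (\<forall>F\<in>codim_facets (braid idx n) k. \<forall>F'\<in>codim_facets (braid idx n) k.
          F \<inter> coord_space org e k \<noteq> {} \<and> F' \<inter> coord_space org e k \<noteq> {} \<longrightarrow>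
          (polar_facet_less org e k F F' \<longleftrightarrow>
             listed_before (pi_tab k n) (tableau_of idx k n F) (tableau_of idx k n F'))))"
proof -
  obtain C where C: "1 \<le> C" "\<And>P x. valid N P \<Longrightarrow> norm (fr.proj (code_flat P) (length P) x) \<le> C * norm x"
    using proj_bound by blast
  let ?V = "{P. valid N P}"
  have "\<forall>\<^sub>F \<epsilon> in at_right 0. \<forall>P\<in>?V. \<forall>d\<in>{1..N}. \<forall>d'\<in>{1..N}. X (pt_of P \<epsilon>) d < X (pt_of P \<epsilon>) d' \<longleftrightarrow> wt P d < wt P d'"
    using pt_of_order by (intro eventually_ball_finite finite_valid) auto
  moreover have "\<forall>\<^sub>F \<epsilon> in at_right 0. \<forall>PQ\<in>?V \<times> ?V.
      length (fst PQ) = length (snd PQ) \<and> fst PQ \<noteq> [] \<and> code_less (fst PQ) (snd PQ) \<longrightarrow>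
      polar_less (fr.org \<epsilon>) e (pt_of (fst PQ) \<epsilon>) (pt_of (snd PQ) \<epsilon>)"
    using finite_valid[of N] by (intro eventually_ball_imp pt_of_less) auto
  moreover have "\<forall>\<^sub>F \<epsilon> in at_right (0::real). \<epsilon> \<in> {0<..<1 / (100 * C)}"
    using C(1) by (intro eventually_at_right_real) simp
  ultimately have "\<forall>\<^sub>F \<epsilon> in at_right 0. (\<forall>P\<in>?V. \<forall>d\<in>{1..N}. \<forall>d'\<in>{1..N}. X (pt_of P \<epsilon>) d < X (pt_of P \<epsilon>) d' \<longleftrightarrow> wt P d < wt P d') \<and>
      (\<forall>PQ\<in>?V \<times> ?V. length (fst PQ) = length (snd PQ) \<and> fst PQ \<noteq> [] \<and> code_less (fst PQ) (snd PQ) \<longrightarrow>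
      polar_less (fr.org \<epsilon>) e (pt_of (fst PQ) \<epsilon>) (pt_of (snd PQ) \<epsilon>)) \<and> \<epsilon> \<in> {0<..<1 / (100 * C)}"
    by (intro eventually_conj)
  then obtain \<epsilon> where ord: "\<forall>P\<in>?V. \<forall>d\<in>{1..N}. \<forall>d'\<in>{1..N}. X (pt_of P \<epsilon>) d < X (pt_of P \<epsilon>) d' \<longleftrightarrow> wt P d < wt P d'"
    and less: "\<forall>PQ\<in>?V \<times> ?V. length (fst PQ) = length (snd PQ) \<and> fst PQ \<noteq> [] \<and> code_less (fst PQ) (snd PQ) \<longrightarrow>
      polar_less (fr.org \<epsilon>) e (pt_of (fst PQ) \<epsilon>) (pt_of (snd PQ) \<epsilon>)"
    and \<epsilon>: "\<epsilon> \<in> {0<..<1 / (100 * C)}"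
    using eventually_happens[of _ "at_right (0::real)"] trivial_limit_at_right_real[of "0::real"] by blast
  define o' where "o' = fr.org \<epsilon>"
  have ord: "X (pt_of P \<epsilon>) d < X (pt_of P \<epsilon>) d' \<longleftrightarrow> wt P d < wt P d'" if "valid N P" "d \<in> {1..N}" "d' \<in> {1..N}" for P d d'
    using ord that by blast
  have less: "polar_less o' e (pt_of P \<epsilon>) (pt_of Q \<epsilon>)"
    if "valid N P" "valid N Q" "length P = length Q" "P \<noteq> []" "code_less P Q" for P Q
    using less that unfolding o'_def by auto
  have \<epsilon>0: "0 < \<epsilon>" "\<epsilon> \<le> 1 / (100 * C)" using \<epsilon> by auto
  have tab_pt: "level_rows (X (pt_of P \<epsilon>)) {1..N} = code_tab N P" if "valid N P" for P
    using ord[OF that] by (intro level_rows_eqI) auto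
  have rep_pt: "rep P d = rep P d' \<longleftrightarrow> X (pt_of P \<epsilon>) d = X (pt_of P \<epsilon>) d'"
    if "valid N P" "d \<in> {1..N}" "d' \<in> {1..N}" for P d d'
  proof -
    have "rep P d = rep P d' \<longleftrightarrow> wt P d = wt P d'" using wt_eq_iff[OF that(1), of d d'] that by simp
    then show ?thesis using ord[OF that] ord[OF that(1,3,2)] by (cases "wt P d" "wt P d'" rule: linorder_cases) auto
  qed
  have "generic_polar (braid idx n) o' e"
    unfolding o'_def
  proof (rule fr.generic_polar_org[OF C(1) \<epsilon>0])
    fix k L assume "L \<in> codim_flats (braid idx n) k"
    then obtain P where "valid N P" "length P = k" "L = code_flat P" using flat_transversal by blast
    then show "fr.transversal L k \<and> (\<forall>x. norm (fr.proj L k x) \<le> C * norm x)"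
      using transversal_code_flat C(2) by blast
  next
    fix F assume "F \<in> facets (braid idx n)"
    then obtain x where "F = cell x" using facets_braid by blast
    then show "\<not> bounded F \<and> (\<exists>x. \<forall>t>0. t *\<^sub>R x \<in> F)" using cell_unbounded cell_scale by blast
  next
    have v: "valid N []" by simp
    have "fr.org \<epsilon> \<in> code_flat []" "fr.org \<epsilon> \<in> coord_space (fr.org \<epsilon>) e 0"
      by (simp_all add: mem_code_flat coord_space_def)
    \<comment> \<open>The space V_0 consists of the origin alone, so the origin is the point of the
      empty code. Its coordinates are pairwise different, as the weights of that code are, and this
      puts it into a chamber.\<close>
    then have "fr.org \<epsilon> = pt_of [] \<epsilon>" using pt_of_inter[OF v, of \<epsilon>] by auto
    then show "\<exists>F\<in>codim_facets (braid idx n) 0. fr.org \<epsilon> \<in> F"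
      using codim_cell[OF v, of "pt_of [] \<epsilon>" 0] rep_pt[OF v] cell_self[of "pt_of [] \<epsilon>"] by auto
  qed
  moreover have "(\<forall>F\<in>codim_facets (braid idx n) k.
          F \<inter> coord_space o' e k \<noteq> {} \<longleftrightarrow> tableau_of idx k n F \<in> set (pi_tab k n)) \<and>
       (\<forall>F\<in>codim_facets (braid idx n) k. \<forall>F'\<in>codim_facets (braid idx n) k.
          F \<inter> coord_space o' e k \<noteq> {} \<and> F' \<inter> coord_space o' e k \<noteq> {} \<longrightarrow>
          (polar_facet_less o' e k F F' \<longleftrightarrow>
             listed_before (pi_tab k n) (tableau_of idx k n F) (tableau_of idx k n F')))"
    if kn: "k \<le> n" for k
  proof -
    define cs where "cs = codes k N"
    have kN: "k < N" using kn NN by simp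
    have cs: "set cs = {P. valid N P \<and> length P = k}" unfolding cs_def by (rule set_codes[OF kN])
    have srt: "sorted_wrt code_less cs" unfolding cs_def by (rule sorted_codes[OF kN])
    have pi: "pi_tab k n = map (code_tab N) cs" using pi_tab_codes[OF kn] NN by (simp add: cs_def)
    have facet: "\<exists>x P. F = cell x \<and> valid N P \<and> length P = k \<and> tableau_of idx k n F = level_rows (X x) {1..N} \<and>
        F \<inter> coord_space o' e k \<subseteq> {pt_of P \<epsilon>}" if F: "F \<in> codim_facets (braid idx n) k" for F
    proof -
      obtain x where x: "F = cell x" using F facets_braid unfolding codim_facets_def by blast
      obtain P where P: "valid N P" "\<And>d d'. d \<in> {1..N} \<Longrightarrow> d' \<in> {1..N} \<Longrightarrow> rep P d = rep P d' \<longleftrightarrow> X x d = X x d'"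
        using code_exists[of N "X x"] by blast
      have k: "length P = k" using codim_cell[OF P] F x by blast
      have "tableau_of idx k n F = level_rows (X x) {1..N}" using tableau_of_cell[OF P] k x by simp
      moreover have "cell x \<subseteq> code_flat P" using P by (rule aff_dim_cell(2))
      then have "F \<inter> coord_space o' e k \<subseteq> {pt_of P \<epsilon>}" using pt_of_inter[OF P(1), of \<epsilon>] k x unfolding o'_def by blast
      ultimately show ?thesis using x P(1) k by blast
    qed
    have pt_in: "pt_of Q \<epsilon> \<in> F \<inter> coord_space o' e k"
      if F: "F \<in> codim_facets (braid idx n) k" and Q: "Q \<in> set cs" "tableau_of idx k n F = code_tab N Q" for F Q
    proof -
      obtain x where x: "F = cell x" "tableau_of idx k n F = level_rows (X x) {1..N}" using facet[OF F] by blast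
      have Qv: "valid N Q" "length Q = k" using Q cs by auto
      have "X (pt_of Q \<epsilon>) d < X (pt_of Q \<epsilon>) d' \<longleftrightarrow> X x d < X x d'" if d: "d \<in> {1..N}" "d' \<in> {1..N}" for d d'
      proof -
        have "wt Q d < wt Q d' \<longleftrightarrow> row_of (code_tab N Q) d < row_of (code_tab N Q) d'"
          using row_of_level_rows[of "{1..N}" d d' "wt Q"] d by simp
        also have "code_tab N Q = level_rows (X x) {1..N}" using x Q by simp
        also have "row_of (level_rows (X x) {1..N}) d < row_of (level_rows (X x) {1..N}) d' \<longleftrightarrow> X x d < X x d'"
          using row_of_level_rows[of "{1..N}" d d' "X x"] d by simp
        finally show ?thesis using ord[OF Qv(1) d] by simp
      qed
      then have "pt_of Q \<epsilon> \<in> F" unfolding x cell_def by blast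
      moreover have "pt_of Q \<epsilon> \<in> coord_space o' e k" using pt_of_inter[OF Qv(1), of \<epsilon>] Qv unfolding o'_def by blast
      ultimately show ?thesis by blast
    qed
    have meets: "F \<inter> coord_space o' e k \<noteq> {} \<longleftrightarrow> tableau_of idx k n F \<in> set (pi_tab k n)"
      if F: "F \<in> codim_facets (braid idx n) k" for F
    proof
      assume ne: "F \<inter> coord_space o' e k \<noteq> {}"
      obtain x P where x: "F = cell x" "valid N P" "length P = k" "tableau_of idx k n F = level_rows (X x) {1..N}"
        "F \<inter> coord_space o' e k \<subseteq> {pt_of P \<epsilon>}" using facet[OF F] by blast
      have "pt_of P \<epsilon> \<in> cell x" using ne x by blast
      then have "level_rows (X x) {1..N} = level_rows (X (pt_of P \<epsilon>)) {1..N}" unfolding cell_def by (intro level_rows_eqI) auto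
      then have "tableau_of idx k n F = code_tab N P" using x tab_pt by simp
      moreover have "P \<in> set cs" using x cs by simp
      ultimately show "tableau_of idx k n F \<in> set (pi_tab k n)" unfolding pi set_map by (rule image_eqI)
    next
      assume "tableau_of idx k n F \<in> set (pi_tab k n)"
      then obtain Q where "Q \<in> set cs" "tableau_of idx k n F = code_tab N Q" unfolding pi by auto
      then show "F \<inter> coord_space o' e k \<noteq> {}" using pt_in[OF F] by blast
    qed
    have elem: "the_elem (F \<inter> coord_space o' e k) = pt_of Q \<epsilon>"
      if F: "F \<in> codim_facets (braid idx n) k" and Q: "Q \<in> set cs" "tableau_of idx k n F = code_tab N Q" for F Q
    proof -
      obtain P where sub: "F \<inter> coord_space o' e k \<subseteq> {pt_of P \<epsilon>}" using facet[OF F] by blast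
      have mem: "pt_of Q \<epsilon> \<in> F \<inter> coord_space o' e k" by (rule pt_in[OF F Q])
      have eq: "S = {b}" if "S \<subseteq> {a}" "b \<in> S" for S and a b :: "real ^ 'n"
        using that by blast
      have "F \<inter> coord_space o' e k = {pt_of Q \<epsilon>}" by (rule eq[OF sub mem])
      then show ?thesis by (simp only: the_elem_eq)
    qed
    have cs_less: "polar_less o' e (pt_of (cs ! i) \<epsilon>) (pt_of (cs ! j) \<epsilon>)" if ij: "i < j" "j < length cs" for i j
    proof -
      have "cs ! i \<in> set cs" "cs ! j \<in> set cs" using ij by auto
      then have v: "valid N (cs ! i)" "valid N (cs ! j)" "length (cs ! i) = k" "length (cs ! j) = k" using cs by auto
      \<comment> \<open>For \<open>k = 0\<close> the list has a single code, so two different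
        positions force \<open>k\<close> to be positive; the comparison of points is available for
        nonempty codes.\<close>
      have "k \<noteq> 0" using ij by (cases k) (auto simp: cs_def)
      then have "cs ! i \<noteq> []" using v by auto
      moreover have "code_less (cs ! i) (cs ! j)" using sorted_wrt_nth_less[OF srt ij] .
      ultimately show ?thesis using less v by simp
    qed
    have order: "polar_facet_less o' e k F F' \<longleftrightarrow>
             listed_before (pi_tab k n) (tableau_of idx k n F) (tableau_of idx k n F')"
      if F: "F \<in> codim_facets (braid idx n) k" "F' \<in> codim_facets (braid idx n) k"
        and ne: "F \<inter> coord_space o' e k \<noteq> {}" "F' \<inter> coord_space o' e k \<noteq> {}" for F F'
    proof
      assume pl: "polar_facet_less o' e k F F'"
      have idx_ex: "\<exists>i<length cs. t = code_tab N (cs ! i)" if t: "t \<in> set (pi_tab k n)" for t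
      proof -
        obtain Q where Q: "Q \<in> set cs" "t = code_tab N Q" using t unfolding pi set_map by (rule imageE)
        obtain i where "i < length cs" "cs ! i = Q" using Q(1) unfolding in_set_conv_nth by blast
        then show ?thesis using Q(2) by blast
      qed
      have "tableau_of idx k n F \<in> set (pi_tab k n)" "tableau_of idx k n F' \<in> set (pi_tab k n)"
        using meets[OF F(1)] meets[OF F(2)] ne by simp_all
      then obtain i j where i: "i < length cs" "tableau_of idx k n F = code_tab N (cs ! i)"
        and j: "j < length cs" "tableau_of idx k n F' = code_tab N (cs ! j)"
        using idx_ex by meson
      have "polar_less o' e (pt_of (cs ! i) \<epsilon>) (pt_of (cs ! j) \<epsilon>)"
        using pl elem[OF F(1) _ i(2)] elem[OF F(2) _ j(2)] i(1) j(1) unfolding polar_facet_less_def by simp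
      then have "\<not> polar_less o' e (pt_of (cs ! j) \<epsilon>) (pt_of (cs ! i) \<epsilon>)" "i \<noteq> j"
        using polar_less_asym polar_less_irrefl by blast+
      then have "i < j" using cs_less[of j i] i(1) by (cases i j rule: linorder_cases) auto
      then show "listed_before (pi_tab k n) (tableau_of idx k n F) (tableau_of idx k n F')"
        unfolding listed_before_def pi using i j by (intro exI[of _ i] exI[of _ j]) simp
    next
      assume "listed_before (pi_tab k n) (tableau_of idx k n F) (tableau_of idx k n F')"
      then obtain i j where ij: "i < j" "j < length cs" "code_tab N (cs ! i) = tableau_of idx k n F"
        "code_tab N (cs ! j) = tableau_of idx k n F'" unfolding listed_before_def pi by auto
      then show "polar_facet_less o' e k F F'"
        using cs_less[OF ij(1,2)] elem[OF F(1) _ ij(3)[symmetric]] elem[OF F(2) _ ij(4)[symmetric]]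
        unfolding polar_facet_less_def by simp
    qed
    show ?thesis using meets order by blast
  qed
  ultimately show ?thesis using e_orth by blast
qed

end

theorem proposition6p7:
  fixes n :: nat and idx :: "nat \<Rightarrow> 'n::finite"
  assumes "n \<ge> 1" and "bij_betw idx {1..n+1} (UNIV :: 'n set)"
  shows "\<exists>(org :: real ^ 'n) e.
    orthonormal_frame e \<and>
    generic_polar (braid idx n) org e \<and>
    (\<forall>k\<le>n.
       (\<forall>F\<in>codim_facets (braid idx n) k.
          F \<inter> coord_space org e k \<noteq> {} \<longleftrightarrow> tableau_of idx k n F \<in> set (pi_tab k n)) \<and>
       (\<forall>F\<in>codim_facets (braid idx n) k. \<forall>F'\<in>codim_facets (braid idx n) k.
          F \<inter> coord_space org e k \<noteq> {} \<and> F' \<inter> coord_space org e k \<noteq> {} \<longrightarrow>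
          (polar_facet_less org e k F F' \<longleftrightarrow>
             listed_before (pi_tab k n) (tableau_of idx k n F) (tableau_of idx k n F'))))"
proof -
  obtain \<beta> s pp where "poly_system (n + 1) (n + 1) \<beta> s pp" using poly_system_exists[of "n + 1" "n + 1"] by auto
  then interpret b: braid_polys n idx "n + 1" \<beta> s pp using assms by unfold_locales auto
  obtain e where e: "\<forall>i\<in>{1..n+1}. \<forall>j\<in>{1..n+1}. e i \<bullet> e j = (if i = j then 1 else 0)"
    "\<And>k. k \<le> n + 1 \<Longrightarrow> span (e ` {1..k}) = span (b.monom_vec ` {1..k})" "\<And>k. k \<in> {1..n+1} \<Longrightarrow> 0 < b.monom_vec k \<bullet> e k"
    using orthonormal_flag[of "n + 1" b.monom_vec] b.monom_vec_indep by blast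
  interpret braid_frame n idx "n + 1" \<beta> s pp e
    by unfold_locales (use e b.dimN in \<open>auto simp: orthonormal_frame_def\<close>)
  show ?thesis by (rule generic_polar_pi_tab)
qed

end
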